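(* Let $n\ge 2$, let $U\subset\mathbb{R}^n$ be a connected open set, let $X=(X_1,\dots,X_m)$ be smooth real vector fields on $U$ satisfying Hörmander's condition (H), and let $\Omega\subset\subset U$ be a bounded open subset with generalized Métivier index $\tilde\nu$. Assume moreover that every subunit ball has finite volume: $|B(x,r)|<+\infty$ for all $x\in U$ and $r>0$. Let $C,C_0,C_1,C_2,C_3$ be the positive constants described in the context, and let $$\lambda_1(\tilde\nu):=\inf_{u\in\mathcal{W}_{X,0}^{1,\tilde\nu}(\Omega),\ u\ne0}\frac{\int_\Omega|Xu|^{\tilde\nu}dx}{\int_\Omega|u|^{\tilde\nu}dx}>0.$$ Then for any $$0<\sigma<\frac{\tilde\nu-1}{e\tilde\nu}\,C_3^{-\frac{\tilde\nu+1}{\tilde\nu-1}}\left(\frac{C_1}{4C_0(C_1+C_2)}\right)^{\frac{\tilde\nu}{\tilde\nu-1}}\left(\frac{\lambda_1(\tilde\nu)\,C\,C_1}{\lambda_1(\tilde\nu)+1}\right)^{\frac1{\tilde\nu-1}}$$ there exists $\widetilde C>0$ such that for any $u\in\mathcal{W}^{1,\tilde\nu}_{X,0}(\Omega)$ with $\|Xu\|_{L^{\tilde\nu}(\Omega)}\le1$, $$\int_\Omega e^{\sigma|u|^{\frac{\tilde\nu}{\tilde\nu-1}}}dx\le\widetilde C|\Omega|.$$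
   Context: Condition (H): there is a (smallest) positive integer $s_0$ such that $X_1,\dots,X_m$ together with their commutators of length at most $s_0$ span $\mathbb{R}^n$ at each point of $U$. $\Omega\subset\subset U$ means $\overline\Omega$ is a compact subset of $U$. $Xu=(X_1u,\dots,X_mu)$, $|Xu|=(\sum_j|X_ju|^2)^{1/2}$. $\mathcal{W}_X^{1,p}(U)=\{u\in L^p(U):X_ju\in L^p(U),\ 1\le j\le m\}$ with $\|u\|^p=\|u\|_{L^p(U)}^p+\sum_j\|X_ju\|^p_{L^p(U)}$; $\mathcal{W}_{X,0}^{1,p}(\Omega)$ is the closure of $C_0^\infty(\Omega)$ in it. Subunit metric: $d(x,y)$ is the infimum of $\delta>0$ such that there is an absolutely continuous $\varphi:[0,1]\to U$ with $\varphi(0)=x$, $\varphi(1)=y$, $\varphi'(t)=\sum_ia_i(t)X_i(\varphi(t))$ and $\sum_i|a_i(t)|^2\le\delta^2$ for a.e. $t$. $B(x,r)=\{y\in U:d(x,y)<r\}$; $|\cdot|$ is Lebesgue measure. For $x\in U$, let $V_j(x)\subset\mathbb{R}^n$ be the span of the values at $x$ of all iterated commutators $[X_{i_1},[\dots,[X_{i_{r-1}},X_{i_r}]\dots]]$ of length $r\le j$, $\nu_j(x)=\dim V_j(x)$, $\nu_0(x)=0$, and $s(x)$ the smallest integer with $V_{s(x)}(x)=\mathbb{R}^n$; $\nu(x)=\sum_{j=1}^{s(x)}j(\nu_j(x)-\nu_{j-1}(x))$, and $\tilde\nu=\max_{x\in\overline\Omega}\nu(x)$. Nagel–Stein–Wainger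 polynomial: let $Y_1,\dots,Y_l$ enumerate all commutators $[X_{j_1},[X_{j_2},\dots[X_{j_{k-1}},X_{j_k}]\dots]]$ of lengths $k=1,\dots,s_0$, with formal degree $d(Y_i)=k$ if $Y_i$ has length $k$. For an $n$-tuple $I=(i_1,\dots,i_n)$, $1\le i_j\le l$, put $d(I)=\sum_jd(Y_{i_j})$, $\lambda_I(x)=\det(Y_{i_1},\dots,Y_{i_n})(x)$, and $\Lambda(x,r)=\sum_I|\lambda_I(x)|r^{d(I)}$. Constants: put $K=\overline\Omega$ and $\delta_K=\sup_{x,y\in K}d(x,y)$. The constants $C>0$, $0<C_1\le C_2$, $C_3>1$, and an auxiliary $\rho_K>0$, are such that: $\Lambda(x,r)\ge Cr^{\tilde\nu}$ and $C_1\Lambda(x,r)\le|B(x,r)|\le C_2\Lambda(x,r)$ for all $x\in K$, $0<r\le\max\{\delta_K,\rho_K\}$; $|B(x,2r)|\le C_3|B(x,r)|$ for all $x\in K$ and all $r$ with $0<r\le\delta_K$ or $0<r\le\rho_K/2$; and $C_3^{-1}|B(y,d(x,y))|\le|B(x,d(x,y))|\le C_3|B(y,d(x,y))|$ for all $x,y\in K$. The constant $C_0>0$ is such that for every $f\in C_0^\infty(\Omega)$ and $x\in\overline\Omega$, $|f(x)|\le C_0\int_\Omega\frac{d(x,y)}{|B(x,d(x,y))|}(|Xf(y)|+|f(y)|)dy$. (Under the assumptions such constants exist.) *)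

theory Defs
  imports "HOL-Analysis.Analysis"
begin

section \<open>Smooth functions and vector fields\<close>

text \<open>On an open set, \<open>Ck_on k S f\<close> says that \<open>f\<close> is of class \<open>C^k\<close>: partial derivatives are
  iterated with respect to the standard basis (differentiability at stage \<open>k + 1\<close> supplies the
  continuity of \<open>f\<close> itself).\<close>

primrec Ck_on ::
  "nat \<Rightarrow> 'a::euclidean_space set \<Rightarrow> ('a \<Rightarrow> 'b::real_normed_vector) \<Rightarrow> bool" where
  "Ck_on 0 S f \<longleftrightarrow> continuous_on S f"
| "Ck_on (Suc k) S f \<longleftrightarrow> (\<forall>x\<in>S. f differentiable (at x)) \<and>
     (\<forall>b\<in>Basis. Ck_on k S (\<lambda>x. frechet_derivative f (at x) b))"

definition smooth_on ::
  "'a::euclidean_space set \<Rightarrow> ('a \<Rightarrow> 'b::real_normed_vector) \<Rightarrow> bool" where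
  "smooth_on S f \<longleftrightarrow> (\<forall>k. Ck_on k S f)"

text \<open>\<open>C_0^\<infinity>(S)\<close>, as total functions vanishing outside \<open>S\<close>; thus \<open>C_0^\<infinity>(S)\<close> is contained in
  \<open>C_0^\<infinity>(T)\<close> for \<open>S \<subseteq> T\<close> without an explicit extension by zero.\<close>

definition test_functions :: "'a::euclidean_space set \<Rightarrow> ('a \<Rightarrow> real) set" where
  "test_functions S =
     {f. smooth_on UNIV f \<and> compact (closure {x. f x \<noteq> 0}) \<and> closure {x. f x \<noteq> 0} \<subseteq> S}"

definition lie_bracket ::
  "('a \<Rightarrow> 'a) \<Rightarrow> ('a \<Rightarrow> 'a) \<Rightarrow> 'a \<Rightarrow> 'a::euclidean_space" where
  "lie_bracket Y Z x =
     frechet_derivative Z (at x) (Y x) - frechet_derivative Y (at x) (Z x)"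

text \<open>The word \<open>[i1, \<dots>, ir]\<close> encodes the commutator \<open>[X_i1, [\<dots>, [X_i(r-1), X_ir] \<dots>]]\<close>, of length
  \<open>r\<close>. The empty word is a dummy and is excluded below.\<close>

fun commutator ::
  "('m \<Rightarrow> 'a \<Rightarrow> 'a) \<Rightarrow> 'm list \<Rightarrow> 'a \<Rightarrow> 'a::euclidean_space" where
  "commutator X [] = (\<lambda>_. 0)"
| "commutator X [i] = X i"
| "commutator X (i # j # w) = lie_bracket (X i) (commutator X (j # w))"

definition words :: "nat \<Rightarrow> 'm list set" where
  "words s = {w. 1 \<le> length w \<and> length w \<le> s}"

definition commutator_span ::
  "('m \<Rightarrow> 'a \<Rightarrow> 'a) \<Rightarrow> nat \<Rightarrow> 'a \<Rightarrow> 'a::euclidean_space set" where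
  "commutator_span X j x = span ((\<lambda>w. commutator X w x) ` words j)"

definition hormander_at_step ::
  "('m \<Rightarrow> 'a \<Rightarrow> 'a::euclidean_space) \<Rightarrow> 'a set \<Rightarrow> nat \<Rightarrow> bool" where
  "hormander_at_step X U s \<longleftrightarrow> 0 < s \<and> (\<forall>x\<in>U. commutator_span X s x = UNIV)"

definition hormander_condition ::
  "('m \<Rightarrow> 'a \<Rightarrow> 'a::euclidean_space) \<Rightarrow> 'a set \<Rightarrow> bool" where
  "hormander_condition X U \<longleftrightarrow> (\<exists>s. hormander_at_step X U s)"

definition hormander_index ::
  "('m \<Rightarrow> 'a \<Rightarrow> 'a::euclidean_space) \<Rightarrow> 'a set \<Rightarrow> nat" where
  "hormander_index X U = (LEAST s. hormander_at_step X U s)"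


section \<open>The generalized Metivier index\<close>

definition pointwise_step ::
  "('m \<Rightarrow> 'a \<Rightarrow> 'a) \<Rightarrow> 'a::euclidean_space \<Rightarrow> nat" where
  "pointwise_step X x = (LEAST s. commutator_span X s x = UNIV)"

text \<open>The subtraction below does not truncate, since \<open>commutator_span X j x\<close> increases with \<open>j\<close>;
  \<open>commutator_span X 0 x = {0}\<close>, which gives the convention that the dimension of index \<open>0\<close> is \<open>0\<close>.\<close>

definition pointwise_homogeneous_dim ::
  "('m \<Rightarrow> 'a \<Rightarrow> 'a) \<Rightarrow> 'a::euclidean_space \<Rightarrow> nat" where
  "pointwise_homogeneous_dim X x = (\<Sum>j = 1..pointwise_step X x.
     j * (dim (commutator_span X j x) - dim (commutator_span X (j - 1) x)))"

definition metivier_index ::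
  "('m \<Rightarrow> 'a \<Rightarrow> 'a) \<Rightarrow> 'a::euclidean_space set \<Rightarrow> nat" where
  "metivier_index X \<Omega> = Max (pointwise_homogeneous_dim X ` closure \<Omega>)"


section \<open>The subunit metric\<close>

definition abs_continuous_on_interval ::
  "real \<Rightarrow> real \<Rightarrow> (real \<Rightarrow> 'a::real_normed_vector) \<Rightarrow> bool" where
  "abs_continuous_on_interval a b \<phi> \<longleftrightarrow>
     (\<forall>\<epsilon>>0. \<exists>\<delta>>0. \<forall>D :: (real \<times> real) set.
        finite D \<and> (\<forall>(s, t)\<in>D. a \<le> s \<and> s \<le> t \<and> t \<le> b) \<and>
        pairwise (\<lambda>I J. {fst I<..<snd I} \<inter> {fst J<..<snd J} = {}) D \<and>
        (\<Sum>(s, t)\<in>D. t - s) < \<delta>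
        \<longrightarrow> (\<Sum>(s, t)\<in>D. norm (\<phi> t - \<phi> s)) < \<epsilon>)"

definition subunit_curve ::
  "('m::finite \<Rightarrow> 'a \<Rightarrow> 'a::euclidean_space) \<Rightarrow> 'a set \<Rightarrow> 'a \<Rightarrow> 'a \<Rightarrow> real \<Rightarrow> bool" where
  "subunit_curve X U x y \<delta> \<longleftrightarrow>
     (\<exists>(\<phi> :: real \<Rightarrow> 'a) (a :: 'm \<Rightarrow> real \<Rightarrow> real).
        abs_continuous_on_interval 0 1 \<phi> \<and> \<phi> ` {0..1} \<subseteq> U \<and> \<phi> 0 = x \<and> \<phi> 1 = y \<and>
        (AE t in lebesgue_on {0..1}.
           (\<phi> has_vector_derivative (\<Sum>i\<in>UNIV. a i t *\<^sub>R X i (\<phi> t))) (at t within {0..1}) \<and>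
           (\<Sum>i\<in>UNIV. \<bar>a i t\<bar>\<^sup>2) \<le> \<delta>\<^sup>2))"

text \<open>Extended values, so that the infimum makes sense before the Chow-Rashevskii theorem (finiteness
  of the distance on a connected set) is known.\<close>

definition subunit_dist ::
  "('m::finite \<Rightarrow> 'a \<Rightarrow> 'a::euclidean_space) \<Rightarrow> 'a set \<Rightarrow> 'a \<Rightarrow> 'a \<Rightarrow> ennreal" where
  "subunit_dist X U x y = Inf {ennreal \<delta> |\<delta>. 0 < \<delta> \<and> subunit_curve X U x y \<delta>}"

definition subunit_ball ::
  "('m::finite \<Rightarrow> 'a \<Rightarrow> 'a::euclidean_space) \<Rightarrow> 'a set \<Rightarrow> 'a \<Rightarrow> real \<Rightarrow> 'a set" where
  "subunit_ball X U x r = {y\<in>U. subunit_dist X U x y < ennreal r}"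

definition ball_volume ::
  "('m::finite \<Rightarrow> 'a \<Rightarrow> 'a::euclidean_space) \<Rightarrow> 'a set \<Rightarrow> 'a \<Rightarrow> real \<Rightarrow> real" where
  "ball_volume X U x r = measure lebesgue (subunit_ball X U x r)"

definition subunit_diameter ::
  "('m::finite \<Rightarrow> 'a \<Rightarrow> 'a::euclidean_space) \<Rightarrow> 'a set \<Rightarrow> 'a set \<Rightarrow> ennreal" where
  "subunit_diameter X U K = (SUP x\<in>K. SUP y\<in>K. subunit_dist X U x y)"


section \<open>The Nagel-Stein-Wainger polynomial\<close>

text \<open>The commutators \<open>Y_1, \<dots>, Y_l\<close> are indexed by the words of length at most \<open>s_0\<close>, and an
  \<open>n\<close>-tuple of them is a map \<open>I\<close> from the coordinate index type to words.\<close>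

definition nsw_polynomial ::
  "('m::finite \<Rightarrow> real^'n \<Rightarrow> real^'n) \<Rightarrow> (real^'n) set \<Rightarrow> real^'n \<Rightarrow> real \<Rightarrow> real" where
  "nsw_polynomial X U x r =
     (\<Sum>I\<in>{I :: 'n \<Rightarrow> 'm list. \<forall>k. I k \<in> words (hormander_index X U)}.
        \<bar>det (\<chi> i k. commutator X (I k) x $ i)\<bar> * r ^ (\<Sum>k\<in>UNIV. length (I k)))"


section \<open>Sobolev spaces\<close>

definition in_Lp :: "real \<Rightarrow> 'a::euclidean_space set \<Rightarrow> ('a \<Rightarrow> real) \<Rightarrow> bool" where
  "in_Lp p S u \<longleftrightarrow> u \<in> borel_measurable (lebesgue_on S) \<and>
     integrable (lebesgue_on S) (\<lambda>x. \<bar>u x\<bar> powr p)"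

definition Lp_norm ::
  "real \<Rightarrow> 'a::euclidean_space set \<Rightarrow> ('a \<Rightarrow> 'b::real_normed_vector) \<Rightarrow> real" where
  "Lp_norm p S f = (LINT x|lebesgue_on S. norm (f x) powr p) powr (1 / p)"

text \<open>The formal adjoint of \<open>Y = \<Sum>k. Y_k \<partial>_k\<close>.\<close>

definition formal_adjoint ::
  "(real^'n \<Rightarrow> real^'n) \<Rightarrow> (real^'n \<Rightarrow> real) \<Rightarrow> real^'n \<Rightarrow> real" where
  "formal_adjoint Y \<phi> x =
     - (\<Sum>k\<in>UNIV. frechet_derivative (\<lambda>z. Y z $ k * \<phi> z) (at x) (axis k 1))"

definition weak_deriv ::
  "(real^'n) set \<Rightarrow> (real^'n \<Rightarrow> real^'n) \<Rightarrow> (real^'n \<Rightarrow> real) \<Rightarrow> (real^'n \<Rightarrow> real) \<Rightarrow> bool" where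
  "weak_deriv U Y u g \<longleftrightarrow>
     (\<forall>K. compact K \<and> K \<subseteq> U \<longrightarrow> integrable (lebesgue_on K) u \<and> integrable (lebesgue_on K) g) \<and>
     (\<forall>\<phi>\<in>test_functions U.
        (LINT x|lebesgue_on U. u x * formal_adjoint Y \<phi> x) = (LINT x|lebesgue_on U. g x * \<phi> x))"

text \<open>\<open>Xu = (X_1 u, \<dots>, X_m u)\<close> in the sense of distributions; when it exists it is unique up to null
  sets, so the choice is immaterial.\<close>

definition weak_X ::
  "('m::finite \<Rightarrow> real^'n \<Rightarrow> real^'n) \<Rightarrow> (real^'n) set \<Rightarrow> (real^'n \<Rightarrow> real) \<Rightarrow> real^'n \<Rightarrow> real^'m"
  where
  "weak_X X U u = (SOME G. \<forall>j. weak_deriv U (X j) u (\<lambda>x. G x $ j))"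

definition classical_X ::
  "('m::finite \<Rightarrow> real^'n \<Rightarrow> real^'n) \<Rightarrow> (real^'n \<Rightarrow> real) \<Rightarrow> real^'n \<Rightarrow> real^'m" where
  "classical_X X f x = (\<chi> j. frechet_derivative f (at x) (X j x))"

definition W1p ::
  "('m::finite \<Rightarrow> real^'n \<Rightarrow> real^'n) \<Rightarrow> (real^'n) set \<Rightarrow> real \<Rightarrow> (real^'n \<Rightarrow> real) set" where
  "W1p X U p = {u. in_Lp p U u \<and> (\<forall>j. \<exists>g. weak_deriv U (X j) u g \<and> in_Lp p U g)}"

definition W1p_norm ::
  "('m::finite \<Rightarrow> real^'n \<Rightarrow> real^'n) \<Rightarrow> (real^'n) set \<Rightarrow> real \<Rightarrow> (real^'n \<Rightarrow> real) \<Rightarrow> real" where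
  "W1p_norm X U p u =
     (Lp_norm p U u powr p + (\<Sum>j\<in>UNIV. Lp_norm p U (\<lambda>x. weak_X X U u x $ j) powr p)) powr (1 / p)"

definition W1p_zero ::
  "('m::finite \<Rightarrow> real^'n \<Rightarrow> real^'n) \<Rightarrow> (real^'n) set \<Rightarrow> real \<Rightarrow> (real^'n) set
     \<Rightarrow> (real^'n \<Rightarrow> real) set" where
  "W1p_zero X U p \<Omega> =
     {u\<in>W1p X U p. \<forall>\<epsilon>>0. \<exists>f\<in>test_functions \<Omega>. W1p_norm X U p (\<lambda>x. f x - u x) < \<epsilon>}"

text \<open>Elements of the Sobolev space are represented by functions, so \<open>u \<noteq> 0\<close> means that \<open>u\<close> does
  not vanish almost everywhere.\<close>

definition lambda1 ::
  "('m::finite \<Rightarrow> real^'n \<Rightarrow> real^'n) \<Rightarrow> (real^'n) set \<Rightarrow> real \<Rightarrow> (real^'n) set \<Rightarrow> real" where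
  "lambda1 X U p \<Omega> =
     Inf {(LINT x|lebesgue_on \<Omega>. norm (weak_X X U u x) powr p) /
          (LINT x|lebesgue_on \<Omega>. \<bar>u x\<bar> powr p) |u.
          u \<in> W1p_zero X U p \<Omega> \<and> \<not> (AE x in lebesgue_on U. u x = 0)}"


section \<open>The structural constants\<close>

definition volume_constants ::
  "('m::finite \<Rightarrow> real^'n \<Rightarrow> real^'n) \<Rightarrow> (real^'n) set \<Rightarrow> (real^'n) set
     \<Rightarrow> real \<Rightarrow> real \<Rightarrow> real \<Rightarrow> real \<Rightarrow> real \<Rightarrow> bool" where
  "volume_constants X U \<Omega> C C1 C2 C3 \<rho> \<longleftrightarrow>
     0 < C \<and> 0 < C1 \<and> C1 \<le> C2 \<and> 1 < C3 \<and> 0 < \<rho> \<and>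
     (\<forall>x\<in>closure \<Omega>. \<forall>r>0.
        ennreal r \<le> max (subunit_diameter X U (closure \<Omega>)) (ennreal \<rho>) \<longrightarrow>
          C * r ^ metivier_index X \<Omega> \<le> nsw_polynomial X U x r \<and>
          C1 * nsw_polynomial X U x r \<le> ball_volume X U x r \<and>
          ball_volume X U x r \<le> C2 * nsw_polynomial X U x r) \<and>
     (\<forall>x\<in>closure \<Omega>. \<forall>r>0.
        ennreal r \<le> subunit_diameter X U (closure \<Omega>) \<or> r \<le> \<rho> / 2 \<longrightarrow>
          ball_volume X U x (2 * r) \<le> C3 * ball_volume X U x r) \<and>
     (\<forall>x\<in>closure \<Omega>. \<forall>y\<in>closure \<Omega>.
        let r = enn2real (subunit_dist X U x y) in
          inverse C3 * ball_volume X U y r \<le> ball_volume X U x r \<and>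
          ball_volume X U x r \<le> C3 * ball_volume X U y r)"

text \<open>The right-hand side is a nonnegative integral with values in \<open>[0, \<infinity>]\<close>, so no integrability is
  presupposed. On the diagonal, a null set, the kernel has the value \<open>0 / 0 = 0\<close>.\<close>

definition representation_constant ::
  "('m::finite \<Rightarrow> real^'n \<Rightarrow> real^'n) \<Rightarrow> (real^'n) set \<Rightarrow> (real^'n) set \<Rightarrow> real \<Rightarrow> bool" where
  "representation_constant X U \<Omega> C0 \<longleftrightarrow>
     0 < C0 \<and>
     (\<forall>f\<in>test_functions \<Omega>. \<forall>x\<in>closure \<Omega>.
        ennreal \<bar>f x\<bar> \<le> ennreal C0 *
          (\<integral>\<^sup>+ y. ennreal
             (enn2real (subunit_dist X U x y) /
                ball_volume X U x (enn2real (subunit_dist X U x y)) *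
              (norm (classical_X X f y) + \<bar>f y\<bar>)) \<partial>lebesgue_on \<Omega>))"

end

theory Submission
  imports Defs
begin

text \<open>
  That \<open>\<lambda>\<^sub>1\<close> is positive is a duality argument that avoids flows and compact embeddings. Let
  \<open>g = |f| ^ p\<close> with \<open>f\<close> a test function on \<open>\<Omega>\<close>, and call \<open>\<phi>\<close> controlled if
  \<open>|\<integral> g \<phi>| \<le> B \<Sum>\<^sub>j \<integral> |X\<^sub>j g|\<close> with \<open>B\<close> independent of \<open>f\<close>. Integration by parts controls
  \<open>X\<^sub>j\<^sup>* \<psi>\<close>, and \<open>[X, Y]\<^sup>* = Y\<^sup>* X\<^sup>* - X\<^sup>* Y\<^sup>*\<close> extends this to all commutators; since
  these span, Cramer's rule controls every \<open>\<partial>\<^sub>i \<psi>\<close> with \<open>\<psi>\<close> supported in a small box. So a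
  bump function can be translated inside such a box at bounded cost, and as \<open>U\<close> is connected it
  can be moved from anywhere to the complement of \<open>closure \<Omega>\<close>, where \<open>g\<close> vanishes. Hence
  \<open>\<integral> g \<le> B \<Sum>\<^sub>j \<integral> |X\<^sub>j g|\<close>, and Young's inequality turns this into the Poincare inequality.

  For the exponential bound, put \<open>h(x, y) = 1 / (C\<^sub>1 \<Lambda>(x, d(x, y)))\<close>. The volume bounds dominate
  the kernel \<open>d / |B(x, d)|\<close> by a multiple of \<open>h powr ((p - 1) / p)\<close> and show that
  \<open>h(x, \<cdot>) > 1 / t\<close> only on a set of measure \<open>\<le> (C\<^sub>2 / C\<^sub>1) t\<close> for small \<open>t\<close>. Hoelder's
  inequality with three factors then gives
  \<open>\<integral> |f| powr (k p / (p - 1)) \<le> A D ^ k (k + b) ^ (k + 1)\<close>, so the exponential series converges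
  for \<open>\<sigma> e D < 1\<close>, and Fatou's lemma passes to the closure of the test functions.
\<close>

section \<open>Calculus of smooth functions\<close>

text \<open>Positivity of \<open>g\<close> makes the duality usable: control passes from a test
  function to every nonnegative one below a multiple of it, so bumps may be shrunk, moved and added.
  Hence \<open>|f| ^ p\<close> instead of \<open>f\<close>; it is C^1 because
  \<open>p \<ge> 2\<close>.

  In the exponential bound the obstacle is Tonelli's theorem for \<open>h\<close>: it requires
  \<open>d\<close> to be jointly measurable, and no comparison of \<open>d\<close> with the
  Euclidean distance is at hand. The volume bounds give it instead: balls of positive volume are
  measurable, disjoint families of them are countable, so \<open>\<Omega>\<close> is separable for
  \<open>d\<close>.

  The exponent \<open>k / (k + 1)\<close> in the splitting of the kernel turns the weak type bound
  into a factor linear in \<open>k\<close>, and \<open>(k + b) ^ k / k!\<close> is at most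
  \<open>exp (k + b)\<close>; this is the \<open>e\<close> in the threshold for
  \<open>\<sigma>\<close>. Test functions close to \<open>u\<close> may have energy slightly above
  1, so the bound is proved for energy at most 2. The number 4 in the threshold absorbs this 2 and
  the factor \<open>2 powr p\<close> lost when \<open>|Xf| + |f|\<close> is split: with
  \<open>p' = p / (p - 1)\<close>,
  \<open>4 powr (- p') * 2 powr p' * 2 powr (p' - 1) = 1 / 2\<close>.\<close>

lemma Ck_on_cong:
  assumes "open S" "\<And>x. x \<in> S \<Longrightarrow> f x = g x" "Ck_on k S f"
  shows "Ck_on k S g"
  using assms(2,3)
proof (induction k arbitrary: f g)
  case 0
  then show ?case using continuous_on_cong[OF refl, of S f g] by simp
next
  case (Suc k)
  have d: "f differentiable at x" if "x \<in> S" for x using Suc.prems(2) that by simp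
  have "(g has_derivative D) (at x)" if "x \<in> S" "(f has_derivative D) (at x)" for x D
    using has_derivative_transform_within_open[OF that(2) assms(1) that(1) Suc.prems(1)] .
  with d have "\<forall>x\<in>S. g differentiable at x"
    unfolding differentiable_def by meson
  moreover have "Ck_on k S (\<lambda>x. frechet_derivative g (at x) b)" if "b \<in> Basis" for b
  proof (rule Suc.IH)
    show "frechet_derivative f (at x) b = frechet_derivative g (at x) b" if "x \<in> S" for x
      using frechet_derivative_transform_within_open[OF d[OF that] assms(1) that Suc.prems(1)] by simp
    show "Ck_on k S (\<lambda>x. frechet_derivative f (at x) b)"
      using Suc.prems(2) that by simp
  qed
  ultimately show ?case by simp
qed

text \<open>Any family \<open>D\<close> of derivatives may be exhibited; uniqueness of the
  derivative identifies it with \<open>frechet_derivative\<close>. The inductions below can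
  therefore work with explicit formulas.\<close>

lemma Ck_on_SucI:
  assumes "open S" "\<And>x. x \<in> S \<Longrightarrow> (f has_derivative D x) (at x)"
    and "\<And>b. b \<in> Basis \<Longrightarrow> Ck_on k S (\<lambda>x. D x b)"
  shows "Ck_on (Suc k) S f"
proof -
  have "Ck_on k S (\<lambda>x. frechet_derivative f (at x) b)" if "b \<in> Basis" for b
    using assms(3)[OF that]
    by (rule Ck_on_cong[OF assms(1), rotated]) (simp add: frechet_derivative_at[OF assms(2), symmetric])
  then show ?thesis using assms(2) by (auto simp: differentiable_def)
qed

lemma Ck_on_imp_continuous_on: "Ck_on k S f \<Longrightarrow> continuous_on S f"
  by (cases k) (auto intro!: continuous_at_imp_continuous_on differentiable_imp_continuous_within)

lemma Ck_on_Suc_imp: "Ck_on (Suc k) S f \<Longrightarrow> Ck_on k S f"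
proof (induction k arbitrary: f)
  case 0
  then show ?case using Ck_on_imp_continuous_on by fastforce
next
  case (Suc k)
  then show ?case by auto
qed

lemma Ck_on_subset: "Ck_on k S f \<Longrightarrow> T \<subseteq> S \<Longrightarrow> Ck_on k T f"
  by (induction k arbitrary: f) (auto intro: continuous_on_subset)

lemma Ck_on_Un:
  "open S \<Longrightarrow> open T \<Longrightarrow> Ck_on k S f \<Longrightarrow> Ck_on k T f \<Longrightarrow> Ck_on k (S \<union> T) f"
  by (induction k arbitrary: f) (auto intro: continuous_on_open_Un)

lemma Ck_on_Suc_has_derivative:
  "Ck_on (Suc k) S f \<Longrightarrow> x \<in> S \<Longrightarrow> (f has_derivative frechet_derivative f (at x)) (at x)"
  by (simp add: frechet_derivative_works[symmetric])

lemma Ck_on_const: "open S \<Longrightarrow> Ck_on k S (\<lambda>_. c)"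
proof (induction k arbitrary: c)
  case (Suc k)
  then show ?case by (intro Ck_on_SucI[where D = "\<lambda>_ _. 0"]) auto
qed simp

lemma Ck_on_add:
  "open S \<Longrightarrow> Ck_on k S f \<Longrightarrow> Ck_on k S g \<Longrightarrow> Ck_on k S (\<lambda>x. f x + g x)"
proof (induction k arbitrary: f g)
  case (Suc k)
  note der = Suc.prems(2,3)[THEN Ck_on_Suc_has_derivative]
  show ?case
    by (rule Ck_on_SucI[OF Suc.prems(1) has_derivative_add[OF der]]) (use Suc in auto)
qed (auto intro: continuous_on_add)

lemma Ck_on_sum:
  assumes "open S" "\<And>i. i \<in> I \<Longrightarrow> Ck_on k S (f i)"
  shows "Ck_on k S (\<lambda>x. \<Sum>i\<in>I. f i x)"
  using assms(2)
  by (induction I rule: infinite_finite_induct) (auto intro!: Ck_on_add Ck_on_const assms(1))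

lemma Ck_on_bounded_linear:
  assumes "open S" "bounded_linear L"
  shows "Ck_on k S f \<Longrightarrow> Ck_on k S (\<lambda>x. L (f x))"
proof (induction k arbitrary: f)
  case 0
  then show ?case using bounded_linear.continuous_on[OF assms(2)] by simp
next
  case (Suc k)
  note der = Ck_on_Suc_has_derivative[OF Suc.prems]
  have "Ck_on k S (\<lambda>x. L (frechet_derivative f (at x) b))" if "b \<in> Basis" for b
    using Suc.IH[of "\<lambda>x. frechet_derivative f (at x) b"] Suc.prems that by simp
  with Ck_on_SucI[OF assms(1) bounded_linear.has_derivative[OF assms(2) der]] show ?case by blast
qed

text \<open>One Leibniz rule for all products: each summand of the derivative pairs a derivative of
  one factor with the other factor, whose order of smoothness is lowered by one to match.\<close>

lemma Ck_on_bilinear: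
  assumes "open S" "bounded_bilinear B"
  shows "Ck_on k S f \<Longrightarrow> Ck_on k S g \<Longrightarrow> Ck_on k S (\<lambda>x. B (f x) (g x))"
proof (induction k arbitrary: f g)
  case 0
  then show ?case using assms by (auto intro: bounded_bilinear.continuous_on)
next
  case (Suc k)
  note mono = Suc.prems[THEN Ck_on_Suc_imp]
  note der = Suc.prems[THEN Ck_on_Suc_has_derivative]
  show ?case
    by (rule Ck_on_SucI[OF assms(1) bounded_bilinear.FDERIV[OF assms(2) der]])
      (use Suc.prems in \<open>auto intro!: Ck_on_add[OF assms(1)] Suc.IH mono\<close>)
qed

text \<open>The derivative of \<open>1 / f\<close> is \<open>- (1 / f) f' (1 / f)\<close>, so
  smoothness of order \<open>k\<close> of \<open>1 / f\<close> itself feeds the next order; the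
  induction keeps \<open>f\<close> fixed.\<close>

lemma Ck_on_inverse:
  fixes f :: "'a::euclidean_space \<Rightarrow> real"
  assumes "open S" "\<And>x. x \<in> S \<Longrightarrow> f x \<noteq> 0"
  shows "Ck_on k S f \<Longrightarrow> Ck_on k S (\<lambda>x. inverse (f x))"
proof (induction k)
  case 0
  then show ?case using assms by (auto intro: continuous_on_inverse)
next
  case (Suc k)
  have mult: "Ck_on k S u \<Longrightarrow> Ck_on k S v \<Longrightarrow> Ck_on k S (\<lambda>x. u x * v x)" for u v :: "'a \<Rightarrow> real"
    by (rule Ck_on_bilinear[OF assms(1) bounded_bilinear_mult])
  have IH: "Ck_on k S (\<lambda>x. inverse (f x))" using Suc Ck_on_Suc_imp by blast
  have "Ck_on k S (\<lambda>x. (-1) * (inverse (f x) * frechet_derivative f (at x) b * inverse (f x)))"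
    if "b \<in> Basis" for b
    by (intro mult IH Ck_on_const assms(1)) (use Suc.prems that in auto)
  then show ?case
    by (intro Ck_on_SucI[OF assms(1) Deriv.has_derivative_inverse[OF assms(2) Ck_on_Suc_has_derivative[OF Suc.prems]]]) auto
qed

text \<open>Differentiating \<open>h (c \<bullet> x + d)\<close> gives a constant times
  \<open>h'\<close> of the same affine function, so the class is closed under differentiation. Bumps
  are products of such ridge functions, for which this chain rule suffices.\<close>

lemma Ck_on_compose_inner:
  fixes h :: "real \<Rightarrow> real" and c :: "'a::euclidean_space"
  shows "Ck_on k UNIV h \<Longrightarrow> Ck_on k UNIV (\<lambda>x. h (c \<bullet> x + d))"
proof (induction k arbitrary: h)
  case 0
  then have "continuous_on UNIV (h \<circ> (\<lambda>x. c \<bullet> x + d))"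
    by (intro continuous_on_compose) (auto intro!: continuous_intros intro: continuous_on_subset)
  then show ?case by (simp add: o_def)
next
  case (Suc k)
  have hd: "(h has_derivative (\<lambda>v. v * frechet_derivative h (at t) 1)) (at t)" for t
  proof -
    have 1: "(h has_derivative frechet_derivative h (at t)) (at t)"
      using Ck_on_Suc_has_derivative[OF Suc.prems] by simp
    then have "frechet_derivative h (at t) v = v * frechet_derivative h (at t) 1" for v
      using linear_cmul[OF has_derivative_linear[OF 1], of v 1] by simp
    then have "frechet_derivative h (at t) = (\<lambda>v. v * frechet_derivative h (at t) 1)" by blast
    then show ?thesis using 1 by simp
  qed
  have der: "((\<lambda>x. h (c \<bullet> x + d)) has_derivative
      (\<lambda>v. (c \<bullet> v) * frechet_derivative h (at (c \<bullet> x + d)) 1)) (at x)" for x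
  proof -
    have "((\<lambda>x. c \<bullet> x + d) has_derivative (\<lambda>v. c \<bullet> v)) (at x)"
      by (auto intro!: derivative_eq_intros)
    from diff_chain_at[OF this hd] show ?thesis by (simp add: o_def)
  qed
  have h': "Ck_on k UNIV (\<lambda>x. frechet_derivative h (at (c \<bullet> x + d)) 1)"
    using Suc.IH[of "\<lambda>t. frechet_derivative h (at t) 1"] Suc.prems by simp
  show ?case
    by (rule Ck_on_SucI[OF open_UNIV der])
      (rule Ck_on_bilinear[OF open_UNIV bounded_bilinear_mult Ck_on_const[OF open_UNIV] h'])
qed

lemma smooth_on_cong:
  "open S \<Longrightarrow> (\<And>x. x \<in> S \<Longrightarrow> f x = g x) \<Longrightarrow> smooth_on S f \<Longrightarrow> smooth_on S g"
  unfolding smooth_on_def using Ck_on_cong by blast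

lemma smooth_on_subset: "smooth_on S f \<Longrightarrow> T \<subseteq> S \<Longrightarrow> smooth_on T f"
  unfolding smooth_on_def using Ck_on_subset by blast

lemma smooth_on_Un:
  "open S \<Longrightarrow> open T \<Longrightarrow> smooth_on S f \<Longrightarrow> smooth_on T f \<Longrightarrow> smooth_on (S \<union> T) f"
  unfolding smooth_on_def using Ck_on_Un by blast

lemma smooth_on_has_derivative:
  "smooth_on S f \<Longrightarrow> x \<in> S \<Longrightarrow> (f has_derivative frechet_derivative f (at x)) (at x)"
  unfolding smooth_on_def using Ck_on_Suc_has_derivative by blast

lemma smooth_on_imp_continuous_on: "smooth_on S f \<Longrightarrow> continuous_on S f"
  unfolding smooth_on_def using Ck_on_imp_continuous_on by blast

lemma smooth_on_partial:
  "smooth_on S f \<Longrightarrow> b \<in> Basis \<Longrightarrow> smooth_on S (\<lambda>x. frechet_derivative f (at x) b)"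
  unfolding smooth_on_def by (metis Ck_on.simps(2))

lemma smooth_onI_derivative:
  assumes "open S" "\<And>x. x \<in> S \<Longrightarrow> (f has_derivative D x) (at x)"
    and "\<And>b. b \<in> Basis \<Longrightarrow> smooth_on S (\<lambda>x. D x b)"
  shows "smooth_on S f"
proof -
  have "Ck_on (Suc k) S f" for k
    using assms Ck_on_SucI[of S f D k] unfolding smooth_on_def by blast
  then show ?thesis unfolding smooth_on_def using Ck_on_Suc_imp by blast
qed

lemma smooth_on_const: "open S \<Longrightarrow> smooth_on S (\<lambda>_. c)"
  by (simp add: smooth_on_def Ck_on_const)

lemma smooth_on_add:
  "open S \<Longrightarrow> smooth_on S f \<Longrightarrow> smooth_on S g \<Longrightarrow> smooth_on S (\<lambda>x. f x + g x)"
  by (simp add: smooth_on_def Ck_on_add)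

lemma smooth_on_sum:
  "open S \<Longrightarrow> (\<And>i. i \<in> I \<Longrightarrow> smooth_on S (f i)) \<Longrightarrow> smooth_on S (\<lambda>x. \<Sum>i\<in>I. f i x)"
  by (simp add: smooth_on_def Ck_on_sum)

lemma smooth_on_bounded_linear:
  "open S \<Longrightarrow> bounded_linear L \<Longrightarrow> smooth_on S f \<Longrightarrow> smooth_on S (\<lambda>x. L (f x))"
  by (simp add: smooth_on_def Ck_on_bounded_linear)

lemma smooth_on_uminus: "open S \<Longrightarrow> smooth_on S f \<Longrightarrow> smooth_on S (\<lambda>x. - f x)"
  by (rule smooth_on_bounded_linear) (auto intro: bounded_linear_minus bounded_linear_ident)

lemma smooth_on_diff:
  "open S \<Longrightarrow> smooth_on S f \<Longrightarrow> smooth_on S g \<Longrightarrow> smooth_on S (\<lambda>x. f x - g x)"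
  using smooth_on_add[of S f "\<lambda>x. - g x"] smooth_on_uminus by fastforce

lemma smooth_on_scaleR:
  "open S \<Longrightarrow> smooth_on S f \<Longrightarrow> smooth_on S g \<Longrightarrow> smooth_on S (\<lambda>x. f x *\<^sub>R g x)"
  by (simp add: smooth_on_def Ck_on_bilinear[OF _ bounded_bilinear_scaleR])

lemma smooth_on_mult:
  fixes f g :: "'a::euclidean_space \<Rightarrow> real"
  shows "open S \<Longrightarrow> smooth_on S f \<Longrightarrow> smooth_on S g \<Longrightarrow> smooth_on S (\<lambda>x. f x * g x)"
  by (simp add: smooth_on_def Ck_on_bilinear[OF _ bounded_bilinear_mult])

lemma smooth_on_prod:
  fixes f :: "'i \<Rightarrow> 'a::euclidean_space \<Rightarrow> real"
  assumes "open S" "\<And>i. i \<in> I \<Longrightarrow> smooth_on S (f i)"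
  shows "smooth_on S (\<lambda>x. \<Prod>i\<in>I. f i x)"
  using assms(2)
  by (induction I rule: infinite_finite_induct) (auto intro!: smooth_on_mult smooth_on_const assms(1))

lemma smooth_on_inverse:
  fixes f :: "'a::euclidean_space \<Rightarrow> real"
  shows "open S \<Longrightarrow> (\<And>x. x \<in> S \<Longrightarrow> f x \<noteq> 0) \<Longrightarrow> smooth_on S f \<Longrightarrow> smooth_on S (\<lambda>x. inverse (f x))"
  by (simp add: smooth_on_def Ck_on_inverse)

lemma smooth_on_compose_inner:
  fixes h :: "real \<Rightarrow> real" and c :: "'a::euclidean_space"
  shows "smooth_on UNIV h \<Longrightarrow> smooth_on UNIV (\<lambda>x. h (c \<bullet> x + d))"
  by (simp add: smooth_on_def Ck_on_compose_inner)

lemma linear_Basis_expansion: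
  fixes L :: "'a::euclidean_space \<Rightarrow> 'b::real_vector"
  assumes "linear L"
  shows "L v = (\<Sum>b\<in>Basis. (v \<bullet> b) *\<^sub>R L b)"
proof -
  have "L v = L (\<Sum>b\<in>Basis. (v \<bullet> b) *\<^sub>R b)" by (simp add: euclidean_representation)
  then show ?thesis by (simp add: linear_sum[OF assms] linear_cmul[OF assms])
qed

text \<open>\<open>Ck_on\<close> iterates derivatives along constant basis vectors only; expanding
  \<open>Y x\<close> in the basis reduces a variable direction to these.\<close>

lemma smooth_on_directional:
  fixes f :: "'a::euclidean_space \<Rightarrow> 'b::real_normed_vector"
  assumes "open S" "smooth_on S f" "smooth_on S Y"
  shows "smooth_on S (\<lambda>x. frechet_derivative f (at x) (Y x))"
proof -
  have "smooth_on S (\<lambda>x. \<Sum>b\<in>Basis. (Y x \<bullet> b) *\<^sub>R frechet_derivative f (at x) b)"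
    by (rule smooth_on_sum[OF assms(1)], rule smooth_on_scaleR[OF assms(1)
          smooth_on_bounded_linear[OF assms(1) bounded_linear_inner_left assms(3)] smooth_on_partial[OF assms(2)]])
  then show ?thesis
  proof (rule smooth_on_cong[OF assms(1), rotated])
    fix x assume "x \<in> S"
    then have l: "linear (frechet_derivative f (at x))"
      using smooth_on_has_derivative[OF assms(2)] has_derivative_linear by blast
    show "(\<Sum>b\<in>Basis. (Y x \<bullet> b) *\<^sub>R frechet_derivative f (at x) b) = frechet_derivative f (at x) (Y x)"
      by (rule linear_Basis_expansion[OF l, symmetric])
  qed
qed

lemma smooth_on_lie_bracket:
  "open S \<Longrightarrow> smooth_on S Y \<Longrightarrow> smooth_on S Z \<Longrightarrow> smooth_on S (lie_bracket Y Z)"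
  unfolding lie_bracket_def by (intro smooth_on_diff smooth_on_directional)

lemma smooth_on_commutator:
  assumes "open S" "\<And>j. smooth_on S (X j)"
  shows "smooth_on S (commutator X w)"
  using assms(2)
  by (induction X w rule: commutator.induct)
    (auto intro!: smooth_on_const smooth_on_lie_bracket assms(1))

text \<open>Vector fields are smooth on \<open>U\<close> only, whereas test functions are total.
  Smoothness is local, and \<open>N\<close> together with the complement of \<open>K\<close> covers
  the space; in this way a product with a coefficient defined on \<open>U\<close> becomes a test
  function.\<close>

lemma smooth_on_extend_zero:
  assumes "open N" "smooth_on N f" "closed K" "K \<subseteq> N" "\<And>x. x \<notin> K \<Longrightarrow> f x = 0"
  shows "smooth_on UNIV f"
proof -
  have "smooth_on (- K) f"
    using smooth_on_cong[of "- K" "\<lambda>_. 0" f] smooth_on_const[of "- K" 0] assms(3,5) by (simp add: open_Compl)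
  then have "smooth_on (N \<union> - K) f" using smooth_on_Un[OF assms(1) _ assms(2)] assms(3) by (simp add: open_Compl)
  moreover have "N \<union> - K = UNIV" using assms(4) by blast
  ultimately show ?thesis by simp
qed

section \<open>Symmetry of second derivatives, and the Lie bracket as a commutator of
  derivations\<close>

lemma has_real_derivative_line:
  fixes f :: "'a::real_normed_vector \<Rightarrow> real"
  assumes "(f has_derivative f') (at (x + s *\<^sub>R v))"
  shows "((\<lambda>s. f (x + s *\<^sub>R v)) has_real_derivative f' v) (at s)"
proof -
  have "((\<lambda>s. x + s *\<^sub>R v) has_derivative (\<lambda>r. r *\<^sub>R v)) (at s)"
    by (auto intro!: derivative_eq_intros)
  from diff_chain_at[OF this assms] show ?thesis
    using linear_cmul[OF has_derivative_linear[OF assms]]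
    by (simp add: o_def has_field_derivative_def mult_commute_abs)
qed

lemma frechet_derivative_eq_0_outside:
  fixes f :: "'a::real_normed_vector \<Rightarrow> real"
  assumes "closed K" "\<And>x. x \<notin> K \<Longrightarrow> f x = 0" "x \<notin> K"
  shows "frechet_derivative f (at x) = (\<lambda>_. 0)"
proof -
  have "((\<lambda>_. 0::real) has_derivative (\<lambda>_. 0)) (at x)" by simp
  then have "(f has_derivative (\<lambda>_. 0)) (at x)"
    by (rule has_derivative_transform_within_open[of _ _ _ _ "- K"])
      (use assms in \<open>auto simp: open_Compl\<close>)
  from frechet_derivative_at[OF this, symmetric] show ?thesis .
qed

text \<open>The left side of the identity is a second difference that is symmetric in
  \<open>i\<close> and \<open>j\<close>. The mean value theorem, applied along \<open>i\<close> to
  the difference in direction \<open>j\<close> and then along \<open>j\<close>, turns it into a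
  single value of the mixed derivative.\<close>

lemma frechet_derivative_directional_bounds:
  fixes f :: "'a::euclidean_space \<Rightarrow> real"
  assumes S: "open S" and f: "Ck_on (Suc (Suc 0)) S f"
    and i: "i \<in> Basis" and j: "j \<in> Basis" and t: "0 < t" and sub: "cball x (2 * t) \<subseteq> S"
  obtains y where "dist x y \<le> 2 * t"
    "f (x + t *\<^sub>R i + t *\<^sub>R j) - f (x + t *\<^sub>R i) - f (x + t *\<^sub>R j) + f x =
      t\<^sup>2 * frechet_derivative (\<lambda>z. frechet_derivative f (at z) i) (at y) j"
proof -
  let ?fi = "\<lambda>z. frechet_derivative f (at z) i"
  have in_S: "x + a *\<^sub>R i + b *\<^sub>R j \<in> S" and d: "dist x (x + a *\<^sub>R i + b *\<^sub>R j) \<le> 2 * t"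
    if "0 \<le> a" "a \<le> t" "0 \<le> b" "b \<le> t" for a b
  proof -
    have "norm (a *\<^sub>R i + b *\<^sub>R j) \<le> a + b"
      using norm_triangle_ineq[of "a *\<^sub>R i" "b *\<^sub>R j"] i j that by simp
    also have "\<dots> \<le> 2 * t" using that by simp
    finally show "dist x (x + a *\<^sub>R i + b *\<^sub>R j) \<le> 2 * t"
      by (simp add: dist_norm norm_minus_commute add.assoc add.commute[of "b *\<^sub>R j"])
    then show "x + a *\<^sub>R i + b *\<^sub>R j \<in> S" using sub by auto
  qed
  have chain: "((\<lambda>s. h (p + s *\<^sub>R v)) has_real_derivative frechet_derivative h (at (p + s *\<^sub>R v)) v) (at s)"
    if "h differentiable at (p + s *\<^sub>R v)" for h :: "'a \<Rightarrow> real" and p v s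
    using that by (intro has_real_derivative_line) (simp add: frechet_derivative_works)
  have fd: "f differentiable at z" "?fi differentiable at z" if "z \<in> S" for z
    using f i that by auto
  define \<phi> where "\<phi> s = f (x + t *\<^sub>R j + s *\<^sub>R i) - f (x + s *\<^sub>R i)" for s
  have "(\<phi> has_real_derivative ?fi (x + t *\<^sub>R j + s *\<^sub>R i) - ?fi (x + s *\<^sub>R i)) (at s)"
    if "0 \<le> s" "s \<le> t" for s
    unfolding \<phi>_def
    by (intro DERIV_diff chain fd) (use in_S[of s t] in_S[of s 0] that t in \<open>auto simp: algebra_simps\<close>)
  from MVT2[OF t, of \<phi>, OF this] obtain s where s: "0 < s" "s < t"
    "\<phi> t - \<phi> 0 = t * (?fi (x + t *\<^sub>R j + s *\<^sub>R i) - ?fi (x + s *\<^sub>R i))" by auto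
  have "((\<lambda>r. ?fi (x + s *\<^sub>R i + r *\<^sub>R j)) has_real_derivative
      frechet_derivative ?fi (at (x + s *\<^sub>R i + r *\<^sub>R j)) j) (at r)" if "0 \<le> r" "r \<le> t" for r
    by (intro chain fd in_S) (use s that in auto)
  from MVT2[OF t this] obtain r where r: "0 < r" "r < t"
    "?fi (x + s *\<^sub>R i + t *\<^sub>R j) - ?fi (x + s *\<^sub>R i + 0 *\<^sub>R j) =
      (t - 0) * frechet_derivative ?fi (at (x + s *\<^sub>R i + r *\<^sub>R j)) j" by blast
  show ?thesis
  proof (rule that)
    show "dist x (x + s *\<^sub>R i + r *\<^sub>R j) \<le> 2 * t" using d s r by simp
    have "\<phi> t - \<phi> 0 = t * (t * frechet_derivative ?fi (at (x + s *\<^sub>R i + r *\<^sub>R j)) j)"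
      using s(3) r(3) by (simp add: algebra_simps)
    then show "f (x + t *\<^sub>R i + t *\<^sub>R j) - f (x + t *\<^sub>R i) - f (x + t *\<^sub>R j) + f x =
      t\<^sup>2 * frechet_derivative ?fi (at (x + s *\<^sub>R i + r *\<^sub>R j)) j"
      by (simp add: \<phi>_def algebra_simps power2_eq_square)
  qed
qed

text \<open>Schwarz's theorem. Exchanging \<open>i\<close> and \<open>j\<close> leaves the second
  difference unchanged, so the two mixed derivatives take the same value at points
  \<open>Y n i j\<close> and \<open>Y n j i\<close> that both tend to \<open>x\<close>; their
  continuity finishes the argument.\<close>

lemma frechet_derivative_commute:
  fixes f :: "'a::euclidean_space \<Rightarrow> real"
  assumes S: "open S" and f: "Ck_on (Suc (Suc 0)) S f"
    and i: "i \<in> Basis" and j: "j \<in> Basis" and x: "x \<in> S"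
  shows "frechet_derivative (\<lambda>z. frechet_derivative f (at z) i) (at x) j =
    frechet_derivative (\<lambda>z. frechet_derivative f (at z) j) (at x) i"
proof -
  define G where "G i j y = frechet_derivative (\<lambda>z. frechet_derivative f (at z) i) (at y) j" for i j y
  obtain r where r: "0 < r" "cball x r \<subseteq> S" using S x open_contains_cball by blast
  have cont: "isCont (G i j) x" if "i \<in> Basis" "j \<in> Basis" for i j
    using f that S x continuous_on_eq_continuous_at unfolding G_def by (simp, blast)
  define T where "T n = r / 2 / real (Suc n)" for n
  have T: "0 < T n" "2 * T n \<le> r" for n
    using r(1) unfolding T_def by (auto simp: field_simps)
  have sub: "cball x (2 * T n) \<subseteq> S" for n using T(2)[of n] r(2) subset_cball by (meson order_trans)
  define P where "P n i j y \<longleftrightarrow> dist x y \<le> 2 * T n \<and>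
      f (x + T n *\<^sub>R i + T n *\<^sub>R j) - f (x + T n *\<^sub>R i) - f (x + T n *\<^sub>R j) + f x = (T n)\<^sup>2 * G i j y" for n i j y
  define Y where "Y n i j = (SOME y. P n i j y)" for n i j
  have "P n i j (Y n i j)" if "i \<in> Basis" "j \<in> Basis" for n i j
    unfolding Y_def
  proof (rule someI_ex)
    show "\<exists>y. P n i j y"
      using frechet_derivative_directional_bounds[OF S f that T(1) sub] unfolding G_def P_def by blast
  qed
  then have Y: "\<And>n i j. i \<in> Basis \<Longrightarrow> j \<in> Basis \<Longrightarrow> dist x (Y n i j) \<le> 2 * T n"
    "\<And>n i j. i \<in> Basis \<Longrightarrow> j \<in> Basis \<Longrightarrow>
      f (x + T n *\<^sub>R i + T n *\<^sub>R j) - f (x + T n *\<^sub>R i) - f (x + T n *\<^sub>R j) + f x = (T n)\<^sup>2 * G i j (Y n i j)"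
    unfolding P_def by blast+
  have T0: "T \<longlonglongrightarrow> 0" unfolding T_def by (intro LIMSEQ_Suc[OF lim_const_over_n])
  have lim: "(\<lambda>n. G i j (Y n i j)) \<longlonglongrightarrow> G i j x" if "i \<in> Basis" "j \<in> Basis" for i j
  proof (rule isCont_tendsto_compose[OF cont[OF that]])
    have *: "(\<lambda>n. 2 * T n) \<longlonglongrightarrow> 0" using tendsto_mult_right_zero[OF T0] by simp
    have "norm (dist (Y n i j) x) \<le> 2 * T n" for n
      using Y(1)[OF that, of n] by (subst dist_commute) simp
    then have "(\<lambda>n. dist (Y n i j) x) \<longlonglongrightarrow> 0"
      by (rule Lim_null_comparison[OF always_eventually[OF allI] *])
    then show "(\<lambda>n. Y n i j) \<longlonglongrightarrow> x" by (subst tendsto_dist_iff)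
  qed
  have "G i j (Y n i j) = G j i (Y n j i)" for n
  proof -
    have "(T n)\<^sup>2 * G i j (Y n i j) = (T n)\<^sup>2 * G j i (Y n j i)"
      unfolding Y(2)[OF i j, symmetric] Y(2)[OF j i, symmetric] by (simp add: algebra_simps)
    then show ?thesis using T(1)[of n] by simp
  qed
  then have "G i j x = G j i x"
    using lim[OF i j] lim[OF j i] LIMSEQ_unique by simp
  then show ?thesis unfolding G_def .
qed

text \<open>Each iterated derivative splits into a part that differentiates the coefficients of the
  inner field and a second-order part that contracts the Hessian \<open>?H\<close> with both fields.
  The second-order parts cancel by symmetry of \<open>?H\<close>; the difference of the others is
  the derivative along the bracket.\<close>

lemma lie_bracket_derivative:
  fixes f :: "'a::euclidean_space \<Rightarrow> real"
  assumes S: "open S" and x: "x \<in> S" and f: "smooth_on S f" and X: "smooth_on S X" and Y: "smooth_on S Y"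
  shows "frechet_derivative (\<lambda>z. frechet_derivative f (at z) (Y z)) (at x) (X x) -
      frechet_derivative (\<lambda>z. frechet_derivative f (at z) (X z)) (at x) (Y x) =
    frechet_derivative f (at x) (lie_bracket X Y x)"
proof -
  let ?p = "\<lambda>b z. frechet_derivative f (at z) b"
  let ?H = "\<lambda>b c. frechet_derivative (?p b) (at x) c"
  have lin: "linear (frechet_derivative f (at z))" if "z \<in> S" for z
    using smooth_on_has_derivative[OF f that] has_derivative_linear by blast
  have exp: "frechet_derivative f (at z) v = (\<Sum>b\<in>Basis. (v \<bullet> b) * ?p b z)" if "z \<in> S" for z v
    using linear_Basis_expansion[OF lin[OF that], of v] by simp
  have Hexp: "frechet_derivative (?p b) (at x) v = (\<Sum>c\<in>Basis. (v \<bullet> c) * ?H b c)" if "b \<in> Basis" for b v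
    using linear_Basis_expansion[OF has_derivative_linear[OF smooth_on_has_derivative[OF smooth_on_partial[OF f that] x]], of v]
    by simp
  have main: "frechet_derivative (\<lambda>z. frechet_derivative f (at z) (Y z)) (at x) v =
      frechet_derivative f (at x) (frechet_derivative Y (at x) v) +
      (\<Sum>b\<in>Basis. \<Sum>c\<in>Basis. (Y x \<bullet> b) * (v \<bullet> c) * ?H b c)"
    if Y: "smooth_on S Y" for Y v
  proof -
    have Y': "((\<lambda>z. Y z \<bullet> b) has_derivative (\<lambda>v. frechet_derivative Y (at x) v \<bullet> b)) (at x)" for b
      by (rule bounded_linear.has_derivative[OF bounded_linear_inner_left smooth_on_has_derivative[OF Y x]])
    have "((\<lambda>z. \<Sum>b\<in>Basis. (Y z \<bullet> b) * ?p b z) has_derivative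
      (\<lambda>v. \<Sum>b\<in>Basis. (Y x \<bullet> b) * ?H b v + (frechet_derivative Y (at x) v \<bullet> b) * ?p b x)) (at x)"
      by (intro has_derivative_sum has_derivative_mult Y' smooth_on_has_derivative[OF smooth_on_partial[OF f] x])
    then have "((\<lambda>z. frechet_derivative f (at z) (Y z)) has_derivative
      (\<lambda>v. \<Sum>b\<in>Basis. (Y x \<bullet> b) * ?H b v + (frechet_derivative Y (at x) v \<bullet> b) * ?p b x)) (at x)"
      by (rule has_derivative_transform_within_open[OF _ S x]) (simp add: exp)
    from fun_cong[OF frechet_derivative_at[OF this], of v, symmetric]
    moreover have "(\<Sum>b\<in>Basis. (Y x \<bullet> b) * ?H b v) = (\<Sum>b\<in>Basis. \<Sum>c\<in>Basis. (Y x \<bullet> b) * (v \<bullet> c) * ?H b c)"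
    proof (intro sum.cong refl)
      fix b :: 'a assume "b \<in> Basis"
      show "(Y x \<bullet> b) * ?H b v = (\<Sum>c\<in>Basis. (Y x \<bullet> b) * (v \<bullet> c) * ?H b c)"
        unfolding Hexp[OF \<open>b \<in> Basis\<close>, of v] by (simp add: sum_distrib_left mult.assoc)
    qed
    ultimately show ?thesis
      unfolding exp[OF x, of "frechet_derivative Y (at x) v"] by (simp add: sum.distrib)
  qed
  have sym: "?H b c = ?H c b" if "b \<in> Basis" "c \<in> Basis" for b c
    using frechet_derivative_commute[OF S _ that x] f unfolding smooth_on_def by blast
  have "(\<Sum>b\<in>Basis. \<Sum>c\<in>Basis. (Y x \<bullet> b) * (X x \<bullet> c) * ?H b c) =
        (\<Sum>c\<in>Basis. \<Sum>b\<in>Basis. (Y x \<bullet> b) * (X x \<bullet> c) * ?H b c)"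
    by (rule sum.swap)
  also have "\<dots> = (\<Sum>b\<in>Basis. \<Sum>c\<in>Basis. (X x \<bullet> b) * (Y x \<bullet> c) * ?H b c)"
    using sym by (intro sum.cong refl) (simp add: mult.commute)
  finally have sw: "(\<Sum>b\<in>Basis. \<Sum>c\<in>Basis. (Y x \<bullet> b) * (X x \<bullet> c) * ?H b c) =
    (\<Sum>b\<in>Basis. \<Sum>c\<in>Basis. (X x \<bullet> b) * (Y x \<bullet> c) * ?H b c)" .
  show ?thesis
    unfolding main[OF X] main[OF Y] sw lie_bracket_def linear_diff[OF lin[OF x]] by simp
qed

text \<open>The powers of \<open>inverse x\<close> make the family closed under differentiation, as induction on the order requires.\<close>

definition exp_inv :: "nat \<Rightarrow> real \<Rightarrow> real" where
  "exp_inv n x = (if x \<le> 0 then 0 else inverse x ^ n * exp (- inverse x))"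

lemma exp_inv_tendsto_0: "(exp_inv n \<longlongrightarrow> 0) (at 0)"
proof (rule filterlim_split_at)
  show "(exp_inv n \<longlongrightarrow> 0) (at_left 0)"
    by (rule tendsto_eventually) (auto simp: exp_inv_def eventually_at_filter)
  have "((\<lambda>x::real. inverse x ^ n / exp (inverse x)) \<longlongrightarrow> 0) (at_right 0)"
    by (rule filterlim_compose[OF tendsto_power_div_exp_0 filterlim_inverse_at_top_right])
  then show "(exp_inv n \<longlongrightarrow> 0) (at_right 0)"
    by (rule Lim_transform_eventually)
      (auto simp: exp_inv_def eventually_at_filter exp_minus divide_inverse)
qed

lemma exp_inv_has_derivative:
  "(exp_inv n has_real_derivative exp_inv (n + 2) x - real n * exp_inv (n + 1) x) (at x)"
proof (cases x "0::real" rule: linorder_cases)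
  case less
  have "((\<lambda>_. 0) has_real_derivative 0) (at x)" by simp
  then have "(exp_inv n has_real_derivative 0) (at x)"
    by (rule has_field_derivative_transform_within_open[of _ _ _ "{..<0}"]) (use less in \<open>auto simp: exp_inv_def\<close>)
  then show ?thesis using less by (simp add: exp_inv_def)
next
  case equal
  \<comment> \<open>The difference quotient of \<open>exp_inv n\<close> at 0 is
    \<open>exp_inv (Suc n)\<close>, which tends to 0.\<close>
  have "((\<lambda>h. (exp_inv n (0 + h) - exp_inv n 0) / h) \<longlongrightarrow> 0) (at 0)"
    by (rule Lim_transform_eventually[OF exp_inv_tendsto_0[of "Suc n"]])
      (auto simp: exp_inv_def eventually_at_filter divide_inverse)
  then have "(exp_inv n has_real_derivative 0) (at 0)" by (simp add: DERIV_def)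
  then show ?thesis using equal by (simp add: exp_inv_def)
next
  case greater
  have "((\<lambda>x. inverse x ^ n * exp (- inverse x)) has_real_derivative
      inverse x ^ (n + 2) * exp (- inverse x) - real n * (inverse x ^ (n + 1) * exp (- inverse x))) (at x)"
  proof -
    have inv: "(inverse has_real_derivative - (inverse x ^ 2)) (at x)"
      using DERIV_inverse[of x UNIV] greater by (simp add: power2_eq_square)
    have pow: "((\<lambda>x. inverse x ^ n) has_real_derivative - (real n * inverse x ^ (n + 1))) (at x)"
      using DERIV_power[OF inv, of n] by (cases n) (simp_all add: power2_eq_square mult_ac)
    show ?thesis
      using DERIV_mult[OF pow DERIV_chain2[OF DERIV_exp DERIV_minus[OF inv]]]
      by (simp add: algebra_simps power2_eq_square)
  qed
  then have "(exp_inv n has_real_derivative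
      inverse x ^ (n + 2) * exp (- inverse x) - real n * (inverse x ^ (n + 1) * exp (- inverse x))) (at x)"
    by (rule has_field_derivative_transform_within_open[of _ _ _ "{0<..}"]) (use greater in \<open>auto simp: exp_inv_def\<close>)
  then show ?thesis using greater by (simp add: exp_inv_def)
qed

lemma Ck_on_exp_inv: "Ck_on k UNIV (exp_inv n)"
proof (induction k arbitrary: n)
  case 0
  show ?case
    using exp_inv_has_derivative by (auto intro!: continuous_at_imp_continuous_on DERIV_isCont)
next
  case (Suc k)
  have "Ck_on k UNIV (\<lambda>x. exp_inv (n + 2) x + (- real n) *\<^sub>R exp_inv (n + 1) x)"
    by (rule Ck_on_add[OF open_UNIV Suc.IH Ck_on_bounded_linear[OF open_UNIV bounded_linear_scaleR_right Suc.IH]])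
  then have "Ck_on k UNIV (\<lambda>x. (exp_inv (n + 2) x - real n * exp_inv (n + 1) x) * b)" if "b \<in> Basis" for b
    using that by simp
  then show ?case
    using Ck_on_SucI[OF open_UNIV exp_inv_has_derivative[unfolded has_field_derivative_def]] by blast
qed

lemma smooth_on_exp_inv: "smooth_on UNIV (exp_inv n)"
  by (simp add: smooth_on_def Ck_on_exp_inv)

lemma smooth_on_real_antiderivative:
  fixes F f :: "real \<Rightarrow> real"
  assumes "\<And>x. (F has_real_derivative f x) (at x)" "smooth_on UNIV f"
  shows "smooth_on UNIV F"
  by (rule smooth_onI_derivative[OF open_UNIV assms(1)[unfolded has_field_derivative_def]])
    (use assms(2) in simp)

section \<open>Test functions and integration by parts\<close>

lemma test_functionsI:
  assumes "smooth_on UNIV f" "compact K" "K \<subseteq> S" "\<And>x. x \<notin> K \<Longrightarrow> f x = 0"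
  shows "f \<in> test_functions S"
proof -
  have sub: "closure {x. f x \<noteq> 0} \<subseteq> K"
    using assms(4) by (intro closure_minimal compact_imp_closed[OF assms(2)]) blast
  then have "compact (closure {x. f x \<noteq> 0})"
    using compact_Int_closed[OF assms(2) closed_closure, of "{x. f x \<noteq> 0}"] by (simp add: Int_absorb1)
  then show ?thesis using sub assms(1,3) unfolding test_functions_def by blast
qed

lemma test_functionsE:
  assumes "f \<in> test_functions S"
  obtains K where "smooth_on UNIV f" "compact K" "K \<subseteq> S" "\<And>x. x \<notin> K \<Longrightarrow> f x = 0"
proof (rule that)
  show "f x = 0" if "x \<notin> closure {x. f x \<noteq> 0}" for x
    using that closure_subset[of "{x. f x \<noteq> 0}"] by blast
qed (use assms in \<open>simp_all add: test_functions_def\<close>)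

lemma test_functions_mono: "f \<in> test_functions S \<Longrightarrow> S \<subseteq> T \<Longrightarrow> f \<in> test_functions T"
  unfolding test_functions_def by blast

lemma test_functions_eq_0: "f \<in> test_functions S \<Longrightarrow> x \<notin> S \<Longrightarrow> f x = 0"
  by (metis test_functionsE subsetD)

lemma test_functions_smooth: "f \<in> test_functions S \<Longrightarrow> smooth_on UNIV f"
  unfolding test_functions_def by blast

lemma test_functions_mult_smooth:
  assumes "open U" "smooth_on U a" "\<phi> \<in> test_functions U"
  shows "(\<lambda>x. a x * \<phi> x) \<in> test_functions U"
proof -
  obtain K where K: "smooth_on UNIV \<phi>" "compact K" "K \<subseteq> U" "\<And>x. x \<notin> K \<Longrightarrow> \<phi> x = 0"
    using test_functionsE[OF assms(3)] by blast
  have "smooth_on U (\<lambda>x. a x * \<phi> x)"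
    by (intro smooth_on_mult assms smooth_on_subset[OF K(1)]) auto
  then have "smooth_on UNIV (\<lambda>x. a x * \<phi> x)"
    by (rule smooth_on_extend_zero[OF assms(1) _ compact_imp_closed[OF K(2)] K(3)]) (simp add: K(4))
  then show ?thesis by (rule test_functionsI[OF _ K(2,3)]) (simp add: K(4))
qed

lemma test_functions_add:
  assumes "f \<in> test_functions S" "g \<in> test_functions S"
  shows "(\<lambda>x. f x + g x) \<in> test_functions S"
proof -
  obtain K where K: "smooth_on UNIV f" "compact K" "K \<subseteq> S" "\<And>x. x \<notin> K \<Longrightarrow> f x = 0"
    using test_functionsE[OF assms(1)] by blast
  obtain L where L: "smooth_on UNIV g" "compact L" "L \<subseteq> S" "\<And>x. x \<notin> L \<Longrightarrow> g x = 0"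
    using test_functionsE[OF assms(2)] by blast
  show ?thesis
    by (rule test_functionsI[OF smooth_on_add[OF open_UNIV K(1) L(1)] compact_Un[OF K(2) L(2)]])
      (use K L in auto)
qed

lemma test_functions_uminus: "f \<in> test_functions S \<Longrightarrow> (\<lambda>x. - f x) \<in> test_functions S"
  unfolding test_functions_def by (simp add: smooth_on_uminus)

lemma test_functions_diff:
  "f \<in> test_functions S \<Longrightarrow> g \<in> test_functions S \<Longrightarrow> (\<lambda>x. f x - g x) \<in> test_functions S"
  using test_functions_add[of f S "\<lambda>x. - g x"] test_functions_uminus by fastforce

lemma test_functions_0: "(\<lambda>_. 0) \<in> test_functions S"
  by (rule test_functionsI[of _ "{}"]) (auto intro: smooth_on_const)

lemma test_functions_sum:
  "(\<And>i. i \<in> I \<Longrightarrow> f i \<in> test_functions S) \<Longrightarrow> (\<lambda>x. \<Sum>i\<in>I. f i x) \<in> test_functions S"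
  by (induction I rule: infinite_finite_induct) (simp_all add: test_functions_0 test_functions_add)

lemma test_functions_partial:
  assumes "f \<in> test_functions S" "b \<in> Basis"
  shows "(\<lambda>x. frechet_derivative f (at x) b) \<in> test_functions S"
proof -
  obtain K where K: "smooth_on UNIV f" "compact K" "K \<subseteq> S" "\<And>x. x \<notin> K \<Longrightarrow> f x = 0"
    using test_functionsE[OF assms(1)] by blast
  have "frechet_derivative f (at x) b = 0" if "x \<notin> K" for x
    using frechet_derivative_eq_0_outside[OF compact_imp_closed[OF K(2)] K(4) that] by simp
  then show ?thesis
    by (intro test_functionsI[OF smooth_on_partial[OF K(1) assms(2)] K(2,3)])
qed

lemma formal_adjoint_test_function:
  fixes Y :: "real^'n \<Rightarrow> real^'n"
  assumes U: "open U" and Y: "smooth_on U Y" and \<phi>: "\<phi> \<in> test_functions U"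
  shows "formal_adjoint Y \<phi> \<in> test_functions U"
proof -
  have "(\<lambda>z. Y z $ k * \<phi> z) \<in> test_functions U" for k
    by (rule test_functions_mult_smooth[OF U _ \<phi>])
      (rule smooth_on_bounded_linear[OF U bounded_linear_vec_nth Y])
  then have "(\<lambda>x. frechet_derivative (\<lambda>z. Y z $ k * \<phi> z) (at x) (axis k 1)) \<in> test_functions U" for k
    by (rule test_functions_partial) (simp add: axis_in_Basis_iff)
  then show ?thesis
    unfolding formal_adjoint_def by (intro test_functions_uminus test_functions_sum)
qed

text \<open>The factor \<open>r\<close> controls steepness: as \<open>r\<close> grows, the functions
  converge to the indicator of the open box while their support stays in the closed box. One formula
  thus gives both bumps and an approximation of indicators by test functions.\<close>

definition box_bump :: "real \<Rightarrow> 'a::euclidean_space \<Rightarrow> 'a \<Rightarrow> 'a \<Rightarrow> real" where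
  "box_bump r a b x = (\<Prod>i\<in>Basis. exp_inv 0 (r * (x \<bullet> i - a \<bullet> i)) * exp_inv 0 (r * (b \<bullet> i - x \<bullet> i)))"

lemma exp_inv_0_bounds: "0 \<le> exp_inv 0 x" "exp_inv 0 x \<le> 1" "x \<le> 0 \<Longrightarrow> exp_inv 0 x = 0" "0 < x \<Longrightarrow> 0 < exp_inv 0 x"
  by (auto simp: exp_inv_def)

lemma smooth_on_box_bump: "smooth_on UNIV (box_bump r a b)"
proof -
  have "smooth_on UNIV (\<lambda>x. exp_inv 0 (r * (x \<bullet> i - a \<bullet> i)) * exp_inv 0 (r * (b \<bullet> i - x \<bullet> i)))" for i
    using smooth_on_compose_inner[OF smooth_on_exp_inv, of 0 "r *\<^sub>R i" "- r * (a \<bullet> i)"]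
      smooth_on_compose_inner[OF smooth_on_exp_inv, of 0 "(- r) *\<^sub>R i" "r * (b \<bullet> i)"]
    by (intro smooth_on_mult open_UNIV) (simp_all add: algebra_simps inner_commute)
  then show ?thesis unfolding box_bump_def[abs_def] by (intro smooth_on_prod open_UNIV)
qed

lemma box_bump_bounds: "0 \<le> box_bump r a b x" "box_bump r a b x \<le> 1"
  unfolding box_bump_def
  by (auto intro!: prod_nonneg prod_le_1 mult_le_one exp_inv_0_bounds mult_nonneg_nonneg)

lemma box_bump_eq_0:
  assumes "0 < r" "x \<notin> box a b"
  shows "box_bump r a b x = 0"
proof -
  obtain i where i: "i \<in> Basis" "x \<bullet> i \<le> a \<bullet> i \<or> b \<bullet> i \<le> x \<bullet> i"
    using assms(2) by (auto simp: mem_box not_less)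
  then have "r * (x \<bullet> i - a \<bullet> i) \<le> 0 \<or> r * (b \<bullet> i - x \<bullet> i) \<le> 0"
    using assms(1) by (auto simp: mult_le_0_iff)
  then show ?thesis
    unfolding box_bump_def using i(1) by (auto intro!: prod_zero bexI[of _ i] simp: exp_inv_0_bounds)
qed

lemma box_bump_pos: "0 < r \<Longrightarrow> x \<in> box a b \<Longrightarrow> 0 < box_bump r a b x"
  unfolding box_bump_def by (auto intro!: prod_pos mult_pos_pos exp_inv_0_bounds simp: mem_box)

lemma box_bump_test_function: "0 < r \<Longrightarrow> cbox a b \<subseteq> S \<Longrightarrow> box_bump r a b \<in> test_functions S"
  by (rule test_functionsI[OF smooth_on_box_bump compact_cbox])
    (auto intro!: box_bump_eq_0 dest: subsetD[OF box_subset_cbox])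

lemma box_bump_tendsto_indicator:
  "(\<lambda>n. box_bump (real (Suc n)) a b x) \<longlonglongrightarrow> indicator (box a b) x"
proof (cases "x \<in> box a b")
  case True
  have *: "(\<lambda>n. exp_inv 0 (real (Suc n) * t)) \<longlonglongrightarrow> 1" if "0 < t" for t
  proof -
    have "(\<lambda>n. exp (- (inverse (real (Suc n)) * inverse t))) \<longlonglongrightarrow> exp (- (0 * inverse t))"
      by (intro tendsto_intros LIMSEQ_inverse_real_of_nat)
    then show ?thesis
      using that by (simp add: exp_inv_def inverse_mult_distrib not_le mult_le_0_iff del: of_nat_Suc)
  qed
  have "(\<lambda>n. box_bump (real (Suc n)) a b x) \<longlonglongrightarrow> (\<Prod>i\<in>(Basis::'a set). 1 * 1)"
    unfolding box_bump_def using True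
    by (intro tendsto_prod tendsto_mult *) (auto simp: mem_box)
  then show ?thesis using True by simp
next
  case False
  then show ?thesis by (simp add: box_bump_eq_0 del: of_nat_Suc)
qed

section \<open>Integration by parts\<close>

lemma integrable_compact_support:
  fixes f :: "'a::euclidean_space \<Rightarrow> real"
  assumes "continuous_on UNIV f" "compact K" "\<And>x. x \<notin> K \<Longrightarrow> f x = 0"
  shows "integrable lborel f"
proof -
  have "integrable lborel (\<lambda>x. indicator K x *\<^sub>R f x)"
    using borel_integrable_compact[OF assms(2)] assms(1) continuous_on_subset by blast
  moreover have "(\<lambda>x. indicator K x *\<^sub>R f x) = f" using assms(3) by (intro ext) (auto simp: indicator_def)
  ultimately show ?thesis by simp
qed

lemma integral_directional_derivative_eq_0:
  fixes F :: "'a::euclidean_space \<Rightarrow> real"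
  assumes der: "\<And>x. (F has_derivative F' x) (at x)" and cont: "continuous_on UNIV (\<lambda>x. F' x v)"
    and K: "compact K" "\<And>x. x \<notin> K \<Longrightarrow> F x = 0"
  shows "integral\<^sup>L lborel (\<lambda>x. F' x v) = 0"
proof -
  text \<open>The difference quotients have integral 0 by translation invariance and converge dominatedly.\<close>
  have Fc: "continuous_on UNIV F"
    using der by (auto intro!: continuous_at_imp_continuous_on has_derivative_continuous)
  have F'0: "F' x v = 0" if "x \<notin> K" for x
    by (simp add: frechet_derivative_at[OF der] frechet_derivative_eq_0_outside[OF compact_imp_closed[OF K(1)] K(2) that])
  obtain B where B: "0 < B" "\<And>x. \<bar>F' x v\<bar> \<le> B"
  proof -
    have "bounded ((\<lambda>x. F' x v) ` K)"
      by (intro compact_imp_bounded compact_continuous_image continuous_on_subset[OF cont] K) simp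
    then obtain B where B: "0 < B" "\<And>x. x \<in> K \<Longrightarrow> \<bar>F' x v\<bar> \<le> B" by (auto simp: bounded_pos)
    show ?thesis using that[of B] B F'0 by (metis abs_zero less_imp_le)
  qed
  obtain r where r: "\<And>x. x \<in> K \<Longrightarrow> norm x \<le> r" using compact_imp_bounded[OF K(1)] by (auto simp: bounded_iff)
  have line: "((\<lambda>s. F (x + s *\<^sub>R v)) has_real_derivative F' (x + s *\<^sub>R v) v) (at s)" for x s
    by (rule has_real_derivative_line[OF der])
  define h where "h n = inverse (real (Suc n))" for n
  have h: "0 < h n" "h n \<le> 1" for n unfolding h_def by (auto simp: field_simps)
  \<comment> \<open>By the mean value theorem \<open>G\<close> is bounded by \<open>B\<close>, and
    since \<open>h n \<le> 1\<close> it vanishes outside the ball of radius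
    \<open>r + norm v\<close>; this is the integrable majorant.\<close>
  define G where "G n x = (F (x + h n *\<^sub>R v) - F x) / h n" for n x
  have G_bound: "\<bar>G n x\<bar> \<le> B * indicator (cball 0 (r + norm v)) x" for n x
  proof (cases "x \<in> cball 0 (r + norm v)")
    case True
    obtain s where "F (x + h n *\<^sub>R v) - F (x + 0 *\<^sub>R v) = (h n - 0) * F' (x + s *\<^sub>R v) v"
      using MVT2[OF h(1)[of n], of "\<lambda>s. F (x + s *\<^sub>R v)" "\<lambda>s. F' (x + s *\<^sub>R v) v"] line by blast
    then have "G n x = F' (x + s *\<^sub>R v) v" unfolding G_def using h(1)[of n] by simp
    then show ?thesis using B True by simp
  next
    case False
    then have *: "norm x > r + norm v" by simp
    then have "x \<notin> K" using r by (smt (verit) norm_ge_zero)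
    moreover have "norm x \<le> norm (x + h n *\<^sub>R v) + norm (h n *\<^sub>R v)"
      using norm_triangle_ineq4[of "x + h n *\<^sub>R v" "h n *\<^sub>R v"] by simp
    moreover have "norm (h n *\<^sub>R v) \<le> norm v" using h[of n] by (simp add: mult_left_le_one_le)
    ultimately have "x + h n *\<^sub>R v \<notin> K" using r * by (smt (verit))
    with \<open>x \<notin> K\<close> show ?thesis unfolding G_def using K False by simp
  qed
  have int_F: "integrable lborel F" by (rule integrable_compact_support[OF Fc K])
  have shift: "integrable lborel (\<lambda>x. F (x + c))" "integral\<^sup>L lborel (\<lambda>x. F (x + c)) = integral\<^sup>L lborel F" for c
  proof -
    have m: "(\<lambda>x. x + c) \<in> measurable lborel borel" by simp
    have m2: "F \<in> borel_measurable borel" using Fc by (rule borel_measurable_continuous_onI)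
    have eq: "distr lborel borel (\<lambda>x. x + c) = lborel"
      using lborel_distr_plus[of c] by (simp add: add.commute[of _ c])
    show "integrable lborel (\<lambda>x. F (x + c))" using int_F integrable_distr_eq[OF m m2] by (simp add: eq)
    show "integral\<^sup>L lborel (\<lambda>x. F (x + c)) = integral\<^sup>L lborel F"
      using integral_distr[OF m m2] by (simp add: eq)
  qed
  have G0: "integral\<^sup>L lborel (G n) = 0" for n
    unfolding G_def using shift(1) int_F by (simp add: shift(2))
  have G_lim: "(\<lambda>n. G n x) \<longlonglongrightarrow> F' x v" for x
  proof -
    have "((\<lambda>s. (F (x + s *\<^sub>R v) - F x) / s) \<longlongrightarrow> F' x v) (at 0)"
      using line[of x 0] by (simp add: DERIV_def)
    moreover have "filterlim h (at 0) sequentially"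
      unfolding filterlim_at h_def using LIMSEQ_inverse_real_of_nat by (auto intro: always_eventually)
    ultimately show ?thesis unfolding G_def by (rule filterlim_compose)
  qed
  have "(\<lambda>n. integral\<^sup>L lborel (G n)) \<longlonglongrightarrow> integral\<^sup>L lborel (\<lambda>x. F' x v)"
  proof (rule integral_dominated_convergence[where w = "\<lambda>x. B * indicator (cball 0 (r + norm v)) x"])
    show "(\<lambda>x. F' x v) \<in> borel_measurable lborel" using cont by (simp add: borel_measurable_continuous_onI)
    show "G n \<in> borel_measurable lborel" for n
      using shift(1) int_F unfolding G_def by auto
    show "integrable lborel (\<lambda>x. B * indicator (cball 0 (r + norm v)) x :: real)"
      by (intro integrable_mult_right integrable_real_indicator) (use emeasure_bounded_finite[OF bounded_cball[of 0 "r + norm v"]] in \<open>auto simp: less_top[symmetric]\<close>)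
  qed (use G_lim G_bound in auto)
  then show ?thesis using LIMSEQ_unique G0 by (simp add: LIMSEQ_const_iff)
qed

text \<open>The definitions integrate over \<open>lebesgue_on\<close>, while the translation
  argument lives on \<open>lborel\<close>. For a Borel function that vanishes outside
  \<open>S\<close> the two integrals coincide, so computations can move between the two
  settings.\<close>

lemma integral_lebesgue_on_eq_lborel:
  fixes f :: "'a::euclidean_space \<Rightarrow> real"
  assumes "f \<in> borel_measurable borel" "S \<in> sets lebesgue" "\<And>x. x \<notin> S \<Longrightarrow> f x = 0"
  shows "integral\<^sup>L (lebesgue_on S) f = integral\<^sup>L lborel f"
    and "integrable (lebesgue_on S) f \<longleftrightarrow> integrable lborel f"
proof -
  have eq: "(\<lambda>x. if x \<in> S then f x else 0) = f" using assms(3) by auto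
  show "integral\<^sup>L (lebesgue_on S) f = integral\<^sup>L lborel f"
    using Lebesgue_Measure.integral_restrict_UNIV[OF assms(2), of f] assms(1)
    by (simp add: eq integral_completion)
  show "integrable (lebesgue_on S) f \<longleftrightarrow> integrable lborel f"
    using Lebesgue_Measure.integrable_restrict_UNIV[OF assms(2), of f] assms(1)
    by (simp add: eq integrable_completion)
qed

text \<open>Each \<open>a k\<close>, the product of \<open>\<phi>\<close> and a component of
  \<open>Y\<close>, has compact support in \<open>U\<close>, so the \<open>k\<close>-th partial
  derivative of \<open>g\<close> times \<open>a k\<close> has integral 0. One derivative of
  \<open>g\<close> is enough; this matters since \<open>|f| ^ p\<close> need not be smooth.\<close>

lemma integral_formal_adjoint:
  fixes g :: "real^'n \<Rightarrow> real" and Y :: "real^'n \<Rightarrow> real^'n"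
  assumes U: "open U" and Y: "smooth_on U Y" and \<phi>: "\<phi> \<in> test_functions U"
    and g: "Ck_on (Suc 0) UNIV g"
  shows "(LINT x|lebesgue_on U. g x * formal_adjoint Y \<phi> x) =
    (LINT x|lebesgue_on U. frechet_derivative g (at x) (Y x) * \<phi> x)"
proof -
  define a where "a k x = Y x $ k * \<phi> x" for k x
  have a: "a k \<in> test_functions U" for k
    unfolding a_def
    by (rule test_functions_mult_smooth[OF U _ \<phi>])
      (rule smooth_on_bounded_linear[OF U bounded_linear_vec_nth Y])
  define e where "e k = (axis k 1 :: real^'n)" for k
  have e: "e k \<in> Basis" for k unfolding e_def by (simp add: axis_in_Basis_iff)
  have da: "(\<lambda>x. frechet_derivative (a k) (at x) (e k)) \<in> test_functions U" for k
    by (rule test_functions_partial[OF a e])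
  have gd: "(g has_derivative frechet_derivative g (at x)) (at x)" for x
    using Ck_on_Suc_has_derivative[OF g] by simp
  have g_cont: "continuous_on UNIV g" by (rule Ck_on_imp_continuous_on[OF g])
  have dg_cont: "continuous_on UNIV (\<lambda>x. frechet_derivative g (at x) b)" if "b \<in> Basis" for b
    using g that by simp
  have test_cont: "continuous_on UNIV f" if "f \<in> test_functions U" for f :: "real^'n \<Rightarrow> real"
    using smooth_on_imp_continuous_on[OF test_functions_smooth[OF that]] .
  have int: "integrable lborel (\<lambda>x. u x * f x)"
    if u: "continuous_on UNIV u" and f: "f \<in> test_functions U" for u f :: "real^'n \<Rightarrow> real"
  proof -
    obtain K where K: "compact K" "\<And>x. x \<notin> K \<Longrightarrow> f x = 0" using test_functionsE[OF f] by metis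
    show ?thesis
      by (rule integrable_compact_support[OF continuous_on_mult[OF u test_cont[OF f]] K(1)]) (simp add: K(2))
  qed
  have zero: "integral\<^sup>L lborel (\<lambda>x. g x * frechet_derivative (a k) (at x) (e k)) +
      integral\<^sup>L lborel (\<lambda>x. frechet_derivative g (at x) (e k) * a k x) = 0" for k
  proof -
    obtain K where K: "compact K" "\<And>x. x \<notin> K \<Longrightarrow> a k x = 0" using test_functionsE[OF a] by metis
    have "integral\<^sup>L lborel (\<lambda>x. g x * frechet_derivative (a k) (at x) (e k) + frechet_derivative g (at x) (e k) * a k x) = 0"
    proof (rule integral_directional_derivative_eq_0[where F = "\<lambda>x. g x * a k x" and K = K and v = "e k"
        and F' = "\<lambda>x v. g x * frechet_derivative (a k) (at x) v + frechet_derivative g (at x) v * a k x"])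
      show "((\<lambda>x. g x * a k x) has_derivative
        (\<lambda>v. g x * frechet_derivative (a k) (at x) v + frechet_derivative g (at x) v * a k x)) (at x)" for x
        by (intro has_derivative_mult gd smooth_on_has_derivative[OF test_functions_smooth[OF a]]) simp
      show "continuous_on UNIV (\<lambda>x. g x * frechet_derivative (a k) (at x) (e k) + frechet_derivative g (at x) (e k) * a k x)"
        by (intro continuous_on_add continuous_on_mult g_cont dg_cont e test_cont[OF a] test_cont[OF da])
    qed (use K in auto)
    then show ?thesis
      by (simp add: Bochner_Integration.integral_add int[OF g_cont da] int[OF dg_cont[OF e] a])
  qed
  have expand: "frechet_derivative g (at x) (Y x) * \<phi> x = (\<Sum>k\<in>UNIV. frechet_derivative g (at x) (e k) * a k x)" for x
  proof -
    have l: "linear (frechet_derivative g (at x))" using gd has_derivative_linear by blast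
    have "(\<Sum>k\<in>UNIV. (Y x $ k) *\<^sub>R e k) = Y x"
      using basis_expansion[of "Y x"] unfolding e_def by (simp add: scalar_mult_eq_scaleR)
    then have "frechet_derivative g (at x) (Y x) = frechet_derivative g (at x) (\<Sum>k\<in>UNIV. (Y x $ k) *\<^sub>R e k)"
      by simp
    also have "\<dots> = (\<Sum>k\<in>UNIV. Y x $ k * frechet_derivative g (at x) (e k))"
      unfolding linear_sum[OF l] using linear_cmul[OF l] by simp
    finally show ?thesis by (simp add: a_def sum_distrib_left mult_ac)
  qed
  have "(LINT x|lebesgue_on U. g x * formal_adjoint Y \<phi> x) = integral\<^sup>L lborel (\<lambda>x. g x * formal_adjoint Y \<phi> x)"
    by (rule integral_lebesgue_on_eq_lborel)
      (use U test_functions_eq_0[OF formal_adjoint_test_function[OF U Y \<phi>]]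
        continuous_on_mult[OF g_cont test_cont[OF formal_adjoint_test_function[OF U Y \<phi>]]]
        in \<open>auto intro: borel_measurable_continuous_onI\<close>)
  also have "\<dots> = integral\<^sup>L lborel (\<lambda>x. - (\<Sum>k\<in>UNIV. g x * frechet_derivative (a k) (at x) (e k)))"
    by (rule Bochner_Integration.integral_cong) (auto simp: formal_adjoint_def a_def[abs_def] e_def sum_distrib_left)
  also have "\<dots> = - (\<Sum>k\<in>UNIV. integral\<^sup>L lborel (\<lambda>x. g x * frechet_derivative (a k) (at x) (e k)))"
    by (simp add: Bochner_Integration.integral_sum int[OF g_cont da])
  also have "\<dots> = (\<Sum>k\<in>UNIV. integral\<^sup>L lborel (\<lambda>x. frechet_derivative g (at x) (e k) * a k x))"
    unfolding sum_negf[symmetric] using zero by (intro sum.cong refl) (smt (verit))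
  also have "\<dots> = integral\<^sup>L lborel (\<lambda>x. \<Sum>k\<in>UNIV. frechet_derivative g (at x) (e k) * a k x)"
    by (simp add: Bochner_Integration.integral_sum int[OF dg_cont[OF e] a])
  also have "\<dots> = integral\<^sup>L lborel (\<lambda>x. frechet_derivative g (at x) (Y x) * \<phi> x)"
    unfolding expand ..
  also have "\<dots> = (LINT x|lebesgue_on U. frechet_derivative g (at x) (Y x) * \<phi> x)"
  proof (rule integral_lebesgue_on_eq_lborel(1)[symmetric])
    show "(\<lambda>x. frechet_derivative g (at x) (Y x) * \<phi> x) \<in> borel_measurable borel"
      unfolding expand by (intro borel_measurable_continuous_onI continuous_on_sum continuous_on_mult dg_cont e test_cont[OF a])
  qed (use U test_functions_eq_0[OF \<phi>] in auto)
  finally show ?thesis .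
qed

text \<open>The steep bumps on \<open>box c d\<close> are test functions on \<open>U\<close> and
  converge boundedly to its indicator; the restriction of \<open>|u|\<close> to
  \<open>cbox c d\<close> dominates the passage to the limit.\<close>

lemma integral_box_eq_0:
  fixes u :: "'a::euclidean_space \<Rightarrow> real"
  assumes U: "open U" and loc: "integrable (lebesgue_on (cbox c d)) u" and sub: "cbox c d \<subseteq> U"
    and zero: "\<And>\<phi>. \<phi> \<in> test_functions U \<Longrightarrow> (LINT x|lebesgue_on U. u x * \<phi> x) = 0"
  shows "(LINT x|lebesgue. indicator (box c d) x * u x) = 0"
proof -
  define v where "v x = (if x \<in> cbox c d then u x else 0)" for x
  have v: "integrable lebesgue v"
    unfolding v_def using Lebesgue_Measure.integrable_restrict_UNIV[of "cbox c d" u] loc by simp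
  have bm: "box_bump r c d \<in> borel_measurable lebesgue" for r
    using smooth_on_imp_continuous_on[OF smooth_on_box_bump]
    by (intro measurable_completion) (auto intro: borel_measurable_continuous_onI)
  have 0: "(LINT x|lebesgue. v x * box_bump (real (Suc n)) c d x) = 0" for n
  proof -
    let ?b = "box_bump (real (Suc n)) c d"
    have "(LINT x|lebesgue. v x * ?b x) = (LINT x|lebesgue. (if x \<in> U then u x * ?b x else 0))"
      using sub by (intro Bochner_Integration.integral_cong refl)
        (auto simp: v_def intro!: box_bump_eq_0 dest: subsetD[OF box_subset_cbox])
    also have "\<dots> = (LINT x|lebesgue_on U. u x * ?b x)"
      by (rule Lebesgue_Measure.integral_restrict_UNIV) (use U in auto)
    also have "\<dots> = 0" by (rule zero, rule box_bump_test_function[OF _ sub]) simp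
    finally show ?thesis .
  qed
  have "(\<lambda>n. LINT x|lebesgue. v x * box_bump (real (Suc n)) c d x) \<longlonglongrightarrow>
    (LINT x|lebesgue. v x * indicator (box c d) x)"
  proof (rule integral_dominated_convergence[where w = "\<lambda>x. \<bar>v x\<bar>"])
    show "(\<lambda>x. v x * indicator (box c d) x) \<in> borel_measurable lebesgue"
      using v by (intro borel_measurable_times borel_measurable_indicator) auto
    show "(\<lambda>x. v x * box_bump (real (Suc n)) c d x) \<in> borel_measurable lebesgue" for n
      using v bm by (intro borel_measurable_times) auto
    show "integrable lebesgue (\<lambda>x. \<bar>v x\<bar>)" using v by simp
    show "AE x in lebesgue. (\<lambda>n. v x * box_bump (real (Suc n)) c d x) \<longlonglongrightarrow> v x * indicator (box c d) x"
      by (intro AE_I2 tendsto_mult tendsto_const box_bump_tendsto_indicator)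
    show "AE x in lebesgue. norm (v x * box_bump (real (Suc n)) c d x) \<le> \<bar>v x\<bar>" for n
      by (intro AE_I2) (auto simp: abs_mult box_bump_bounds mult_left_le simp del: of_nat_Suc)
  qed
  then have "(LINT x|lebesgue. v x * indicator (box c d) x) = 0"
    unfolding 0 by (simp add: LIMSEQ_const_iff)
  moreover have "v x * indicator (box c d) x = indicator (box c d) x * u x" for x
    using box_subset_cbox[of c d] by (auto simp: v_def indicator_def)
  ultimately show ?thesis by simp
qed

text \<open>Boxes form an intersection-stable generator of the Borel sets, so by the pi-lambda
  theorem \<open>w\<close> integrates to 0 over every Borel set. The assumption \<open>w0\<close> on
  the total integral serves the complements.\<close>

lemma AE_eq_0_if_box_integrals_eq_0:
  fixes w :: "'a::euclidean_space \<Rightarrow> real"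
  assumes w: "integrable lborel w" and w0: "integral\<^sup>L lborel w = 0"
    and box: "\<And>c d. (LINT x|lborel. indicator (box c d) x * w x) = 0"
  shows "AE x in lborel. w x = 0"
proof (rule sigma_finite_measure.density_zero[OF lborel.sigma_finite_measure_axioms w])
  fix A :: "'a set" assume "A \<in> sets lborel"
  then have A: "A \<in> sigma_sets UNIV (range (\<lambda>(a, b). box a b))"
    by (simp add: borel_eq_box)
  let ?G = "range (\<lambda>(a, b). box a b) :: 'a set set"
  have stable: "Int_stable ?G" by (auto simp: Int_stable_def box_Int_box)
  show "set_lebesgue_integral lborel A w = 0"
  proof (rule sigma_sets_induct_disjoint[OF stable _ A, where P = "\<lambda>A. set_lebesgue_integral lborel A w = 0"])
    show "set_lebesgue_integral lborel A w = 0" if "A \<in> ?G" for A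
      using that box by (auto simp: set_lebesgue_integral_def)
    show "set_lebesgue_integral lborel {} w = 0" by (simp add: set_lebesgue_integral_def)
    show "set_lebesgue_integral lborel (UNIV - A) w = 0"
      if "A \<in> sigma_sets UNIV ?G" "set_lebesgue_integral lborel A w = 0" for A
    proof -
      have A: "A \<in> sets lborel" using that(1) by (simp add: borel_eq_box)
      have "set_lebesgue_integral lborel (UNIV - A) w =
          (LINT x|lborel. w x - indicator A x *\<^sub>R w x)"
        unfolding set_lebesgue_integral_def
        by (intro Bochner_Integration.integral_cong) (auto simp: indicator_def)
      also have "\<dots> = integral\<^sup>L lborel w - set_lebesgue_integral lborel A w"
        unfolding set_lebesgue_integral_def
        by (intro Bochner_Integration.integral_diff w integrable_mult_indicator A)
      finally show ?thesis using that w0 by simp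
    qed
    show "set_lebesgue_integral lborel (\<Union>i. A i) w = 0"
      if "disjoint_family A" "range A \<subseteq> sigma_sets UNIV ?G" "\<And>i. set_lebesgue_integral lborel (A i) w = 0"
      for A :: "nat \<Rightarrow> 'a set"
    proof -
      have A: "A i \<in> sets lborel" for i using that(2) by (auto simp: borel_eq_box)
      have "set_lebesgue_integral lborel (\<Union>i. A i) w = (\<Sum>i. set_lebesgue_integral lborel (A i) w)"
      proof (rule lebesgue_integral_countable_add[OF A])
        show "i \<noteq> j \<Longrightarrow> A i \<inter> A j = {}" for i j using that(1) by (auto simp: disjoint_family_on_def)
        show "set_integrable lborel (\<Union>i. A i) w"
          unfolding set_integrable_def by (intro integrable_mult_indicator w sets.countable_UN) (use A in auto)
      qed
      then show ?thesis using that(3) by simp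
    qed
  qed auto
qed

text \<open>The fundamental lemma of the calculus of variations for locally integrable functions. It
  is proved on one closed box at a time, where \<open>u\<close> is integrable, and extended to
  \<open>U\<close> by a countable cover.\<close>

lemma fundamental_lemma:
  fixes u :: "'a::euclidean_space \<Rightarrow> real"
  assumes U: "open U" and loc: "\<And>K. compact K \<Longrightarrow> K \<subseteq> U \<Longrightarrow> integrable (lebesgue_on K) u"
    and zero: "\<And>\<phi>. \<phi> \<in> test_functions U \<Longrightarrow> (LINT x|lebesgue_on U. u x * \<phi> x) = 0"
  shows "AE x in lebesgue_on U. u x = 0"
proof -
  have cb: "AE x in lebesgue. x \<in> cbox a b \<longrightarrow> u x = 0" if ab: "cbox a b \<subseteq> U" for a b
  proof -
    define v where "v x = (if x \<in> cbox a b then u x else 0)" for x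
    have v: "integrable lebesgue v"
      unfolding v_def using Lebesgue_Measure.integrable_restrict_UNIV[of "cbox a b" u] loc[OF compact_cbox ab] by simp
    \<comment> \<open>\<open>u\<close> is only Lebesgue measurable, whereas the pi-lambda argument
      runs over Borel sets; a Borel version \<open>v'\<close> that agrees almost everywhere bridges
      the gap.\<close>
    then have "v \<in> borel_measurable (completion lborel)" by simp
    then obtain v' where v': "v' \<in> borel_measurable lborel" "AE x in lborel. v x = v' x"
      using completion_ex_borel_measurable_real by blast
    then have ae: "AE x in lebesgue. v x = v' x" by (simp add: AE_completion)
    have int_v': "integrable lborel v'"
    proof -
      have m: "v' \<in> borel_measurable lebesgue" using v'(1) by (simp add: measurable_completion)
      have "integrable lebesgue v'"
        using integrable_cong_AE[OF _ m ae] v by auto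
      then show ?thesis using integrable_completion[of v' lborel] v'(1) by simp
    qed
    define w where "w x = indicator (box a b) x * v' x" for x
    have int_w: "integrable lborel w"
      unfolding w_def using integrable_mult_indicator[OF _ int_v', of "box a b"] by simp
    have boxes: "(LINT x|lborel. indicator (box c d) x * w x) = 0" for c d
    proof -
      \<comment> \<open>Every box has to be tested. Cutting it down to \<open>box a b\<close> gives
        another box; if that is nonempty, its closure lies in \<open>cbox a b\<close> and hence in
        \<open>U\<close>.\<close>
      obtain c' d' where cd: "box c d \<inter> box a b = box c' d'" by (auto simp: box_Int_box)
      have "(LINT x|lborel. indicator (box c d) x * w x) = (LINT x|lebesgue. indicator (box c d) x * w x)"
        using int_w by (intro integral_completion[symmetric] borel_measurable_times) auto
      also have "\<dots> = (LINT x|lebesgue. indicator (box c' d') x * u x)"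
      proof (rule integral_cong_AE)
        show "AE x in lebesgue. indicator (box c d) x * w x = indicator (box c' d') x * u x"
          using ae
        proof eventually_elim
          case (elim x)
          then show ?case
            unfolding cd[symmetric] w_def v_def using box_subset_cbox[of a b]
            by (auto simp: indicator_def split: if_splits)
        qed
        show "(\<lambda>x. indicator (box c d) x * w x) \<in> borel_measurable lebesgue"
          using int_w by (intro measurable_completion borel_measurable_times) auto
        have "(\<lambda>x. indicator (box c' d') x * u x) = (\<lambda>x. indicator (box c' d') x * v x)"
          unfolding cd[symmetric] v_def using box_subset_cbox[of a b] by (intro ext) (auto simp: indicator_def)
        also have "\<dots> \<in> borel_measurable lebesgue"
          using v by (intro borel_measurable_times borel_measurable_indicator) auto
        finally show "(\<lambda>x. indicator (box c' d') x * u x) \<in> borel_measurable lebesgue" .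
      qed
      also have "\<dots> = 0"
      proof (cases "box c' d' = {}")
        case False
        have "cbox c' d' = closure (box c' d')" using False by (simp add: closure_box)
        also have "\<dots> \<subseteq> cbox a b"
          unfolding cd[symmetric] using box_subset_cbox[of a b] by (intro closure_minimal) auto
        finally have sub: "cbox c' d' \<subseteq> U" using ab by blast
        show ?thesis by (rule integral_box_eq_0[OF U loc[OF compact_cbox sub] sub zero])
      qed simp
      finally show ?thesis .
    qed
    have "(\<lambda>x. indicator (box a b) x * w x) = w" by (intro ext) (auto simp: w_def indicator_def)
    then have w0: "integral\<^sup>L lborel w = 0" using boxes[of a b] by metis
    have "AE x in lborel. w x = 0" by (rule AE_eq_0_if_box_integrals_eq_0[OF int_w w0 boxes])
    then have w_ae: "AE x in lebesgue. w x = 0" by (simp add: AE_completion)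
    have "AE x in lebesgue. x \<notin> cbox a b - box a b"
      by (rule AE_not_in) (use negligible_frontier_interval[of a b] in \<open>simp add: negligible_iff_null_sets\<close>)
    with w_ae ae show ?thesis
      by eventually_elim (auto simp: w_def v_def indicator_def split: if_splits)
  qed
  obtain D where D: "countable D" "D \<subseteq> Pow U" "\<And>X. X \<in> D \<Longrightarrow> \<exists>a b. X = cbox a b" "\<Union>D = U"
    using open_countable_Union_open_cbox[OF U] by metis
  have "AE x in lebesgue. \<forall>Q\<in>D. x \<in> Q \<longrightarrow> u x = 0"
    unfolding AE_ball_countable[OF D(1)]
  proof
    fix Q assume "Q \<in> D"
    with D(2,3) obtain a b where "Q = cbox a b" "cbox a b \<subseteq> U" by blast
    with cb show "AE x in lebesgue. x \<in> Q \<longrightarrow> u x = 0" by simp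
  qed
  then have "AE x in lebesgue. x \<in> U \<longrightarrow> u x = 0"
    by eventually_elim (use D(4) in blast)
  then show ?thesis using U by (simp add: AE_restrict_space_iff)
qed

section \<open>Weak derivatives\<close>

lemma integrable_mult_test_function:
  fixes u :: "'a::euclidean_space \<Rightarrow> real"
  assumes U: "open U" and loc: "\<And>K. compact K \<Longrightarrow> K \<subseteq> U \<Longrightarrow> integrable (lebesgue_on K) u"
    and \<phi>: "\<phi> \<in> test_functions U"
  shows "integrable (lebesgue_on U) (\<lambda>x. u x * \<phi> x)"
proof -
  obtain K where K: "smooth_on UNIV \<phi>" "compact K" "K \<subseteq> U" "\<And>x. x \<notin> K \<Longrightarrow> \<phi> x = 0"
    using test_functionsE[OF \<phi>] by metis
  have c: "continuous_on UNIV \<phi>" by (rule smooth_on_imp_continuous_on[OF K(1)])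
  have "bounded (\<phi> ` K)"
    by (intro compact_imp_bounded compact_continuous_image continuous_on_subset[OF c] K) simp
  then obtain B where B: "\<And>x. x \<in> K \<Longrightarrow> \<bar>\<phi> x\<bar> \<le> B" by (auto simp: bounded_iff)
  have KL: "K \<in> sets lebesgue" using K(2) by (simp add: compact_imp_closed borel_closed)
  let ?v = "\<lambda>x. if x \<in> K then u x else 0"
  have v: "integrable lebesgue ?v"
    using Lebesgue_Measure.integrable_restrict_UNIV[OF KL, of u] loc[OF K(2,3)] by simp
  have "integrable lebesgue (\<lambda>x. ?v x * \<phi> x)"
  proof (rule Bochner_Integration.integrable_bound[where f = "\<lambda>x. B * ?v x"])
    show "integrable lebesgue (\<lambda>x. B * ?v x)" using v by simp
    show "(\<lambda>x. ?v x * \<phi> x) \<in> borel_measurable lebesgue"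
      using v measurable_completion[of \<phi> lborel borel] borel_measurable_continuous_onI[OF c]
      by (intro borel_measurable_times) auto
    show "AE x in lebesgue. norm (?v x * \<phi> x) \<le> norm (B * ?v x)"
      using B by (intro AE_I2) (auto simp: abs_mult mult.commute intro!: mult_right_mono order_trans[OF B abs_ge_self])
  qed
  moreover have "(\<lambda>x. ?v x * \<phi> x) = (\<lambda>x. if x \<in> U then u x * \<phi> x else 0)"
    using K(3,4) by (intro ext) auto
  ultimately show ?thesis
    using Lebesgue_Measure.integrable_restrict_UNIV[of U "\<lambda>x. u x * \<phi> x"] U by auto
qed

lemma integrable_on_compact:
  fixes f :: "'a::euclidean_space \<Rightarrow> real"
  assumes "compact K" "continuous_on K f"
  shows "integrable (lebesgue_on K) f"
proof -
  have "integrable lborel (\<lambda>x. indicator K x *\<^sub>R f x)"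
    by (rule borel_integrable_compact[OF assms])
  then have "integrable lebesgue (\<lambda>x. indicator K x *\<^sub>R f x)"
    by (simp add: integrable_completion)
  moreover have "(\<lambda>x. indicator K x *\<^sub>R f x) = (\<lambda>x. if x \<in> K then f x else 0)"
    by (auto simp: indicator_def)
  ultimately show ?thesis
    using Lebesgue_Measure.integrable_restrict_UNIV[of K f] assms(1)
    by (simp add: compact_imp_closed borel_closed)
qed

lemma weak_deriv_integrable:
  assumes "weak_deriv U Y u g" "compact K" "K \<subseteq> U"
  shows "integrable (lebesgue_on K) u" "integrable (lebesgue_on K) g"
  using assms unfolding weak_deriv_def by blast+

lemma weak_deriv_eq:
  "weak_deriv U Y u g \<Longrightarrow> \<phi> \<in> test_functions U \<Longrightarrow>
    (LINT x|lebesgue_on U. u x * formal_adjoint Y \<phi> x) = (LINT x|lebesgue_on U. g x * \<phi> x)"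
  unfolding weak_deriv_def by blast

lemma weak_deriv_unique:
  assumes U: "open U" and g: "weak_deriv U Y u g" and h: "weak_deriv U Y u h"
  shows "AE x in lebesgue_on U. g x = h x"
proof -
  have "AE x in lebesgue_on U. g x - h x = 0"
  proof (rule fundamental_lemma[OF U])
    show "integrable (lebesgue_on K) (\<lambda>x. g x - h x)" if "compact K" "K \<subseteq> U" for K
      using weak_deriv_integrable[OF g that] weak_deriv_integrable[OF h that] by simp
    show "(LINT x|lebesgue_on U. (g x - h x) * \<phi> x) = 0" if "\<phi> \<in> test_functions U" for \<phi>
      using weak_deriv_eq[OF g that] weak_deriv_eq[OF h that]
        integrable_mult_test_function[OF U weak_deriv_integrable(2)[OF g] that]
        integrable_mult_test_function[OF U weak_deriv_integrable(2)[OF h] that]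
      by (simp add: left_diff_distrib)
  qed
  then show ?thesis by simp
qed

lemma weak_deriv_diff:
  assumes U: "open U" and Y: "smooth_on U Y" and u: "weak_deriv U Y u g" and v: "weak_deriv U Y v h"
  shows "weak_deriv U Y (\<lambda>x. u x - v x) (\<lambda>x. g x - h x)"
  unfolding weak_deriv_def
proof (intro conjI allI impI ballI)
  show "integrable (lebesgue_on K) (\<lambda>x. u x - v x)" "integrable (lebesgue_on K) (\<lambda>x. g x - h x)"
    if "compact K \<and> K \<subseteq> U" for K
    using weak_deriv_integrable[OF u, of K] weak_deriv_integrable[OF v, of K] that by simp_all
  fix \<phi> assume \<phi>: "\<phi> \<in> test_functions U"
  note adj = formal_adjoint_test_function[OF U Y \<phi>]
  show "(LINT x|lebesgue_on U. (u x - v x) * formal_adjoint Y \<phi> x) = (LINT x|lebesgue_on U. (g x - h x) * \<phi> x)"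
    using weak_deriv_eq[OF u \<phi>] weak_deriv_eq[OF v \<phi>]
      integrable_mult_test_function[OF U weak_deriv_integrable(2)[OF u] \<phi>]
      integrable_mult_test_function[OF U weak_deriv_integrable(2)[OF v] \<phi>]
      integrable_mult_test_function[OF U weak_deriv_integrable(1)[OF u] adj]
      integrable_mult_test_function[OF U weak_deriv_integrable(1)[OF v] adj]
    by (simp add: left_diff_distrib)
qed

lemma continuous_on_directional_derivative:
  fixes g :: "'a::euclidean_space \<Rightarrow> real"
  assumes g: "Ck_on (Suc 0) S g" and Y: "continuous_on S Y"
  shows "continuous_on S (\<lambda>x. frechet_derivative g (at x) (Y x))"
proof -
  have "continuous_on S (\<lambda>x. \<Sum>b\<in>Basis. (Y x \<bullet> b) * frechet_derivative g (at x) b)"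
    using g Y by (auto intro!: continuous_intros)
  moreover have "(\<Sum>b\<in>Basis. (Y x \<bullet> b) * frechet_derivative g (at x) b) = frechet_derivative g (at x) (Y x)"
    if "x \<in> S" for x
    using linear_Basis_expansion[OF has_derivative_linear[OF Ck_on_Suc_has_derivative[OF g that]], of "Y x"] by simp
  ultimately show ?thesis using continuous_on_cong[OF refl] by (metis (no_types, lifting))
qed

lemma weak_deriv_classical:
  fixes g :: "real^'n \<Rightarrow> real"
  assumes U: "open U" and Y: "smooth_on U Y" and g: "Ck_on (Suc 0) UNIV g"
  shows "weak_deriv U Y g (\<lambda>x. frechet_derivative g (at x) (Y x))"
  unfolding weak_deriv_def
proof (intro conjI allI impI ballI)
  fix K assume K: "compact K \<and> K \<subseteq> U"
  show "integrable (lebesgue_on K) g"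
    using K by (intro integrable_on_compact continuous_on_subset[OF Ck_on_imp_continuous_on[OF g]]) auto
  have "continuous_on U (\<lambda>x. frechet_derivative g (at x) (Y x))"
    by (rule continuous_on_directional_derivative[OF Ck_on_subset[OF g] smooth_on_imp_continuous_on[OF Y]]) simp
  then show "integrable (lebesgue_on K) (\<lambda>x. frechet_derivative g (at x) (Y x))"
    using K by (intro integrable_on_compact) (auto intro: continuous_on_subset)
next
  fix \<phi> assume "\<phi> \<in> test_functions U"
  then show "(LINT x|lebesgue_on U. g x * formal_adjoint Y \<phi> x) = (LINT x|lebesgue_on U. frechet_derivative g (at x) (Y x) * \<phi> x)"
    by (rule integral_formal_adjoint[OF U Y _ g])
qed

lemma weak_X_weak_deriv:
  assumes "\<And>j. \<exists>g. weak_deriv U (X j) u g"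
  shows "weak_deriv U (X j) u (\<lambda>x. weak_X X U u x $ j)"
proof -
  obtain g where g: "weak_deriv U (X j) u (g j)" for j using assms by metis
  have "\<exists>G. \<forall>j. weak_deriv U (X j) u (\<lambda>x. G x $ j)"
    by (rule exI[of _ "\<lambda>x. \<chi> j. g j x"]) (simp add: g)
  then show ?thesis unfolding weak_X_def by (rule someI2_ex) blast
qed

text \<open>Removes the choice operator from \<open>weak_X\<close>: any field of weak derivatives
  that can be exhibited agrees with the chosen one almost everywhere.\<close>

lemma weak_X_unique:
  assumes U: "open U" and g: "\<And>j. weak_deriv U (X j) u (\<lambda>x. g x $ j)"
  shows "AE x in lebesgue_on U. weak_X X U u x = g x"
proof -
  have "AE x in lebesgue_on U. weak_X X U u x $ j = g x $ j" for j
    by (rule weak_deriv_unique[OF U weak_X_weak_deriv g]) (use g in blast)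
  then have "AE x in lebesgue_on U. \<forall>j\<in>UNIV. weak_X X U u x $ j = g x $ j"
    by (intro AE_finite_allI) auto
  then show ?thesis by eventually_elim (simp add: vec_eq_iff)
qed

lemma weak_X_test_function:
  assumes U: "open U" and X: "\<And>j. smooth_on U (X j)" and f: "f \<in> test_functions U"
  shows "AE x in lebesgue_on U. weak_X X U f x = classical_X X f x"
proof (rule weak_X_unique[OF U])
  have "Ck_on (Suc 0) UNIV f" using test_functions_smooth[OF f] unfolding smooth_on_def by blast
  then show "weak_deriv U (X j) f (\<lambda>x. classical_X X f x $ j)" for j
    using weak_deriv_classical[OF U X] by (simp add: classical_X_def)
qed

text \<open>The three fields are chosen independently of each other, so linearity of
  \<open>weak_X\<close> can be expected only almost everywhere.\<close>

lemma weak_X_diff: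
  assumes U: "open U" and X: "\<And>j. smooth_on U (X j)"
    and u: "\<And>j. \<exists>g. weak_deriv U (X j) u g" and v: "\<And>j. \<exists>g. weak_deriv U (X j) v g"
  shows "AE x in lebesgue_on U. weak_X X U (\<lambda>x. u x - v x) x = weak_X X U u x - weak_X X U v x"
  by (rule weak_X_unique[OF U], unfold vector_minus_component)
    (rule weak_deriv_diff[OF U X weak_X_weak_deriv[OF u] weak_X_weak_deriv[OF v]])

text \<open>\<open>weak_deriv\<close> records local integrability alone. A countable cover of
  \<open>U\<close> by closed boxes turns it into measurability on \<open>U\<close>, which the L^p
  norms of a chosen weak derivative require.\<close>

lemma measurable_if_locally_integrable:
  fixes u :: "'a::euclidean_space \<Rightarrow> real"
  assumes U: "open U" and loc: "\<And>K. compact K \<Longrightarrow> K \<subseteq> U \<Longrightarrow> integrable (lebesgue_on K) u"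
  shows "u \<in> borel_measurable (lebesgue_on U)"
proof -
  obtain D where D: "countable D" "D \<subseteq> Pow U" "\<And>X. X \<in> D \<Longrightarrow> \<exists>a b. X = cbox a b" "\<Union>D = U"
    using open_countable_Union_open_cbox[OF U] by metis
  show ?thesis
  proof (rule measurable_piecewise_restrict[OF D(1)])
    fix Q assume Q: "Q \<in> D"
    then obtain a b where ab: "Q = cbox a b" "cbox a b \<subseteq> U" using D(2,3) by blast
    then show "Q \<inter> space (lebesgue_on U) \<in> sets (lebesgue_on U)"
      using U by (auto simp: sets_restrict_space_iff Int_absorb2 space_restrict_space)
    have "restrict_space (lebesgue_on U) Q = lebesgue_on Q"
      using ab U by (subst restrict_restrict_space) (auto simp: Int_absorb1)
    then show "u \<in> borel_measurable (restrict_space (lebesgue_on U) Q)"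
      using loc[OF compact_cbox ab(2)] ab(1) by auto
  qed (use D(4) in \<open>auto simp: space_restrict_space\<close>)
qed

text \<open>\<open>W1p\<close> provides some weak derivative in L^p for each \<open>j\<close>; it
  agrees almost everywhere with the component of \<open>weak_X\<close>, which inherits its
  integrability.\<close>

lemma W1p_weak_X:
  assumes U: "open U" and u: "u \<in> W1p X U p"
  shows "weak_deriv U (X j) u (\<lambda>x. weak_X X U u x $ j)" "in_Lp p U (\<lambda>x. weak_X X U u x $ j)"
proof -
  have ex: "\<exists>g. weak_deriv U (X j) u g \<and> in_Lp p U g" for j using u unfolding W1p_def by blast
  show w: "weak_deriv U (X j) u (\<lambda>x. weak_X X U u x $ j)"
    by (rule weak_X_weak_deriv) (use ex in blast)
  obtain g where g: "weak_deriv U (X j) u g" "in_Lp p U g" using ex by blast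
  have m: "(\<lambda>x. weak_X X U u x $ j) \<in> borel_measurable (lebesgue_on U)"
    by (rule measurable_if_locally_integrable[OF U weak_deriv_integrable(2)[OF w]])
  have "integrable (lebesgue_on U) (\<lambda>x. \<bar>g x\<bar> powr p) \<longleftrightarrow>
      integrable (lebesgue_on U) (\<lambda>x. \<bar>weak_X X U u x $ j\<bar> powr p)"
  proof (rule integrable_cong_AE)
    show "AE x in lebesgue_on U. \<bar>g x\<bar> powr p = \<bar>weak_X X U u x $ j\<bar> powr p"
      using weak_deriv_unique[OF U g(1) w] by eventually_elim simp
  qed (use m g(2) in \<open>auto simp: in_Lp_def\<close>)
  then show "in_Lp p U (\<lambda>x. weak_X X U u x $ j)" using g(2) m unfolding in_Lp_def by blast
qed

lemma in_Lp_compact_support: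
  fixes f :: "'a::euclidean_space \<Rightarrow> real"
  assumes "0 < p" "open U" "continuous_on U f" "compact K" "K \<subseteq> U" "\<And>x. x \<notin> K \<Longrightarrow> f x = 0"
  shows "in_Lp p U f"
proof -
  have int: "integrable (lebesgue_on U) h" if h: "continuous_on U h" "\<And>x. x \<notin> K \<Longrightarrow> h x = 0" for h :: "'a \<Rightarrow> real"
  proof -
    have KL: "K \<in> sets lebesgue" using assms(4) by (simp add: compact_imp_closed borel_closed)
    have "integrable (lebesgue_on K) h"
      using assms(4,5) h(1) by (intro integrable_on_compact) (auto intro: continuous_on_subset)
    then have "integrable lebesgue (\<lambda>x. if x \<in> K then h x else 0)"
      using Lebesgue_Measure.integrable_restrict_UNIV[OF KL, of h] by simp
    also have "(\<lambda>x. if x \<in> K then h x else 0) = (\<lambda>x. if x \<in> U then h x else 0)"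
      using h(2) assms(5) by (intro ext) auto
    finally show ?thesis
      using Lebesgue_Measure.integrable_restrict_UNIV[of U h] assms(2) by auto
  qed
  have "continuous_on U (\<lambda>x. \<bar>f x\<bar> powr p)"
    using assms(1,3) by (intro continuous_on_powr' continuous_intros) auto
  then show ?thesis
    unfolding in_Lp_def using int[OF assms(3,6)] int[of "\<lambda>x. \<bar>f x\<bar> powr p"] assms(1,6) by auto
qed

lemma test_function_in_W1p:
  fixes X :: "'m::finite \<Rightarrow> real^'n \<Rightarrow> real^'n"
  assumes p: "0 < p" and U: "open U" and X: "\<And>j. smooth_on U (X j)" and f: "f \<in> test_functions U"
  shows "f \<in> W1p X U p"
proof -
  have C1: "Ck_on (Suc 0) UNIV f" using test_functions_smooth[OF f] unfolding smooth_on_def by blast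
  obtain K where K: "smooth_on UNIV f" "compact K" "K \<subseteq> U" "\<And>x. x \<notin> K \<Longrightarrow> f x = 0"
    using test_functionsE[OF f] by metis
  have "in_Lp p U f"
    by (rule in_Lp_compact_support[OF p U _ K(2-4)])
      (use smooth_on_imp_continuous_on[OF K(1)] continuous_on_subset in blast)
  moreover have "in_Lp p U (\<lambda>x. frechet_derivative f (at x) (X j x))" for j
  proof (rule in_Lp_compact_support[OF p U _ K(2,3)])
    show "continuous_on U (\<lambda>x. frechet_derivative f (at x) (X j x))"
      by (rule continuous_on_directional_derivative[OF Ck_on_subset[OF C1] smooth_on_imp_continuous_on[OF X]]) simp
    show "frechet_derivative f (at x) (X j x) = 0" if "x \<notin> K" for x
      using frechet_derivative_eq_0_outside[OF compact_imp_closed[OF K(2)] K(4) that] by simp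
  qed
  moreover have "weak_deriv U (X j) f (\<lambda>x. frechet_derivative f (at x) (X j x))" for j
    by (rule weak_deriv_classical[OF U X C1])
  ultimately show ?thesis unfolding W1p_def by blast
qed

lemma test_functions_directional:
  assumes U: "open U" and Z: "smooth_on U Z" and f: "f \<in> test_functions U"
  shows "(\<lambda>x. frechet_derivative f (at x) (Z x)) \<in> test_functions U"
proof -
  obtain K where K: "smooth_on UNIV f" "compact K" "K \<subseteq> U" "\<And>x. x \<notin> K \<Longrightarrow> f x = 0"
    using test_functionsE[OF f] by metis
  have 0: "frechet_derivative f (at x) (Z x) = 0" if "x \<notin> K" for x
    using frechet_derivative_eq_0_outside[OF compact_imp_closed[OF K(2)] K(4) that] by simp
  have "smooth_on U (\<lambda>x. frechet_derivative f (at x) (Z x))"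
    by (rule smooth_on_directional[OF U smooth_on_subset[OF K(1)] Z]) simp
  then have "smooth_on UNIV (\<lambda>x. frechet_derivative f (at x) (Z x))"
    by (rule smooth_on_extend_zero[OF U _ compact_imp_closed[OF K(2)] K(3)]) (rule 0)
  then show ?thesis by (rule test_functionsI[OF _ K(2,3)]) (rule 0)
qed

lemma test_functions_C1: "f \<in> test_functions S \<Longrightarrow> Ck_on (Suc 0) UNIV f"
  using test_functions_smooth unfolding smooth_on_def by blast

section \<open>An \<open>L\<^sup>1\<close> Poincare inequality\<close>

text \<open>Tested against \<open>\<eta>\<close>, both sides become integrals of
  \<open>\<psi>\<close> times a derivative of \<open>\<eta>\<close>: on the left along the bracket,
  on the right the commutator of the derivatives along \<open>Y\<close> and \<open>Z\<close>. The
  fundamental lemma gives the identity without expanding the adjoints in coordinates, which is why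
  it is stated almost everywhere.\<close>

lemma formal_adjoint_lie_bracket:
  fixes Y Z :: "real^'n \<Rightarrow> real^'n"
  assumes U: "open U" and Y: "smooth_on U Y" and Z: "smooth_on U Z" and \<psi>: "\<psi> \<in> test_functions U"
  shows "AE x in lebesgue_on U. formal_adjoint (lie_bracket Y Z) \<psi> x =
    formal_adjoint Z (formal_adjoint Y \<psi>) x - formal_adjoint Y (formal_adjoint Z \<psi>) x"
proof -
  note adj = formal_adjoint_test_function[OF U]
  note YZ = smooth_on_lie_bracket[OF U Y Z]
  let ?h = "\<lambda>x. formal_adjoint (lie_bracket Y Z) \<psi> x -
    (formal_adjoint Z (formal_adjoint Y \<psi>) x - formal_adjoint Y (formal_adjoint Z \<psi>) x)"
  have loc: "integrable (lebesgue_on K) f" if "f \<in> test_functions U" "compact K" for f :: "real^'n \<Rightarrow> real" and K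
    using smooth_on_imp_continuous_on[OF test_functions_smooth[OF that(1)]] that(2)
    by (intro integrable_on_compact) (auto intro: continuous_on_subset)
  note int = integrable_mult_test_function[OF U loc]
  have h: "?h \<in> test_functions U"
    by (intro test_functions_diff adj YZ Y Z \<psi>)
  have "AE x in lebesgue_on U. ?h x = 0"
  proof (rule fundamental_lemma[OF U])
    show "integrable (lebesgue_on K) ?h" if "compact K" "K \<subseteq> U" for K by (rule loc[OF h that(1)])
    fix \<eta> assume \<eta>: "\<eta> \<in> test_functions U"
    let ?D = "frechet_derivative \<eta>"
    have Y\<eta>: "(\<lambda>x. ?D (at x) (Y x)) \<in> test_functions U" and Z\<eta>: "(\<lambda>x. ?D (at x) (Z x)) \<in> test_functions U"
      by (rule test_functions_directional[OF U _ \<eta>], fact)+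
    have 1: "(LINT x|lebesgue_on U. \<eta> x * formal_adjoint (lie_bracket Y Z) \<psi> x) =
        (LINT x|lebesgue_on U. ?D (at x) (lie_bracket Y Z x) * \<psi> x)"
      by (rule integral_formal_adjoint[OF U YZ \<psi> test_functions_C1[OF \<eta>]])
    have 2: "(LINT x|lebesgue_on U. frechet_derivative (\<lambda>z. ?D (at z) (Z z)) (at x) (Y x) * \<psi> x) =
        (LINT x|lebesgue_on U. \<eta> x * formal_adjoint Z (formal_adjoint Y \<psi>) x)"
      using integral_formal_adjoint[OF U Y \<psi> test_functions_C1[OF Z\<eta>]]
        integral_formal_adjoint[OF U Z adj[OF Y \<psi>] test_functions_C1[OF \<eta>]] by simp
    have 3: "(LINT x|lebesgue_on U. frechet_derivative (\<lambda>z. ?D (at z) (Y z)) (at x) (Z x) * \<psi> x) =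
        (LINT x|lebesgue_on U. \<eta> x * formal_adjoint Y (formal_adjoint Z \<psi>) x)"
      using integral_formal_adjoint[OF U Z \<psi> test_functions_C1[OF Y\<eta>]]
        integral_formal_adjoint[OF U Y adj[OF Z \<psi>] test_functions_C1[OF \<eta>]] by simp
    have 4: "(LINT x|lebesgue_on U. ?D (at x) (lie_bracket Y Z x) * \<psi> x) =
        (LINT x|lebesgue_on U. frechet_derivative (\<lambda>z. ?D (at z) (Z z)) (at x) (Y x) * \<psi> x -
          frechet_derivative (\<lambda>z. ?D (at z) (Y z)) (at x) (Z x) * \<psi> x)"
    proof (intro Bochner_Integration.integral_cong refl)
      fix x assume "x \<in> space (lebesgue_on U)"
      then have x: "x \<in> U" by (simp add: space_restrict_space)
      show "?D (at x) (lie_bracket Y Z x) * \<psi> x =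
        frechet_derivative (\<lambda>z. ?D (at z) (Z z)) (at x) (Y x) * \<psi> x -
          frechet_derivative (\<lambda>z. ?D (at z) (Y z)) (at x) (Z x) * \<psi> x"
        unfolding lie_bracket_derivative[OF U x smooth_on_subset[OF test_functions_smooth[OF \<eta>] subset_UNIV] Y Z, symmetric]
        by (simp add: left_diff_distrib)
    qed
    have 5: "(LINT x|lebesgue_on U. frechet_derivative (\<lambda>z. ?D (at z) (Z z)) (at x) (Y x) * \<psi> x -
          frechet_derivative (\<lambda>z. ?D (at z) (Y z)) (at x) (Z x) * \<psi> x) =
        (LINT x|lebesgue_on U. frechet_derivative (\<lambda>z. ?D (at z) (Z z)) (at x) (Y x) * \<psi> x) -
        (LINT x|lebesgue_on U. frechet_derivative (\<lambda>z. ?D (at z) (Y z)) (at x) (Z x) * \<psi> x)"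
      using int[OF test_functions_directional[OF U Y Z\<eta>] _ \<psi>] int[OF test_functions_directional[OF U Z Y\<eta>] _ \<psi>]
      by (rule Bochner_Integration.integral_diff)
    have "(LINT x|lebesgue_on U. ?h x * \<eta> x) =
      (LINT x|lebesgue_on U. \<eta> x * formal_adjoint (lie_bracket Y Z) \<psi> x) -
      ((LINT x|lebesgue_on U. \<eta> x * formal_adjoint Z (formal_adjoint Y \<psi>) x) -
       (LINT x|lebesgue_on U. \<eta> x * formal_adjoint Y (formal_adjoint Z \<psi>) x))"
      using int[OF \<eta> _ adj[OF YZ \<psi>]] int[OF \<eta> _ adj[OF Z adj[OF Y \<psi>]]] int[OF \<eta> _ adj[OF Y adj[OF Z \<psi>]]]
      by (simp add: algebra_simps)
    then show "(LINT x|lebesgue_on U. ?h x * \<eta> x) = 0"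
      using 1 2 3 4 5 by simp
  qed
  then show ?thesis by eventually_elim simp
qed

lemma smooth_on_det:
  fixes A :: "'a::euclidean_space \<Rightarrow> real^'n^'n"
  assumes "open S" "\<And>i k. smooth_on S (\<lambda>x. A x $ i $ k)"
  shows "smooth_on S (\<lambda>x. det (A x))"
  unfolding det_def by (intro smooth_on_sum smooth_on_mult smooth_on_prod smooth_on_const assms)

text \<open>The spanning set contains a basis, which is enumerated by the coordinate type
  \<open>'n\<close>; the basis vectors are then the columns of an invertible matrix.\<close>

lemma spanning_family_det_neq_0:
  fixes v :: "'w \<Rightarrow> real^'n"
  assumes "span (v ` W) = UNIV"
  obtains I :: "'n \<Rightarrow> 'w" where "\<And>k. I k \<in> W" "det (\<chi> i k. v (I k) $ i) \<noteq> 0"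
proof -
  obtain B where B: "B \<subseteq> v ` W" "independent B" "v ` W \<subseteq> span B" "card B = dim (v ` W)"
    using basis_exists[of "v ` W"] by metis
  have span_B: "span B = UNIV"
    using span_minimal[OF B(3) subspace_span] assms by auto
  have fin: "finite B" using B(2) independent_imp_finite by blast
  have "card B = CARD('n)" using dim_span[of "v ` W"] assms B(4) by (simp add: dim_UNIV)
  then obtain h :: "'n \<Rightarrow> real^'n" where h: "bij_betw h UNIV B"
    using finite_same_card_bij[of "UNIV :: 'n set" B] fin by auto
  have "\<forall>k. \<exists>w\<in>W. h k = v w" using h B(1) by (auto simp: bij_betw_def)
  then obtain I where I: "\<And>k. I k \<in> W" "\<And>k. h k = v (I k)" by metis
  let ?A = "\<chi> i k. v (I k) $ i"
  have "columns ?A = B"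
  proof -
    have "column k ?A = h k" for k by (simp add: column_def I(2) vec_eq_iff)
    then show ?thesis using h by (auto simp: columns_def bij_betw_def)
  qed
  then have "\<exists>M. ?A ** M = mat 1"
    using matrix_right_invertible_span_columns[of ?A] span_B by (simp add: span_vec_eq)
  then have "det ?A \<noteq> 0"
    using invertible_right_inverse invertible_det_nz by blast
  then show ?thesis using that I by blast
qed

section \<open>Test functions controlled by the energy\<close>

locale hormander_domain =
  fixes X :: "'m::finite \<Rightarrow> real^'n \<Rightarrow> real^'n" and U \<Omega> :: "(real^'n) set"
  assumes U: "open U" "connected U"
    and X: "\<And>j. smooth_on U (X j)"
    and hormander: "hormander_condition X U"
    and \<Omega>: "open \<Omega>" "compact (closure \<Omega>)" "closure \<Omega> \<subseteq> U"
begin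

text \<open>The class is made to contain \<open>|f| ^ n\<close> for test functions \<open>f\<close>
  on \<open>\<Omega>\<close>. Such functions are C^1 but need not be smooth, and their sign permits
  the comparison of integrals against different test functions.\<close>

definition admissible :: "(real^'n \<Rightarrow> real) \<Rightarrow> bool" where
  "admissible g \<longleftrightarrow> Ck_on (Suc 0) UNIV g \<and> (\<forall>x. 0 \<le> g x) \<and> (\<forall>x. x \<notin> \<Omega> \<longrightarrow> g x = 0)"

definition energy :: "(real^'n \<Rightarrow> real) \<Rightarrow> real" where
  "energy g = (\<Sum>j\<in>UNIV. LINT x|lebesgue_on U. \<bar>frechet_derivative g (at x) (X j x)\<bar>)"

definition controlled :: "(real^'n \<Rightarrow> real) \<Rightarrow> bool" where
  "controlled \<phi> \<longleftrightarrow> (\<exists>B. \<forall>g. admissible g \<longrightarrow> \<bar>LINT x|lebesgue_on U. g x * \<phi> x\<bar> \<le> B * energy g)"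

lemma energy_nonneg: "0 \<le> energy g"
  unfolding energy_def by (intro sum_nonneg Bochner_Integration.integral_nonneg) simp

text \<open>Integrands that involve the vector fields are continuous on \<open>U\<close> only, and
  \<open>U\<close> may be unbounded; vanishing off the compact set \<open>closure \<Omega>\<close>
  makes them integrable.\<close>

lemma integrable_extend:
  fixes f :: "real^'n \<Rightarrow> real"
  assumes "continuous_on U f" "\<And>x. x \<notin> closure \<Omega> \<Longrightarrow> f x = 0"
  shows "integrable (lebesgue_on U) f"
proof -
  have "integrable (lebesgue_on (closure \<Omega>)) f"
    using assms(1) \<Omega> by (intro integrable_on_compact) (auto intro: continuous_on_subset)
  then have "integrable lebesgue (\<lambda>x. if x \<in> closure \<Omega> then f x else 0)"
    using Lebesgue_Measure.integrable_restrict_UNIV[of "closure \<Omega>" f] by simp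
  moreover have "(\<lambda>x. if x \<in> closure \<Omega> then f x else 0) = (\<lambda>x. if x \<in> U then f x else 0)"
    using assms(2) \<Omega>(3) by (intro ext) auto
  ultimately show ?thesis
    using Lebesgue_Measure.integrable_restrict_UNIV[of U f] U(1) by auto
qed

lemma admissible_continuous: "admissible g \<Longrightarrow> continuous_on A g"
  using Ck_on_imp_continuous_on continuous_on_subset unfolding admissible_def by blast

lemma admissible_eq_0: "admissible g \<Longrightarrow> x \<notin> closure \<Omega> \<Longrightarrow> g x = 0"
  using closure_subset[of \<Omega>] unfolding admissible_def by blast

lemma integrable_admissible_mult:
  assumes "admissible g" "continuous_on U \<phi>"
  shows "integrable (lebesgue_on U) (\<lambda>x. g x * \<phi> x)"
proof (rule integrable_extend)
  show "continuous_on U (\<lambda>x. g x * \<phi> x)"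
    by (intro continuous_on_mult admissible_continuous assms)
  show "g x * \<phi> x = 0" if "x \<notin> closure \<Omega>" for x
    using admissible_eq_0[OF assms(1) that] by simp
qed

lemma test_continuous: "\<phi> \<in> test_functions S \<Longrightarrow> continuous_on A \<phi>"
  using smooth_on_imp_continuous_on[OF test_functions_smooth] continuous_on_subset by blast

lemma integrable_admissible_derivative:
  assumes "admissible g"
  shows "continuous_on U (\<lambda>x. frechet_derivative g (at x) (X j x))"
    and "integrable (lebesgue_on U) (\<lambda>x. frechet_derivative g (at x) (X j x))"
proof -
  have g: "Ck_on (Suc 0) UNIV g" using assms unfolding admissible_def by blast
  show c: "continuous_on U (\<lambda>x. frechet_derivative g (at x) (X j x))"
    by (rule continuous_on_directional_derivative[OF Ck_on_subset[OF g] smooth_on_imp_continuous_on[OF X]]) simp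
  show "integrable (lebesgue_on U) (\<lambda>x. frechet_derivative g (at x) (X j x))"
    by (rule integrable_extend[OF c])
      (use frechet_derivative_eq_0_outside[of "closure \<Omega>" g, OF closed_closure admissible_eq_0[OF assms]] in simp)
qed

lemma controlled_diff:
  assumes \<phi>: "\<phi> \<in> test_functions U" "controlled \<phi>" and \<psi>: "\<psi> \<in> test_functions U" "controlled \<psi>"
  shows "controlled (\<lambda>x. \<phi> x - \<psi> x)"
proof -
  obtain B where B: "\<And>g. admissible g \<Longrightarrow> \<bar>LINT x|lebesgue_on U. g x * \<phi> x\<bar> \<le> B * energy g"
    using \<phi>(2) unfolding controlled_def by blast
  obtain C where C: "\<And>g. admissible g \<Longrightarrow> \<bar>LINT x|lebesgue_on U. g x * \<psi> x\<bar> \<le> C * energy g"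
    using \<psi>(2) unfolding controlled_def by blast
  have "\<bar>LINT x|lebesgue_on U. g x * (\<phi> x - \<psi> x)\<bar> \<le> (B + C) * energy g" if g: "admissible g" for g
  proof -
    have "(LINT x|lebesgue_on U. g x * (\<phi> x - \<psi> x)) =
        (LINT x|lebesgue_on U. g x * \<phi> x) - (LINT x|lebesgue_on U. g x * \<psi> x)"
      using integrable_admissible_mult[OF g test_continuous[OF \<phi>(1)]]
        integrable_admissible_mult[OF g test_continuous[OF \<psi>(1)]]
      by (simp add: right_diff_distrib)
    then show ?thesis using B[OF g] C[OF g] by (simp add: algebra_simps)
  qed
  then show ?thesis unfolding controlled_def by blast
qed

lemma controlled_0: "controlled (\<lambda>_. 0)"
  unfolding controlled_def by (intro exI[of _ 0]) simp

lemma controlled_uminus: "controlled \<phi> \<Longrightarrow> controlled (\<lambda>x. - \<phi> x)"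
  unfolding controlled_def by simp

lemma controlled_sum:
  assumes "\<And>i. i \<in> I \<Longrightarrow> \<phi> i \<in> test_functions U" "\<And>i. i \<in> I \<Longrightarrow> controlled (\<phi> i)"
  shows "controlled (\<lambda>x. \<Sum>i\<in>I. \<phi> i x)"
  using assms
proof (induction I rule: infinite_finite_induct)
  case (insert i I)
  have "controlled (\<lambda>x. (\<Sum>i\<in>I. \<phi> i x) - (- \<phi> i x))"
    using insert by (intro controlled_diff controlled_uminus test_functions_sum test_functions_uminus) auto
  then show ?case using insert.hyps by (simp add: add.commute)
qed (simp_all add: controlled_0)

text \<open>Since \<open>g \<ge> 0\<close>, an inequality between test functions survives
  integration against \<open>g\<close>. The number \<open>c\<close> carries no sign assumption,
  hence the \<open>\<bar>c\<bar>\<close> in the constant.\<close>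

lemma controlled_mono:
  assumes \<psi>: "\<psi> \<in> test_functions U" "controlled \<psi>" and \<phi>: "\<phi> \<in> test_functions U"
    and le: "\<And>x. 0 \<le> \<phi> x" "\<And>x. \<phi> x \<le> c * \<psi> x"
  shows "controlled \<phi>"
proof -
  obtain B where B: "\<And>g. admissible g \<Longrightarrow> \<bar>LINT x|lebesgue_on U. g x * \<psi> x\<bar> \<le> B * energy g"
    using \<psi>(2) unfolding controlled_def by blast
  have "\<bar>LINT x|lebesgue_on U. g x * \<phi> x\<bar> \<le> (\<bar>c\<bar> * B) * energy g" if g: "admissible g" for g
  proof -
    have g0: "0 \<le> g x" for x using g unfolding admissible_def by blast
    have "0 \<le> (LINT x|lebesgue_on U. g x * \<phi> x)"
      by (intro Bochner_Integration.integral_nonneg mult_nonneg_nonneg g0 le(1))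
    moreover have "(LINT x|lebesgue_on U. g x * \<phi> x) \<le> (LINT x|lebesgue_on U. c * (g x * \<psi> x))"
      using mult_left_mono[OF le(2) g0] integrable_admissible_mult[OF g test_continuous[OF \<phi>]]
        integrable_admissible_mult[OF g test_continuous[OF \<psi>(1)]]
      by (intro integral_mono) (auto simp: mult_ac)
    moreover have "c * (LINT x|lebesgue_on U. g x * \<psi> x) \<le> \<bar>c\<bar> * \<bar>LINT x|lebesgue_on U. g x * \<psi> x\<bar>"
      by (metis abs_ge_self abs_mult)
    moreover have "\<bar>c\<bar> * \<bar>LINT x|lebesgue_on U. g x * \<psi> x\<bar> \<le> \<bar>c\<bar> * (B * energy g)"
      by (intro mult_left_mono B g) simp
    ultimately show ?thesis by (simp add: mult_ac)
  qed
  then show ?thesis unfolding controlled_def by blast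
qed

lemma controlled_cong_AE:
  assumes "\<phi> \<in> test_functions U" "\<psi> \<in> test_functions U" "AE x in lebesgue_on U. \<phi> x = \<psi> x" "controlled \<phi>"
  shows "controlled \<psi>"
proof -
  have "(LINT x|lebesgue_on U. g x * \<psi> x) = (LINT x|lebesgue_on U. g x * \<phi> x)" if g: "admissible g" for g
    using assms(3) integrable_admissible_mult[OF g test_continuous[OF assms(1)]]
      integrable_admissible_mult[OF g test_continuous[OF assms(2)]]
    by (intro integral_cong_AE) auto
  then show ?thesis using assms(4) unfolding controlled_def by simp
qed

text \<open>Integration by parts moves the adjoint onto \<open>g\<close>, and \<open>\<psi>\<close>
  is bounded; any bound of \<open>|\<psi>|\<close> is a suitable constant.\<close>

lemma controlled_adjoint:
  assumes \<psi>: "\<psi> \<in> test_functions U"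
  shows "controlled (formal_adjoint (X j) \<psi>)"
proof -
  obtain K where K: "smooth_on UNIV \<psi>" "compact K" "K \<subseteq> U" "\<And>x. x \<notin> K \<Longrightarrow> \<psi> x = 0"
    using test_functionsE[OF \<psi>] by metis
  have "bounded (\<psi> ` K)"
    by (intro compact_imp_bounded compact_continuous_image test_continuous[OF \<psi>] K)
  then obtain B where B: "0 < B" "\<And>x. x \<in> K \<Longrightarrow> \<bar>\<psi> x\<bar> \<le> B" by (auto simp: bounded_pos)
  then have B': "\<bar>\<psi> x\<bar> \<le> B" for x using K(4) by (cases "x \<in> K") auto
  have "\<bar>LINT x|lebesgue_on U. g x * formal_adjoint (X j) \<psi> x\<bar> \<le> B * energy g" if g: "admissible g" for g
  proof -
    let ?d = "\<lambda>j x. frechet_derivative g (at x) (X j x)"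
    have int: "integrable (lebesgue_on U) (?d j)" for j by (rule integrable_admissible_derivative(2)[OF g])
    have g1: "Ck_on (Suc 0) UNIV g" using g unfolding admissible_def by blast
    have "\<bar>LINT x|lebesgue_on U. g x * formal_adjoint (X j) \<psi> x\<bar> = \<bar>LINT x|lebesgue_on U. ?d j x * \<psi> x\<bar>"
      by (simp add: integral_formal_adjoint[OF U(1) X \<psi> g1])
    also have "\<dots> \<le> (LINT x|lebesgue_on U. B * \<bar>?d j x\<bar>)"
    proof (rule integral_abs_bound_integral)
      show "integrable (lebesgue_on U) (\<lambda>x. ?d j x * \<psi> x)"
      proof (rule integrable_extend)
        show "continuous_on U (\<lambda>x. ?d j x * \<psi> x)"
          by (intro continuous_on_mult integrable_admissible_derivative(1)[OF g] test_continuous[OF \<psi>])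
        show "?d j x * \<psi> x = 0" if "x \<notin> closure \<Omega>" for x
          using frechet_derivative_eq_0_outside[OF closed_closure admissible_eq_0[OF g] that] by simp
      qed
      show "\<bar>?d j x * \<psi> x\<bar> \<le> B * \<bar>?d j x\<bar>" for x
        using mult_left_mono[OF B'[of x], of "\<bar>?d j x\<bar>"] by (simp add: abs_mult mult.commute)
    qed (use int in simp)
    also have "\<dots> = B * (LINT x|lebesgue_on U. \<bar>?d j x\<bar>)" by simp
    also have "\<dots> \<le> B * energy g"
      unfolding energy_def using B(1)
      by (intro mult_left_mono member_le_sum) (auto intro: Bochner_Integration.integral_nonneg)
    finally show ?thesis .
  qed
  then show ?thesis unfolding controlled_def by blast
qed

text \<open>The induction has to range over all \<open>\<psi>\<close>: for the bracket of
  \<open>X i\<close> and \<open>?Y\<close>, the induction hypothesis is applied to the adjoint of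
  \<open>X i\<close> at \<open>\<psi>\<close>, and \<open>controlled_adjoint\<close> to the adjoint
  of \<open>?Y\<close> at \<open>\<psi>\<close>.\<close>

lemma controlled_adjoint_commutator:
  assumes "\<psi> \<in> test_functions U"
  shows "controlled (formal_adjoint (commutator X w) \<psi>)"
  using assms
proof (induction w arbitrary: \<psi> rule: induct_list012)
  case 1
  have "formal_adjoint (\<lambda>_. 0) \<psi> = (\<lambda>_. 0)" by (rule ext) (simp add: formal_adjoint_def frechet_derivative_const)
  then show ?case by (simp add: controlled_0)
next
  case (2 i)
  then show ?case by (simp add: controlled_adjoint)
next
  case (3 i j w)
  let ?Y = "commutator X (j # w)"
  have Y: "smooth_on U ?Y" by (rule smooth_on_commutator[OF U(1) X])
  note adj = formal_adjoint_test_function[OF U(1)]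
  have t: "(\<lambda>x. formal_adjoint ?Y (formal_adjoint (X i) \<psi>) x - formal_adjoint (X i) (formal_adjoint ?Y \<psi>) x) \<in> test_functions U"
    by (intro test_functions_diff adj X Y 3)
  have c: "controlled (\<lambda>x. formal_adjoint ?Y (formal_adjoint (X i) \<psi>) x - formal_adjoint (X i) (formal_adjoint ?Y \<psi>) x)"
    by (intro controlled_diff 3 controlled_adjoint adj X Y)
  have "formal_adjoint (lie_bracket (X i) ?Y) \<psi> \<in> test_functions U"
    by (intro adj smooth_on_lie_bracket U X Y 3)
  moreover have "AE x in lebesgue_on U. formal_adjoint ?Y (formal_adjoint (X i) \<psi>) x - formal_adjoint (X i) (formal_adjoint ?Y \<psi>) x =
      formal_adjoint (lie_bracket (X i) ?Y) \<psi> x"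
    using formal_adjoint_lie_bracket[OF U(1) X Y 3(3), of i] by eventually_elim simp
  ultimately show ?case using controlled_cong_AE[OF t _ _ c] by simp
qed

text \<open>Hoermander's condition at \<open>x\<close> selects words whose commutators form a basis
  there; the determinant is continuous, so the same words give a frame on a whole box.\<close>

lemma local_frame:
  assumes x: "x \<in> U"
  obtains a b and I :: "'n \<Rightarrow> 'm list" where "x \<in> box a b" "cbox a b \<subseteq> U"
    "\<And>y. y \<in> box a b \<Longrightarrow> det (\<chi> i k. commutator X (I k) y $ i) \<noteq> 0"
proof -
  obtain s where "hormander_at_step X U s" using hormander unfolding hormander_condition_def by blast
  then have "span ((\<lambda>w. commutator X w x) ` words s) = UNIV"
    using x unfolding hormander_at_step_def commutator_span_def by blast
  then obtain I :: "'n \<Rightarrow> 'm list" where I: "det (\<chi> i k. commutator X (I k) x $ i) \<noteq> 0"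
    by (rule spanning_family_det_neq_0) blast
  let ?D = "\<lambda>y. det (\<chi> i k. commutator X (I k) y $ i)"
  have "smooth_on U (\<lambda>y. commutator X (I k) y $ i)" for i k
    by (rule smooth_on_bounded_linear[OF U(1) bounded_linear_vec_nth smooth_on_commutator[OF U(1) X]])
  then have "smooth_on U ?D" by (intro smooth_on_det U) simp
  then have c: "continuous_on U ?D" by (rule smooth_on_imp_continuous_on)
  have "open (U \<inter> ?D -` (- {0}))" by (rule continuous_open_preimage[OF c U(1)]) auto
  moreover have "x \<in> U \<inter> ?D -` (- {0})" using x I by simp
  ultimately obtain a b where ab: "cbox a b \<subseteq> U \<inter> ?D -` (- {0})" "x \<in> box a b"
    using open_contains_cbox by metis
  then show ?thesis using box_subset_cbox[of a b] by (intro that[of a b I]) auto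
qed

text \<open>In the frame, the constant field \<open>axis k 1\<close> is a combination of the
  \<open>?Y l\<close> with coefficients \<open>c l\<close>, smooth by Cramer's rule. The divergence
  of \<open>\<psi>\<close> times this field is the partial derivative of \<open>\<psi>\<close>; it
  equals minus the sum of the adjoints of \<open>?Y l\<close> at \<open>c l * \<psi>\<close>, each
  of which is controlled.\<close>

lemma controlled_partial:
  assumes ab: "cbox a b \<subseteq> U" and det: "\<And>y. y \<in> box a b \<Longrightarrow> det (\<chi> i k. commutator X (I k) y $ i) \<noteq> 0"
    and \<psi>: "\<psi> \<in> test_functions (box a b)"
  shows "controlled (\<lambda>x. frechet_derivative \<psi> (at x) (axis k 1))"
proof -
  let ?N = "box a b"
  let ?Y = "\<lambda>l. commutator X (I l)"
  define A where "A y = (\<chi> i l. ?Y l y $ i)" for y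
  define c where "c l y = det (\<chi> i j. if j = l then axis k 1 $ i else A y $ i $ j) * inverse (det (A y))" for l y
  have NU: "?N \<subseteq> U" using ab box_subset_cbox by blast
  have Ys: "smooth_on ?N (\<lambda>y. ?Y l y $ i)" for l i
    by (rule smooth_on_bounded_linear[OF open_box bounded_linear_vec_nth
        smooth_on_subset[OF smooth_on_commutator[OF U(1) X] NU]])
  have A: "smooth_on ?N (\<lambda>y. A y $ i $ j)" for i j using Ys unfolding A_def by simp
  have c: "smooth_on ?N (c l)" for l
    unfolding c_def
  proof (intro smooth_on_mult smooth_on_inverse smooth_on_det open_box)
    show "smooth_on ?N (\<lambda>x. (\<chi> i j. if j = l then axis k 1 $ i else A x $ i $ j) $ i $ j)" for i j
      using A smooth_on_const[OF open_box] by (cases "j = l") auto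
    show "det (A x) \<noteq> 0" if "x \<in> ?N" for x using det[OF that] unfolding A_def .
  qed (rule A)
  have frame: "(\<Sum>l\<in>UNIV. ?Y l y $ i * c l y) = axis k 1 $ i" if y: "y \<in> ?N" for y i
  proof -
    have "A y *v (\<chi> l. c l y) = axis k 1"
      using cramer[of "A y" "\<chi> l. c l y" "axis k 1"] det[OF y] unfolding c_def A_def[symmetric]
      by (simp add: divide_inverse)
    then have "(A y *v (\<chi> l. c l y)) $ i = axis k 1 $ i" by simp
    then show ?thesis unfolding matrix_vector_mult_def A_def by simp
  qed
  have c\<psi>N: "(\<lambda>y. c l y * \<psi> y) \<in> test_functions ?N" for l
    by (rule test_functions_mult_smooth[OF open_box c \<psi>])
  have c\<psi>: "(\<lambda>y. c l y * \<psi> y) \<in> test_functions U" for l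
    by (rule test_functions_mono[OF c\<psi>N NU])
  have t: "formal_adjoint (?Y l) (\<lambda>y. c l y * \<psi> y) \<in> test_functions U" for l
    by (rule formal_adjoint_test_function[OF U(1) smooth_on_commutator[OF U(1) X] c\<psi>])
  have "controlled (\<lambda>x. - (\<Sum>l\<in>UNIV. formal_adjoint (?Y l) (\<lambda>y. c l y * \<psi> y) x))"
    by (intro controlled_uminus controlled_sum t controlled_adjoint_commutator c\<psi>)
  moreover have "- (\<Sum>l\<in>UNIV. formal_adjoint (?Y l) (\<lambda>y. c l y * \<psi> y) x) = frechet_derivative \<psi> (at x) (axis k 1)" for x
  proof -
    have Yc: "(\<lambda>z. ?Y l z $ i * (c l z * \<psi> z)) \<in> test_functions ?N" for l i
      by (rule test_functions_mult_smooth[OF open_box Ys c\<psi>N])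
    have der: "((\<lambda>z. ?Y l z $ i * (c l z * \<psi> z)) has_derivative
        frechet_derivative (\<lambda>z. ?Y l z $ i * (c l z * \<psi> z)) (at x)) (at x)" for l i
      by (rule smooth_on_has_derivative[OF test_functions_smooth[OF Yc]]) simp
    \<comment> \<open>The frame identity is known on the box alone; outside it \<open>\<psi>\<close>
      is 0, so after multiplication by \<open>\<psi>\<close> the identity is global and can be
      differentiated at every point.\<close>
    have eq: "(\<lambda>z. \<Sum>l\<in>UNIV. ?Y l z $ i * (c l z * \<psi> z)) = (\<lambda>z. axis k 1 $ i * \<psi> z)" for i
    proof
      fix z
      show "(\<Sum>l\<in>UNIV. ?Y l z $ i * (c l z * \<psi> z)) = axis k 1 $ i * \<psi> z"
      proof (cases "z \<in> ?N")
        case True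
        then show ?thesis by (simp add: frame[symmetric] sum_distrib_right mult.assoc)
      next
        case False
        then show ?thesis using test_functions_eq_0[OF \<psi>] by simp
      qed
    qed
    have s: "(\<Sum>l\<in>UNIV. frechet_derivative (\<lambda>z. ?Y l z $ i * (c l z * \<psi> z)) (at x) v) =
        axis k 1 $ i * frechet_derivative \<psi> (at x) v" for i v
    proof -
      have "((\<lambda>z. axis k 1 $ i * \<psi> z) has_derivative
          (\<lambda>v. \<Sum>l\<in>UNIV. frechet_derivative (\<lambda>z. ?Y l z $ i * (c l z * \<psi> z)) (at x) v)) (at x)"
        unfolding eq[symmetric] by (rule has_derivative_sum[OF der])
      moreover have "((\<lambda>z. axis k 1 $ i * \<psi> z) has_derivative (\<lambda>v. axis k 1 $ i * frechet_derivative \<psi> (at x) v)) (at x)"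
        by (rule has_derivative_mult_right[OF smooth_on_has_derivative[OF test_functions_smooth[OF \<psi>]]]) simp
      ultimately show ?thesis by (blast dest: has_derivative_unique fun_cong)
    qed
    have "- (\<Sum>l\<in>UNIV. formal_adjoint (?Y l) (\<lambda>y. c l y * \<psi> y) x) =
        (\<Sum>l\<in>UNIV. \<Sum>i\<in>UNIV. frechet_derivative (\<lambda>z. ?Y l z $ i * (c l z * \<psi> z)) (at x) (axis i 1))"
      by (simp add: formal_adjoint_def sum_negf)
    also have "\<dots> = (\<Sum>i\<in>UNIV. \<Sum>l\<in>UNIV. frechet_derivative (\<lambda>z. ?Y l z $ i * (c l z * \<psi> z)) (at x) (axis i 1))"
      by (rule sum.swap)
    also have "\<dots> = (\<Sum>i\<in>UNIV. if i = k then frechet_derivative \<psi> (at x) (axis i 1) else 0)"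
      unfolding s by (intro sum.cong refl) (simp add: axis_def)
    also have "\<dots> = frechet_derivative \<psi> (at x) (axis k 1)" by simp
    finally show ?thesis .
  qed
  ultimately show ?thesis by simp
qed

end

text \<open>A bump and its translate have the same integral, so the antiderivative of their
  difference that vanishes on the far left also vanishes on the far right. This lets a translation
  be written as the derivative of a test function.\<close>

lemma compactly_supported_difference_antiderivative:
  fixes \<beta> :: "real \<Rightarrow> real"
  assumes \<beta>: "smooth_on UNIV \<beta>" and supp: "\<And>s. e \<le> \<bar>s\<bar> \<Longrightarrow> \<beta> s = 0" and e: "0 < e"
  obtains H where "smooth_on UNIV H" "\<And>s. (H has_real_derivative \<beta> s - \<beta> (s - t)) (at s)"
    "\<And>s. s \<le> min (- e) (t - e) \<or> max e (t + e) \<le> s \<Longrightarrow> H s = 0"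
proof -
  \<comment> \<open>The base point lies strictly left of \<open>- e\<close>, so every
    \<open>s\<close> is either beyond \<open>L\<close>, where the integral can be differentiated, or
    in the open half-line below \<open>- e\<close>, where \<open>A\<close> is 0.\<close>
  define L where "L = - e - 1"
  define A where "A s = integral {L..s} \<beta>" for s
  have cont: "continuous_on S \<beta>" for S
    using smooth_on_imp_continuous_on[OF \<beta>] continuous_on_subset by blast
  have A0: "A s = 0" if "s \<le> - e" for s
  proof -
    have "integral {L..s} \<beta> = integral {L..s} (\<lambda>_. 0)"
      by (rule Henstock_Kurzweil_Integration.integral_cong) (use supp that e in auto)
    then show ?thesis unfolding A_def by simp
  qed
  have A_deriv: "(A has_real_derivative \<beta> s) (at s)" for s
  proof (cases "L < s")
    case True
    have "((\<lambda>u. integral {L..u} \<beta>) has_real_derivative \<beta> s) (at s within {L..s + 1})"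
      by (rule integral_has_real_derivative[OF cont]) (use True in auto)
    moreover have "at s within {L..s + 1} = at s"
      by (rule at_within_interior) (use True in \<open>simp add: interior_atLeastAtMost_real\<close>)
    ultimately show ?thesis unfolding A_def[abs_def] by simp
  next
    case False
    have "((\<lambda>_. 0) has_real_derivative 0) (at s)" by simp
    then have "(A has_real_derivative 0) (at s)"
      by (rule has_field_derivative_transform_within_open[of _ _ _ "{..< - e}"])
        (use False e in \<open>auto simp: L_def A0\<close>)
    then show ?thesis using supp[of s] False e by (simp add: L_def)
  qed
  have A1: "A s = A e" if "e \<le> s" for s
  proof -
    have "\<exists>c. \<forall>x\<in>{e..}. A x = c"
    proof (rule has_field_derivative_zero_constant)
      show "(A has_real_derivative 0) (at x within {e..})" if "x \<in> {e..}" for x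
        using A_deriv[of x] supp[of x] e that has_field_derivative_at_within by fastforce
    qed (rule convex_real_interval)
    then show ?thesis using that by auto
  qed
  define H where "H s = A s - A (s - t)" for s
  have H: "(H has_real_derivative \<beta> s - \<beta> (s - t)) (at s)" for s
  proof -
    have "((\<lambda>s. s - t) has_real_derivative 1) (at s)" by (auto intro!: derivative_eq_intros)
    from DERIV_chain2[where f = A and g = "\<lambda>s. s - t", OF A_deriv this]
    have "((\<lambda>s. A (s - t)) has_real_derivative \<beta> (s - t)) (at s)" by simp
    then show ?thesis unfolding H_def by (intro DERIV_diff A_deriv)
  qed
  show ?thesis
  proof (rule that[OF _ H])
    show "smooth_on UNIV H"
    proof (rule smooth_on_real_antiderivative[OF H])
      show "smooth_on UNIV (\<lambda>s. \<beta> s - \<beta> (s - t))"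
        using smooth_on_diff[OF open_UNIV \<beta> smooth_on_compose_inner[OF \<beta>, of "1::real" "- t"]] by simp
    qed
    show "H s = 0" if "s \<le> min (- e) (t - e) \<or> max e (t + e) \<le> s" for s
      using that A0[of s] A0[of "s - t"] A1[of s] A1[of "s - t"] unfolding H_def by auto
  qed
qed

section \<open>Translation of bumps inside a box\<close>

definition cube_bump :: "real \<Rightarrow> real \<Rightarrow> real" where
  "cube_bump e s = exp_inv 0 (s + e) * exp_inv 0 (e - s)"

lemma smooth_on_cube_bump: "smooth_on UNIV (cube_bump e)"
proof -
  have "smooth_on UNIV (\<lambda>s. exp_inv 0 (s + e) * exp_inv 0 (e - s))"
    using smooth_on_compose_inner[OF smooth_on_exp_inv, of 0 "1::real" e]
      smooth_on_compose_inner[OF smooth_on_exp_inv, of 0 "-1::real" e]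
    by (intro smooth_on_mult open_UNIV) (simp_all add: algebra_simps)
  then show ?thesis unfolding cube_bump_def[abs_def] .
qed

lemma cube_bump_bounds:
  "0 \<le> cube_bump e s" "cube_bump e s \<le> 1" "e \<le> \<bar>s\<bar> \<Longrightarrow> cube_bump e s = 0" "0 < e \<Longrightarrow> 0 < cube_bump e 0"
  unfolding cube_bump_def using exp_inv_0_bounds
  by (auto intro!: mult_nonneg_nonneg mult_le_one mult_pos_pos simp: abs_if exp_inv_def split: if_splits)

lemma smooth_on_compose_component:
  fixes h :: "real \<Rightarrow> real"
  assumes "smooth_on UNIV h"
  shows "smooth_on UNIV (\<lambda>y::real^'n. h (y $ k - c))"
  using smooth_on_compose_inner[OF assms, of "axis k 1 :: real^'n" "- c"]
  by (simp add: inner_axis')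

context hormander_domain
begin

text \<open>The points \<open>x\<close> near which \<open>\<integral> g\<close> is bounded by the energy of \<open>g\<close>.\<close>

definition controlled_at :: "real^'n \<Rightarrow> bool" where
  "controlled_at x \<longleftrightarrow> (\<exists>\<phi>\<in>test_functions U. controlled \<phi> \<and> (\<forall>y. 0 \<le> \<phi> y) \<and> 0 < \<phi> x)"

lemma controlled_at_open: "open {x. controlled_at x}"
proof -
  have "{x. controlled_at x} = (\<Union>\<phi>\<in>{\<phi>\<in>test_functions U. controlled \<phi> \<and> (\<forall>y. 0 \<le> \<phi> y)}. \<phi> -` {0<..})"
    unfolding controlled_at_def by auto
  moreover have "open (\<phi> -` {0<..})" if "\<phi> \<in> test_functions U" for \<phi>
    using test_continuous[OF that, of UNIV] by (intro open_vimage) auto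
  ultimately show ?thesis by auto
qed

lemma controlled_at_exterior:
  assumes "x \<in> U" "x \<notin> closure \<Omega>"
  shows "controlled_at x"
proof -
  have "open (U - closure \<Omega>)" using U by auto
  then obtain a b where ab: "cbox a b \<subseteq> U - closure \<Omega>" "x \<in> box a b"
    using assms open_contains_cbox by (metis DiffI)
  let ?\<phi> = "box_bump 1 a b"
  have "?\<phi> \<in> test_functions U" using ab by (intro box_bump_test_function) auto
  moreover have "controlled ?\<phi>"
    unfolding controlled_def
  proof (intro exI[of _ 0] allI impI)
    fix g assume g: "admissible g"
    have "g x * ?\<phi> x = 0" for x
      using admissible_eq_0[OF g, of x] box_bump_eq_0[of 1 x a b] ab(1) box_subset_cbox[of a b] by auto
    then have "(\<lambda>x. g x * ?\<phi> x) = (\<lambda>_. 0)" by blast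
    then show "\<bar>LINT x|lebesgue_on U. g x * ?\<phi> x\<bar> \<le> 0 * energy g" by (simp only:) simp
  qed
  ultimately show ?thesis
    unfolding controlled_at_def using box_bump_bounds(1)[of 1 a b] box_bump_pos[of 1, OF _ ab(2)]
    by (intro bexI[of _ ?\<phi>]) simp_all
qed

lemma controlled_at_move:
  fixes x :: "real^'n"
  assumes ab: "cbox a b \<subseteq> U" and det: "\<And>y. y \<in> box a b \<Longrightarrow> det (\<chi> i k. commutator X (I k) y $ i) \<noteq> 0"
    and x: "x \<in> box a b" "controlled_at x" and x': "x + t *\<^sub>R axis i 1 \<in> box a b"
  shows "controlled_at (x + t *\<^sub>R axis i 1)"
proof -
  let ?x' = "x + t *\<^sub>R axis i 1"
  have comp: "?x' $ k = (if k = i then x $ i + t else x $ k)" for k by (simp add: axis_def)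
  obtain \<phi> where \<phi>: "\<phi> \<in> test_functions U" "controlled \<phi>" "\<And>y. 0 \<le> \<phi> y" "0 < \<phi> x"
    using x(2) unfolding controlled_at_def by blast
  have NU: "box a b \<subseteq> U" using ab box_subset_cbox by blast
  have "open (box a b \<inter> \<phi> -` {\<phi> x / 2<..})"
    using test_continuous[OF \<phi>(1), of UNIV] by (intro open_Int open_box open_vimage) auto
  moreover have "x \<in> box a b \<inter> \<phi> -` {\<phi> x / 2<..}" using x(1) \<phi>(4) by simp
  ultimately obtain r where r: "0 < r" "\<And>y. dist y x < r \<Longrightarrow> y \<in> box a b \<and> \<phi> x / 2 < \<phi> y"
    unfolding open_dist by fastforce
  \<comment> \<open>Half-width of the cubes. The cube about \<open>x\<close> has to lie in the ball
    of radius \<open>r\<close>, where the norm is estimated by the sum of the coordinates, and both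
    endpoints have to keep the distance \<open>2 * e\<close> from the faces of the box.\<close>
  define e where "e = Min (insert (r / (2 * real CARD('n)))
     ((\<lambda>k. min (min (x $ k - a $ k) (b $ k - x $ k)) (min (?x' $ k - a $ k) (b $ k - ?x' $ k)) / 2) ` UNIV))"
  have e: "0 < e"
    unfolding e_def using r(1) x(1) x' by (subst Min_gr_iff) (auto simp: mem_box_cart)
  have "e \<le> min (min (x $ k - a $ k) (b $ k - x $ k)) (min (?x' $ k - a $ k) (b $ k - ?x' $ k)) / 2" for k
    unfolding e_def by (rule Min_le) auto
  then have "2 * e \<le> min (min (x $ k - a $ k) (b $ k - x $ k)) (min (?x' $ k - a $ k) (b $ k - ?x' $ k))" for k
    by (simp only: le_divide_eq_numeral1 mult.commute)
  then have e_box: "2 * e \<le> x $ k - a $ k" "2 * e \<le> b $ k - x $ k" "2 * e \<le> ?x' $ k - a $ k" "2 * e \<le> b $ k - ?x' $ k" for k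
    unfolding min.bounded_iff by blast+
  have "e \<le> r / (2 * real CARD('n))" unfolding e_def by (rule Min_le) auto
  then have e_r: "real CARD('n) * e < r" using r(1) by (simp add: field_simps)
  let ?\<beta> = "cube_bump e"
  define P where "P y = (\<Prod>k\<in>UNIV - {i}. ?\<beta> (y $ k - x $ k))" for y :: "real^'n"
  define \<eta> where "\<eta> y = ?\<beta> (y $ i - x $ i) * P y" for y
  define \<eta>' where "\<eta>' y = ?\<beta> (y $ i - x $ i - t) * P y" for y
  obtain H where H: "smooth_on UNIV H" "\<And>s. (H has_real_derivative ?\<beta> s - ?\<beta> (s - t)) (at s)"
    "\<And>s. s \<le> min (- e) (t - e) \<or> max e (t + e) \<le> s \<Longrightarrow> H s = 0"
    using compactly_supported_difference_antiderivative[OF smooth_on_cube_bump cube_bump_bounds(3) e] by metis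
  text \<open>The \<open>i\<close>-th derivative of \<open>\<Psi>\<close> is \<open>\<eta> - \<eta>'\<close>, so \<open>\<eta>'\<close> inherits control from \<open>\<eta>\<close>.\<close>
  define \<Psi> where "\<Psi> y = H (y $ i - x $ i) * P y" for y
  have P_smooth: "smooth_on UNIV P"
    unfolding P_def by (intro smooth_on_prod open_UNIV smooth_on_compose_component smooth_on_cube_bump)
  have P_bounds: "0 \<le> P y" "P y \<le> 1" for y
    unfolding P_def by (auto intro!: prod_nonneg prod_le_1 cube_bump_bounds)
  have P_0: "P y = 0" if "k \<noteq> i" "e \<le> \<bar>y $ k - x $ k\<bar>" for y k
    unfolding P_def using that by (intro prod_zero) (auto intro!: bexI[of _ k] cube_bump_bounds)
  \<comment> \<open>The box from \<open>c\<close> to \<open>d\<close> is swept by the cube of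
    half-width \<open>e\<close> while it moves by \<open>t\<close> in coordinate \<open>i\<close>;
    \<open>min\<close> and \<open>max\<close> treat both signs of \<open>t\<close>.\<close>
  define c where "c = (\<chi> k. if k = i then x $ i + min (- e) (t - e) else x $ k - e)"
  define d where "d = (\<chi> k. if k = i then x $ i + max e (t + e) else x $ k + e)"
  have cd: "cbox c d \<subseteq> box a b"
  proof
    fix y assume y: "y \<in> cbox c d"
    have "a $ k < y $ k \<and> y $ k < b $ k" for k
    proof (cases "k = i")
      case True
      have "x $ i + min (- e) (t - e) \<le> y $ i" "y $ i \<le> x $ i + max e (t + e)"
        using y unfolding mem_box_cart c_def d_def by (auto dest: spec[of _ i])
      then show ?thesis using e_box[of i] e True unfolding comp by (auto simp: min_def max_def split: if_splits)
    next
      case False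
      then have "x $ k - e \<le> y $ k" "y $ k \<le> x $ k + e"
        using y unfolding mem_box_cart c_def d_def by (auto dest: spec[of _ k])
      then show ?thesis using e_box[of k] e by auto
    qed
    then show "y \<in> box a b" by (simp add: mem_box_cart)
  qed
  have outside: "P y = 0 \<or> y $ i - x $ i < min (- e) (t - e) \<or> max e (t + e) < y $ i - x $ i" if "y \<notin> cbox c d" for y
  proof -
    obtain k where k: "y $ k < c $ k \<or> d $ k < y $ k" using \<open>y \<notin> cbox c d\<close> by (auto simp: mem_box_cart not_le)
    show ?thesis
    proof (cases "k = i")
      case False
      with k have "e \<le> \<bar>y $ k - x $ k\<bar>"
        using e by (auto simp: c_def d_def)
      then show ?thesis using P_0[OF False] by simp
    qed (use k in \<open>auto simp: c_def d_def\<close>)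
  qed
  have test: "(\<lambda>y. h (y $ i - x $ i) * P y) \<in> test_functions (box a b)"
    if "smooth_on UNIV h" "\<And>s. s \<le> min (- e) (t - e) \<or> max e (t + e) \<le> s \<Longrightarrow> h s = 0" for h
  proof (rule test_functionsI[OF _ compact_cbox cd])
    show "smooth_on UNIV (\<lambda>y. h (y $ i - x $ i) * P y)"
      by (intro smooth_on_mult open_UNIV P_smooth smooth_on_compose_component that)
    show "h (y $ i - x $ i) * P y = 0" if "y \<notin> cbox c d" for y
      using outside[OF that] \<open>\<And>s. s \<le> min (- e) (t - e) \<or> max e (t + e) \<le> s \<Longrightarrow> h s = 0\<close> by fastforce
  qed
  have \<Psi>: "\<Psi> \<in> test_functions (box a b)" unfolding \<Psi>_def by (rule test[OF H(1,3)])
  have \<eta>: "\<eta> \<in> test_functions U"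
    unfolding \<eta>_def
    by (rule test_functions_mono[OF test[OF smooth_on_cube_bump] NU]) (auto intro!: cube_bump_bounds)
  have "smooth_on UNIV (\<lambda>s. ?\<beta> (s - t))"
    using smooth_on_compose_inner[OF smooth_on_cube_bump[of e], of "1::real" "- t"] by simp
  then have \<eta>': "\<eta>' \<in> test_functions U"
    unfolding \<eta>'_def
    by (intro test_functions_mono[OF test[of "\<lambda>s. ?\<beta> (s - t)"] NU]) (auto intro!: cube_bump_bounds)
  have \<eta>_le: "0 \<le> \<eta> y" "\<eta> y \<le> 1" for y
    unfolding \<eta>_def by (auto intro!: mult_nonneg_nonneg mult_le_one cube_bump_bounds P_bounds)
  have "controlled \<eta>"
  proof (rule controlled_mono[OF \<phi>(1,2) \<eta> \<eta>_le(1)])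
    \<comment> \<open>On the cube \<open>\<phi>\<close> exceeds \<open>\<phi> x / 2\<close> and
      \<open>\<eta>\<close> is at most 1; off the cube \<open>\<eta>\<close> is 0.\<close>
    show "\<eta> y \<le> (2 / \<phi> x) * \<phi> y" for y
    proof (cases "\<forall>k. \<bar>y $ k - x $ k\<bar> < e")
      case True
      have "norm (y - x) \<le> (\<Sum>k\<in>UNIV. \<bar>(y - x) $ k\<bar>)" by (rule norm_le_l1_cart)
      also have "\<dots> \<le> (\<Sum>k\<in>(UNIV::'n set). e)" using True by (intro sum_mono) (auto simp: less_imp_le)
      also have "\<dots> < r" using e_r by simp
      finally have "\<phi> x / 2 < \<phi> y" using r(2) by (simp add: dist_norm)
      then have "1 \<le> (2 / \<phi> x) * \<phi> y" using \<phi>(4) by (simp add: field_simps)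
      then show ?thesis using \<eta>_le(2)[of y] by linarith
    next
      case False
      then obtain k where "e \<le> \<bar>y $ k - x $ k\<bar>" by (auto simp: not_less)
      then have "\<eta> y = 0"
        unfolding \<eta>_def using P_0[of k y] cube_bump_bounds(3)[of e "y $ k - x $ k"] by (cases "k = i") auto
      then show ?thesis using \<phi>(3)[of y] \<phi>(4) by simp
    qed
  qed
  moreover have "controlled (\<lambda>y. frechet_derivative \<Psi> (at y) (axis i 1))"
    by (rule controlled_partial[OF ab det \<Psi>])
  moreover have "frechet_derivative \<Psi> (at y) (axis i 1) = \<eta> y - \<eta>' y" for y
  proof -
    have "(\<Psi> has_derivative frechet_derivative \<Psi> (at (y + 0 *\<^sub>R axis i 1))) (at (y + 0 *\<^sub>R axis i 1))"
      using smooth_on_has_derivative[OF test_functions_smooth[OF \<Psi>]] by simp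
    from has_real_derivative_line[OF this]
    have 1: "((\<lambda>s. \<Psi> (y + s *\<^sub>R axis i 1)) has_real_derivative frechet_derivative \<Psi> (at y) (axis i 1)) (at 0)"
      by simp
    have "P (y + s *\<^sub>R axis i 1) = P y" for s
      unfolding P_def by (intro prod.cong refl) (simp add: axis_def)
    then have eq: "\<Psi> (y + s *\<^sub>R axis i 1) = H (y $ i + s - x $ i) * P y" for s
      unfolding \<Psi>_def by (simp add: axis_def)
    have "((\<lambda>s. H (y $ i + s - x $ i)) has_real_derivative ?\<beta> (y $ i - x $ i) - ?\<beta> (y $ i - x $ i - t)) (at 0)"
    proof -
      have "((\<lambda>s. y $ i + s - x $ i) has_real_derivative 1) (at 0)" by (auto intro!: derivative_eq_intros)
      from DERIV_chain2[where f = H and g = "\<lambda>s. y $ i + s - x $ i", OF H(2) this] show ?thesis by simp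
    qed
    then have "((\<lambda>s. H (y $ i + s - x $ i) * P y) has_real_derivative
        (?\<beta> (y $ i - x $ i) - ?\<beta> (y $ i - x $ i - t)) * P y) (at 0)"
      by (rule DERIV_cmult_right)
    then show ?thesis
      using DERIV_unique[OF 1] unfolding eq \<eta>_def \<eta>'_def by (simp add: left_diff_distrib)
  qed
  ultimately have "controlled \<eta>" "controlled (\<lambda>y. \<eta> y - \<eta>' y)" by simp_all
  from controlled_diff[OF \<eta> this(1) test_functions_diff[OF \<eta> \<eta>'] this(2)] have "controlled \<eta>'" by simp
  moreover have "0 \<le> \<eta>' y" for y
    unfolding \<eta>'_def by (auto intro!: mult_nonneg_nonneg cube_bump_bounds P_bounds)
  moreover have "0 < \<eta>' ?x'"
  proof -
    have "0 < P ?x'"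
      unfolding P_def using e by (intro prod_pos) (auto simp: axis_def intro: cube_bump_bounds)
    then show ?thesis unfolding \<eta>'_def using cube_bump_bounds(4)[OF e] by (simp add: axis_def)
  qed
  ultimately show ?thesis unfolding controlled_at_def using \<eta>' by blast
qed

text \<open>The path from \<open>x\<close> to \<open>z\<close> changes one coordinate at a time. A
  box is a product of intervals, so the intermediate points \<open>y S\<close> stay inside.\<close>

lemma controlled_at_spread:
  assumes ab: "cbox a b \<subseteq> U" and det: "\<And>y. y \<in> box a b \<Longrightarrow> det (\<chi> i k. commutator X (I k) y $ i) \<noteq> 0"
    and x: "x \<in> box a b" "controlled_at x" and z: "z \<in> box a b"
  shows "controlled_at z"
proof -
  define y where "y S = (\<chi> k. if k \<in> S then z $ k else x $ k)" for S
  have y_box: "y S \<in> box a b" for S using x(1) z by (auto simp: mem_box_cart y_def)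
  have "controlled_at (y S)" if "finite S" for S
    using that
  proof induction
    case empty
    have "y {} = x" by (simp add: y_def vec_eq_iff)
    then show ?case using x(2) by simp
  next
    case (insert i S)
    have eq: "y (insert i S) = y S + (z $ i - x $ i) *\<^sub>R axis i 1"
      using insert.hyps(2) by (auto simp: y_def vec_eq_iff axis_def)
    show ?case
      unfolding eq by (rule controlled_at_move[OF ab det y_box insert.IH y_box[of "insert i S", unfolded eq]])
  qed
  moreover have "y UNIV = z" by (simp add: y_def vec_eq_iff)
  ultimately show ?thesis using finite[of UNIV] by metis
qed

text \<open>The controlled points of \<open>U\<close> form an open set, and so do the others: a
  single controlled point in a box with a frame would spread to the whole box. Connectedness leaves
  one of the two sets, and a point outside \<open>closure \<Omega>\<close> decides which.\<close>

lemma controlled_at_everywhere: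
  assumes "x \<in> U"
  shows "controlled_at x"
proof -
  \<comment> \<open>Otherwise \<open>U\<close> would be bounded and both open and closed; containing
    \<open>x\<close>, it would be the whole space.\<close>
  have "\<not> U \<subseteq> closure \<Omega>"
  proof
    assume "U \<subseteq> closure \<Omega>"
    then have "U = closure \<Omega>" using \<Omega>(3) by blast
    then have "closed U" "open U" "bounded U" using U(1) \<Omega>(2) by (auto intro: compact_imp_bounded)
    then show False using clopen[of U] assms not_bounded_UNIV by auto
  qed
  then obtain y where y: "y \<in> U" "y \<notin> closure \<Omega>" by blast
  have "open {z\<in>U. \<not> controlled_at z}"
  proof (subst open_subopen, intro ballI)
    fix z assume z: "z \<in> {z\<in>U. \<not> controlled_at z}"
    then have "z \<in> U" by simp
    then obtain a b and I :: "'n \<Rightarrow> 'm list" where abI: "z \<in> box a b" "cbox a b \<subseteq> U"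
      "\<And>y. y \<in> box a b \<Longrightarrow> det (\<chi> i k. commutator X (I k) y $ i) \<noteq> 0"
      by (rule local_frame) blast
    have "box a b \<subseteq> {z\<in>U. \<not> controlled_at z}"
      using controlled_at_spread[OF abI(2,3) _ _ abI(1)] z abI(2) box_subset_cbox by blast
    then show "\<exists>T. open T \<and> z \<in> T \<and> T \<subseteq> {z\<in>U. \<not> controlled_at z}" using abI(1) by blast
  qed
  moreover have "open {z\<in>U. controlled_at z}" using controlled_at_open U(1) open_Int[of U "{z. controlled_at z}"] by (simp add: Collect_conj_eq)
  ultimately have "{z\<in>U. \<not> controlled_at z} \<inter> U = {} \<or> {z\<in>U. controlled_at z} \<inter> U = {}"
    using connectedD[OF U(2), of "{z\<in>U. \<not> controlled_at z}" "{z\<in>U. controlled_at z}"] by blast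
  moreover have "controlled_at y" by (rule controlled_at_exterior[OF y])
  ultimately show ?thesis using assms y(1) by blast
qed

text \<open>By compactness finitely many bumps add up to a controlled \<open>\<Phi>\<close> that is
  at least some \<open>c > 0\<close> on \<open>closure \<Omega>\<close>. Since \<open>g\<close>
  vanishes elsewhere, \<open>c\<close> times the integral of \<open>g\<close> is at most the
  integral of \<open>g * \<Phi>\<close>.\<close>

lemma L1_poincare:
  obtains B where "0 < B" "\<And>g. admissible g \<Longrightarrow> (LINT x|lebesgue_on U. g x) \<le> B * energy g"
proof -
  have "\<forall>x\<in>closure \<Omega>. \<exists>\<phi>\<in>test_functions U. controlled \<phi> \<and> (\<forall>y. 0 \<le> \<phi> y) \<and> 0 < \<phi> x"
    using controlled_at_everywhere \<Omega>(3) unfolding controlled_at_def by blast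
  then obtain \<phi> where \<phi>: "\<And>x. x \<in> closure \<Omega> \<Longrightarrow> \<phi> x \<in> test_functions U"
    "\<And>x. x \<in> closure \<Omega> \<Longrightarrow> controlled (\<phi> x)" "\<And>x y. x \<in> closure \<Omega> \<Longrightarrow> 0 \<le> \<phi> x y"
    "\<And>x. x \<in> closure \<Omega> \<Longrightarrow> 0 < \<phi> x x" by metis
  have op: "open (\<phi> x -` {0<..})" if "x \<in> closure \<Omega>" for x
    using test_continuous[OF \<phi>(1)[OF that], of UNIV] by (intro open_vimage) auto
  obtain F where F: "F \<subseteq> closure \<Omega>" "finite F" "closure \<Omega> \<subseteq> (\<Union>x\<in>F. \<phi> x -` {0<..})"
    by (rule compactE_image[OF \<Omega>(2), of "closure \<Omega>" "\<lambda>x. \<phi> x -` {0<..}"]) (use op \<phi>(4) in auto)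
  define \<Phi> where "\<Phi> y = (\<Sum>x\<in>F. \<phi> x y)" for y
  have \<Phi>: "\<Phi> \<in> test_functions U" "controlled \<Phi>"
    unfolding \<Phi>_def using \<phi> F(1) by (auto intro!: test_functions_sum controlled_sum)
  have pos: "0 < \<Phi> y" if "y \<in> closure \<Omega>" for y
  proof -
    obtain x where "x \<in> F" "0 < \<phi> x y" using F(3) \<open>y \<in> closure \<Omega>\<close> by auto
    then show ?thesis unfolding \<Phi>_def using \<phi>(3) F by (intro sum_pos2[of F x]) auto
  qed
  obtain c where c: "0 < c" "\<And>y. y \<in> closure \<Omega> \<Longrightarrow> c \<le> \<Phi> y"
  proof (cases "closure \<Omega> = {}")
    case True
    then show ?thesis using that[of 1] by simp
  next
    case False
    then obtain y where "y \<in> closure \<Omega>" "\<forall>z\<in>closure \<Omega>. \<Phi> y \<le> \<Phi> z"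
      using continuous_attains_inf[OF \<Omega>(2) _ test_continuous[OF \<Phi>(1)]] by blast
    then show ?thesis using that[of "\<Phi> y"] pos by blast
  qed
  obtain B where B: "\<And>g. admissible g \<Longrightarrow> \<bar>LINT x|lebesgue_on U. g x * \<Phi> x\<bar> \<le> B * energy g"
    using \<Phi>(2) unfolding controlled_def by blast
  show ?thesis
  \<comment> \<open>\<open>controlled\<close> does not prescribe the sign of \<open>B\<close>, but
    the claim asks for a positive constant.\<close>
  proof (rule that[of "(\<bar>B\<bar> + 1) / c"])
    show "0 < (\<bar>B\<bar> + 1) / c" using c(1) by simp
    fix g assume g: "admissible g"
    have g0: "0 \<le> g x" for x using g unfolding admissible_def by blast
    have "c * (LINT x|lebesgue_on U. g x) = (LINT x|lebesgue_on U. c * g x)" by simp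
    also have "\<dots> \<le> (LINT x|lebesgue_on U. g x * \<Phi> x)"
    proof (rule integral_mono)
      show "integrable (lebesgue_on U) (\<lambda>x. c * g x)"
        using integrable_admissible_mult[OF g, of "\<lambda>_. 1"] by simp
      show "integrable (lebesgue_on U) (\<lambda>x. g x * \<Phi> x)"
        by (rule integrable_admissible_mult[OF g test_continuous[OF \<Phi>(1)]])
      show "c * g x \<le> g x * \<Phi> x" for x
        using mult_right_mono[OF c(2)[of x] g0[of x]] admissible_eq_0[OF g, of x]
        by (cases "x \<in> closure \<Omega>") (auto simp: mult.commute)
    qed
    also have "\<dots> \<le> B * energy g" using B[OF g] by simp
    also have "\<dots> \<le> (\<bar>B\<bar> + 1) * energy g" by (intro mult_right_mono energy_nonneg) simp
    finally show "(LINT x|lebesgue_on U. g x) \<le> (\<bar>B\<bar> + 1) / c * energy g"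
      using c(1) by (simp add: field_simps)
  qed
qed

end

section \<open>The Poincare inequality for test functions\<close>

text \<open>With exponent at least 2 the derivative is continuous across 0; this is the reason for
  the lower bound 2 on the exponent in the Poincare inequality.\<close>

lemma abs_power_has_derivative:
  "((\<lambda>s::real. \<bar>s\<bar> ^ (k + 2)) has_real_derivative real (k + 2) * (s * \<bar>s\<bar> ^ k)) (at s)"
proof (cases s "0::real" rule: linorder_cases)
  case less
  have "((\<lambda>s. (- s) ^ (k + 2)) has_real_derivative real (k + 2) * (s * (- s) ^ k)) (at s)"
    using DERIV_power[OF DERIV_minus[OF DERIV_ident], of "k + 2" s UNIV] by (simp add: algebra_simps)
  then have "((\<lambda>s. \<bar>s\<bar> ^ (k + 2)) has_real_derivative real (k + 2) * (s * (- s) ^ k)) (at s)"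
    by (rule has_field_derivative_transform_within_open[of _ _ _ "{..<0}"]) (use less in auto)
  then show ?thesis using less by simp
next
  case equal
  have "((\<lambda>h::real. h * \<bar>h\<bar> ^ k) \<longlongrightarrow> 0 * \<bar>0\<bar> ^ k) (at 0)" by (intro tendsto_intros)
  then have "((\<lambda>h::real. h * \<bar>h\<bar> ^ k) \<longlongrightarrow> 0) (at 0)" by simp
  then have "((\<lambda>h::real. (\<bar>0 + h\<bar> ^ (k + 2) - \<bar>0\<bar> ^ (k + 2)) / h) \<longlongrightarrow> 0) (at 0)"
    by (rule Lim_transform_eventually) (auto simp: eventually_at_filter abs_if)
  then show ?thesis using equal by (simp add: DERIV_def)
next
  case greater
  have "((\<lambda>s. s ^ (k + 2)) has_real_derivative real (k + 2) * (s * s ^ k)) (at s)"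
    using DERIV_power[OF DERIV_ident, of "k + 2" s UNIV] by (simp add: algebra_simps)
  then have "((\<lambda>s. \<bar>s\<bar> ^ (k + 2)) has_real_derivative real (k + 2) * (s * s ^ k)) (at s)"
    by (rule has_field_derivative_transform_within_open[of _ _ _ "{0<..}"]) (use greater in auto)
  then show ?thesis using greater by simp
qed

text \<open>Young's inequality without sharp constants: either \<open>b \<le> \<epsilon> * a\<close>
  and the first term suffices, or \<open>a\<close> is at most \<open>b / \<epsilon>\<close> and the
  second does. The freedom in \<open>\<epsilon>\<close> is what allows a term to be absorbed
  later.\<close>

lemma young_simple:
  fixes a b \<epsilon> :: real
  assumes "0 \<le> a" "0 \<le> b" "0 < \<epsilon>"
  shows "a ^ k * b \<le> \<epsilon> * a ^ Suc k + inverse \<epsilon> ^ k * b ^ Suc k"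
proof (cases "b \<le> \<epsilon> * a")
  case True
  then have "a ^ k * b \<le> a ^ k * (\<epsilon> * a)" using assms by (intro mult_left_mono) auto
  moreover have "0 \<le> inverse \<epsilon> ^ k * b ^ Suc k" using assms by simp
  ultimately show ?thesis by (simp add: mult_ac)
next
  case False
  then have "a \<le> inverse \<epsilon> * b" using assms(3) by (simp add: field_simps)
  then have "a ^ k * b \<le> (inverse \<epsilon> * b) ^ k * b" using assms by (intro mult_right_mono power_mono) auto
  moreover have "0 \<le> \<epsilon> * a ^ Suc k" using assms by simp
  ultimately show ?thesis by (simp add: power_mult_distrib mult_ac)
qed

context hormander_domain
begin

lemma classical_X_nth: "classical_X X f x $ j = frechet_derivative f (at x) (X j x)"
  by (simp add: classical_X_def)

lemma classical_X_test:
  assumes f: "f \<in> test_functions \<Omega>"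
  shows "continuous_on U (classical_X X f)" "x \<notin> closure \<Omega> \<Longrightarrow> classical_X X f x = 0"
proof -
  have "continuous_on U (\<lambda>x. frechet_derivative f (at x) (X j x))" for j
    by (rule continuous_on_directional_derivative[OF Ck_on_subset[OF test_functions_C1[OF f]] smooth_on_imp_continuous_on[OF X]]) simp
  then show "continuous_on U (classical_X X f)"
    unfolding classical_X_def by (intro continuous_on_vec_lambda)
  have "f x = 0" if "x \<notin> closure \<Omega>" for x
    using test_functions_eq_0[OF f] that closure_subset[of \<Omega>] by blast
  then show "x \<notin> closure \<Omega> \<Longrightarrow> classical_X X f x = 0"
    using frechet_derivative_eq_0_outside[OF closed_closure, of \<Omega> f x] by (simp add: classical_X_def vec_eq_iff)
qed

lemma poincare_test_functions:
  fixes n :: nat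
  assumes n: "2 \<le> n"
  obtains c where "0 < c" "\<And>f. f \<in> test_functions \<Omega> \<Longrightarrow>
    (LINT x|lebesgue_on U. \<bar>f x\<bar> ^ n) \<le> c * (LINT x|lebesgue_on U. norm (classical_X X f x) ^ n)"
proof -
  obtain k where k: "n = k + 2" using n by (metis add.commute le_Suc_ex)
  obtain B where B: "0 < B" "\<And>g. admissible g \<Longrightarrow> (LINT x|lebesgue_on U. g x) \<le> B * energy g"
    using L1_poincare by metis
  define m where "m = real CARD('m)"
  have m: "0 < m" unfolding m_def by simp
  \<comment> \<open>Chosen so that \<open>B * energy g\<close> is at most half the integral of
    \<open>g\<close> plus a multiple of the integral of \<open>?N x ^ n\<close>; the half is
    absorbed by the left side.\<close>
  define \<epsilon> where "\<epsilon> = inverse (2 * B * real n * m)"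
  have \<epsilon>: "0 < \<epsilon>" unfolding \<epsilon>_def using B(1) m n by simp
  define D where "D = inverse \<epsilon> ^ (k + 1)"
  have D: "0 < D" unfolding D_def using \<epsilon> by simp
  show ?thesis
  proof (rule that[of "2 * (B * real n * m * D)"])
    show "0 < 2 * (B * real n * m * D)" using B(1) m D n by simp
    fix f assume f: "f \<in> test_functions \<Omega>"
    define g where "g x = \<bar>f x\<bar> ^ n" for x
    let ?d = "\<lambda>j x. frechet_derivative f (at x) (X j x)"
    have f1: "Ck_on (Suc 0) UNIV f" by (rule test_functions_C1[OF f])
    have f_cont: "continuous_on S f" for S by (rule test_continuous[OF f])
    have g_deriv: "(g has_derivative (\<lambda>v. real n * (f x * \<bar>f x\<bar> ^ k) * frechet_derivative f (at x) v)) (at x)" for x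
      using diff_chain_at[OF Ck_on_Suc_has_derivative[OF f1] abs_power_has_derivative[of k "f x", unfolded has_field_derivative_def]]
      unfolding g_def k by (simp add: o_def)
    have g: "admissible g"
      unfolding admissible_def
    proof (intro conjI allI impI)
      show "Ck_on (Suc 0) UNIV g"
      proof (rule Ck_on_SucI[OF open_UNIV g_deriv])
        show "Ck_on 0 UNIV (\<lambda>x. real n * (f x * \<bar>f x\<bar> ^ k) * frechet_derivative f (at x) b)" if "b \<in> Basis" for b
          using f1 that f_cont by (auto intro!: continuous_intros)
      qed
      show "0 \<le> g x" for x unfolding g_def by simp
      show "g x = 0" if "x \<notin> \<Omega>" for x unfolding g_def using test_functions_eq_0[OF f that] n by simp
    qed
    let ?N = "\<lambda>x. norm (classical_X X f x)"
    have int_g: "integrable (lebesgue_on U) g"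
      using integrable_admissible_mult[OF g, of "\<lambda>_. 1"] by simp
    have int_N: "integrable (lebesgue_on U) (\<lambda>x. ?N x ^ n)"
      by (rule integrable_extend) (use n in \<open>auto intro!: continuous_intros classical_X_test[OF f]\<close>)
    have "(LINT x|lebesgue_on U. \<bar>frechet_derivative g (at x) (X j x)\<bar>) \<le>
        (LINT x|lebesgue_on U. real n * (\<epsilon> * g x + D * ?N x ^ n))" for j
    proof (rule integral_mono)
      show "integrable (lebesgue_on U) (\<lambda>x. \<bar>frechet_derivative g (at x) (X j x)\<bar>)"
        using integrable_admissible_derivative(2)[OF g] by simp
      show "integrable (lebesgue_on U) (\<lambda>x. real n * (\<epsilon> * g x + D * ?N x ^ n))"
        using int_g int_N by simp
      fix x
      have "\<bar>frechet_derivative g (at x) (X j x)\<bar> = real n * (\<bar>f x\<bar> ^ (k + 1) * \<bar>?d j x\<bar>)"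
        unfolding frechet_derivative_at[OF g_deriv, symmetric] by (simp add: abs_mult)
      also have "\<dots> \<le> real n * (\<bar>f x\<bar> ^ (k + 1) * ?N x)"
        using component_le_norm_cart[of "classical_X X f x" j]
        by (intro mult_left_mono) (auto simp: classical_X_nth)
      also have "\<dots> \<le> real n * (\<epsilon> * g x + D * ?N x ^ n)"
        using young_simple[of "\<bar>f x\<bar>" "?N x" \<epsilon> "k + 1"] \<epsilon> unfolding g_def D_def k
        by (intro mult_left_mono) auto
      finally show "\<bar>frechet_derivative g (at x) (X j x)\<bar> \<le> real n * (\<epsilon> * g x + D * ?N x ^ n)" .
    qed
    then have "energy g \<le> (\<Sum>j\<in>(UNIV::'m set). LINT x|lebesgue_on U. real n * (\<epsilon> * g x + D * ?N x ^ n))"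
      unfolding energy_def by (rule sum_mono)
    also have "\<dots> = m * real n * (\<epsilon> * integral\<^sup>L (lebesgue_on U) g + D * (LINT x|lebesgue_on U. ?N x ^ n))"
      using int_g int_N by (simp add: m_def)
    finally have "B * energy g \<le> B * (m * real n * (\<epsilon> * integral\<^sup>L (lebesgue_on U) g + D * (LINT x|lebesgue_on U. ?N x ^ n)))"
      using B(1) by (intro mult_left_mono) auto
    also have "\<dots> = integral\<^sup>L (lebesgue_on U) g / 2 + B * real n * m * D * (LINT x|lebesgue_on U. ?N x ^ n)"
      unfolding \<epsilon>_def using B(1) m n by (simp add: field_simps)
    finally have "integral\<^sup>L (lebesgue_on U) g \<le> integral\<^sup>L (lebesgue_on U) g / 2 + B * real n * m * D * (LINT x|lebesgue_on U. ?N x ^ n)"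
      using B(2)[OF g] by linarith
    then show "(LINT x|lebesgue_on U. \<bar>f x\<bar> ^ n) \<le> 2 * (B * real n * m * D) * (LINT x|lebesgue_on U. ?N x ^ n)"
      unfolding g_def by linarith
  qed
qed

end

section \<open>The subunit distance\<close>

lemma abs_continuous_on_interval_add:
  assumes "abs_continuous_on_interval a b f" "abs_continuous_on_interval a b g"
  shows "abs_continuous_on_interval a b (\<lambda>t. f t + g t)"
  unfolding abs_continuous_on_interval_def
proof (intro allI impI)
  fix \<epsilon> :: real assume "0 < \<epsilon>"
  then have e: "0 < \<epsilon> / 2" by simp
  let ?ok = "\<lambda>D d. finite D \<and> (\<forall>(s, t)\<in>D. a \<le> s \<and> s \<le> t \<and> t \<le> b) \<and>
        pairwise (\<lambda>I J. {fst I<..<snd I} \<inter> {fst J<..<snd J} = {}) D \<and> (\<Sum>(s, t)\<in>D. t - s) < d"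
  obtain d1 where d1: "0 < d1" "\<And>D. ?ok D d1 \<Longrightarrow> (\<Sum>(s, t)\<in>D. norm (f t - f s)) < \<epsilon> / 2"
    using assms(1) e unfolding abs_continuous_on_interval_def by blast
  obtain d2 where d2: "0 < d2" "\<And>D. ?ok D d2 \<Longrightarrow> (\<Sum>(s, t)\<in>D. norm (g t - g s)) < \<epsilon> / 2"
    using assms(2) e unfolding abs_continuous_on_interval_def by blast
  show "\<exists>d>0. \<forall>D. ?ok D d \<longrightarrow> (\<Sum>(s, t)\<in>D. norm (f t + g t - (f s + g s))) < \<epsilon>"
  proof (intro exI[of _ "min d1 d2"] conjI allI impI)
    show "0 < min d1 d2" using d1 d2 by simp
    fix D :: "(real \<times> real) set" assume D: "?ok D (min d1 d2)"
    have "(\<Sum>(s, t)\<in>D. norm (f t + g t - (f s + g s))) \<le> (\<Sum>(s, t)\<in>D. norm (f t - f s) + norm (g t - g s))"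
      by (intro sum_mono) (auto simp: add_diff_add intro: norm_triangle_ineq)
    also have "\<dots> = (\<Sum>(s, t)\<in>D. norm (f t - f s)) + (\<Sum>(s, t)\<in>D. norm (g t - g s))"
      by (simp add: case_prod_beta sum.distrib)
    also have "\<dots> < \<epsilon> / 2 + \<epsilon> / 2"
      using D by (intro add_strict_mono d1(2) d2(2)) auto
    finally show "(\<Sum>(s, t)\<in>D. norm (f t + g t - (f s + g s))) < \<epsilon>" by simp
  qed
qed

text \<open>A monotone Lipschitz change of parameter maps disjoint intervals to disjoint intervals
  of comparable total length. It may be constant on stretches, as a clamped parameter is; the
  collapsed intervals contribute 0 and are removed, which makes the map on the remaining set
  \<open>E\<close> injective.\<close>

lemma abs_continuous_on_interval_compose_mono:
  assumes f: "abs_continuous_on_interval a b f"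
    and mono: "\<And>s t. a' \<le> s \<Longrightarrow> s \<le> t \<Longrightarrow> t \<le> b' \<Longrightarrow> c s \<le> c t"
    and lip: "\<And>s t. a' \<le> s \<Longrightarrow> s \<le> t \<Longrightarrow> t \<le> b' \<Longrightarrow> c t - c s \<le> L * (t - s)" and L: "0 < L"
    and range: "\<And>t. a' \<le> t \<Longrightarrow> t \<le> b' \<Longrightarrow> a \<le> c t \<and> c t \<le> b"
  shows "abs_continuous_on_interval a' b' (\<lambda>t. f (c t))"
  unfolding abs_continuous_on_interval_def
proof (intro allI impI)
  fix \<epsilon> :: real assume "0 < \<epsilon>"
  let ?ok = "\<lambda>a b D d. finite D \<and> (\<forall>(s, t)\<in>D. a \<le> s \<and> s \<le> t \<and> t \<le> b) \<and>
        pairwise (\<lambda>I J. {fst I<..<snd I} \<inter> {fst J<..<snd J} = {}) D \<and> (\<Sum>(s, t)\<in>D. t - s) < d"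
  obtain d where d: "0 < d" "\<And>D. ?ok a b D d \<Longrightarrow> (\<Sum>(s, t)\<in>D. norm (f t - f s)) < \<epsilon>"
    using f \<open>0 < \<epsilon>\<close> unfolding abs_continuous_on_interval_def by blast
  show "\<exists>d>0. \<forall>D. ?ok a' b' D d \<longrightarrow> (\<Sum>(s, t)\<in>D. norm (f (c t) - f (c s))) < \<epsilon>"
  proof (intro exI[of _ "d / L"] conjI allI impI)
    show "0 < d / L" using d(1) L by simp
    fix D :: "(real \<times> real) set" assume D: "?ok a' b' D (d / L)"
    define E where "E = {I\<in>D. c (fst I) < c (snd I)}"
    define C where "C I = (c (fst I), c (snd I))" for I
    have fin: "finite D" "finite E" using D unfolding E_def by auto
    have D_le: "a' \<le> fst I" "fst I \<le> snd I" "snd I \<le> b'" if "I \<in> D" for I using D that by auto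
    have apart: "c (snd I) \<le> c (fst J) \<or> c (snd J) \<le> c (fst I)" if "I \<in> E" "J \<in> E" "I \<noteq> J" for I J
    proof -
      have IJ: "I \<in> D" "J \<in> D" using that unfolding E_def by auto
      have lt: "fst I < snd I" "fst J < snd J"
        using that D_le[OF IJ(1)] D_le[OF IJ(2)] unfolding E_def by (auto simp: order_less_le)
      have "{fst I<..<snd I} \<inter> {fst J<..<snd J} = {}" using D IJ that(3) unfolding pairwise_def by blast
      then have "max (fst I) (fst J) \<ge> min (snd I) (snd J)"
        using dense[of "max (fst I) (fst J)" "min (snd I) (snd J)"] by (auto simp: not_le[symmetric])
      then have "snd I \<le> fst J \<or> snd J \<le> fst I" using lt by (auto simp: min_def max_def split: if_splits)
      then show ?thesis
      proof
        assume "snd I \<le> fst J"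
        then have "c (snd I) \<le> c (fst J)" using D_le[OF IJ(1)] D_le[OF IJ(2)] by (intro mono) auto
        then show ?thesis ..
      next
        assume "snd J \<le> fst I"
        then have "c (snd J) \<le> c (fst I)" using D_le[OF IJ(1)] D_le[OF IJ(2)] by (intro mono) auto
        then show ?thesis ..
      qed
    qed
    have inj: "inj_on C E"
    proof (rule inj_onI, rule ccontr)
      fix I J assume *: "I \<in> E" "J \<in> E" "C I = C J" "I \<noteq> J"
      then show False using apart[OF *(1,2,4)] unfolding C_def E_def by auto
    qed
    have "?ok a b (C ` E) d"
    proof (intro conjI)
      show "finite (C ` E)" using fin by simp
      show "\<forall>(s, t)\<in>C ` E. a \<le> s \<and> s \<le> t \<and> t \<le> b"
      proof (intro ballI)
        fix p assume "p \<in> C ` E"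
        then obtain I where I: "I \<in> D" "p = (c (fst I), c (snd I))" unfolding C_def E_def by auto
        show "case p of (s, t) \<Rightarrow> a \<le> s \<and> s \<le> t \<and> t \<le> b"
          using range[of "fst I"] range[of "snd I"] mono[of "fst I" "snd I"] D_le[OF I(1)] I(2) by simp
      qed
      show "pairwise (\<lambda>I J. {fst I<..<snd I} \<inter> {fst J<..<snd J} = {}) (C ` E)"
        unfolding pairwise_image
      proof (intro pairwiseI impI)
        fix I J assume "I \<in> E" "J \<in> E" "I \<noteq> J"
        from apart[OF this] show "{fst (C I)<..<snd (C I)} \<inter> {fst (C J)<..<snd (C J)} = {}"
          unfolding C_def by auto
      qed
      have "(\<Sum>(s, t)\<in>C ` E. t - s) = (\<Sum>I\<in>E. c (snd I) - c (fst I))"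
        unfolding sum.reindex[OF inj] by (simp add: C_def)
      also have "\<dots> \<le> (\<Sum>I\<in>E. L * (snd I - fst I))"
        by (intro sum_mono lip D_le) (auto simp: E_def)
      also have "\<dots> \<le> (\<Sum>I\<in>D. L * (snd I - fst I))"
        by (intro sum_mono2) (use fin D_le L in \<open>auto simp: E_def\<close>)
      also have "\<dots> = L * (\<Sum>(s, t)\<in>D. t - s)" by (simp add: sum_distrib_left case_prod_beta)
      also have "\<dots> < d" using D L by (simp add: field_simps)
      finally show "(\<Sum>(s, t)\<in>C ` E. t - s) < d" .
    qed
    then have "(\<Sum>(s, t)\<in>C ` E. norm (f t - f s)) < \<epsilon>" by (rule d(2))
    also have "(\<Sum>(s, t)\<in>C ` E. norm (f t - f s)) = (\<Sum>I\<in>E. norm (f (c (snd I)) - f (c (fst I))))"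
      unfolding sum.reindex[OF inj] by (simp add: C_def)
    also have "\<dots> = (\<Sum>I\<in>D. norm (f (c (snd I)) - f (c (fst I))))"
    proof (intro sum.mono_neutral_left ballI)
      fix I assume "I \<in> D - E"
      then have "c (fst I) = c (snd I)" using mono[of "fst I" "snd I"] D_le[of I] unfolding E_def by fastforce
      then show "norm (f (c (snd I)) - f (c (fst I))) = 0" by simp
    qed (use fin in \<open>auto simp: E_def\<close>)
    finally show "(\<Sum>(s, t)\<in>D. norm (f (c t) - f (c s))) < \<epsilon>" by (simp add: case_prod_beta)
  qed
qed

text \<open>Reflection reverses the order of the endpoints, so it is treated separately from the
  monotone changes of parameter.\<close>

lemma abs_continuous_on_interval_reflect:
  assumes f: "abs_continuous_on_interval 0 1 f"
  shows "abs_continuous_on_interval 0 1 (\<lambda>t. f (1 - t))"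
  unfolding abs_continuous_on_interval_def
proof (intro allI impI)
  fix \<epsilon> :: real assume "0 < \<epsilon>"
  let ?ok = "\<lambda>D d. finite D \<and> (\<forall>(s, t)\<in>D. 0 \<le> s \<and> s \<le> t \<and> t \<le> (1::real)) \<and>
        pairwise (\<lambda>I J. {fst I<..<snd I} \<inter> {fst J<..<snd J} = {}) D \<and> (\<Sum>(s, t)\<in>D. t - s) < d"
  obtain d where d: "0 < d" "\<And>D. ?ok D d \<Longrightarrow> (\<Sum>(s, t)\<in>D. norm (f t - f s)) < \<epsilon>"
    using f \<open>0 < \<epsilon>\<close> unfolding abs_continuous_on_interval_def by blast
  show "\<exists>d>0. \<forall>D. ?ok D d \<longrightarrow> (\<Sum>(s, t)\<in>D. norm (f (1 - t) - f (1 - s))) < \<epsilon>"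
  proof (intro exI[of _ d] conjI allI impI d(1))
    fix D :: "(real \<times> real) set" assume D: "?ok D d"
    define C where "C I = (1 - snd I, 1 - fst I)" for I :: "real \<times> real"
    have inj: "inj_on C D" unfolding C_def by (auto intro!: inj_onI prod_eqI)
    have "?ok (C ` D) d"
    proof (intro conjI)
      show "finite (C ` D)" using D by simp
      show "\<forall>(s, t)\<in>C ` D. 0 \<le> s \<and> s \<le> t \<and> t \<le> 1" using D unfolding C_def by fastforce
      show "pairwise (\<lambda>I J. {fst I<..<snd I} \<inter> {fst J<..<snd J} = {}) (C ` D)"
        unfolding pairwise_image
      proof (intro pairwiseI impI)
        fix I J assume *: "I \<in> D" "J \<in> D" "I \<noteq> J"
        then have "{fst I<..<snd I} \<inter> {fst J<..<snd J} = {}" using D unfolding pairwise_def by blast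
        moreover have "1 - z \<in> {fst I<..<snd I} \<inter> {fst J<..<snd J}"
          if "z \<in> {fst (C I)<..<snd (C I)} \<inter> {fst (C J)<..<snd (C J)}" for z
          using that unfolding C_def by auto
        ultimately show "{fst (C I)<..<snd (C I)} \<inter> {fst (C J)<..<snd (C J)} = {}" by blast
      qed
      show "(\<Sum>(s, t)\<in>C ` D. t - s) < d"
        unfolding sum.reindex[OF inj] using D by (simp add: C_def case_prod_beta)
    qed
    then have "(\<Sum>(s, t)\<in>C ` D. norm (f t - f s)) < \<epsilon>" by (rule d(2))
    then show "(\<Sum>(s, t)\<in>D. norm (f (1 - t) - f (1 - s))) < \<epsilon>"
      unfolding sum.reindex[OF inj] by (simp add: C_def case_prod_beta norm_minus_commute)
  qed
qed

text \<open>The inverse affine map is differentiable and hence preserves null sets: the exceptional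
  set of times stays null when a curve is reparametrized.\<close>

lemma AE_lebesgue_on_affine:
  assumes P: "AE t in lebesgue_on {0..1::real}. P t" and r: "r \<noteq> 0"
  shows "AE t in lebesgue. r * t + c \<in> {0..1} \<longrightarrow> P (r * t + c)"
proof -
  have "AE t in lebesgue. t \<in> {0..1} \<longrightarrow> P t"
    using P by (simp add: AE_restrict_space_iff)
  then obtain N where N: "N \<in> null_sets lebesgue" "{t. \<not> (t \<in> {0..1} \<longrightarrow> P t)} \<subseteq> N"
    unfolding eventually_ae_filter by auto
  have "negligible ((\<lambda>x. (x - c) / r) ` N)"
  proof (rule negligible_differentiable_image_negligible)
    show "(\<lambda>x. (x - c) / r) differentiable_on N"
      unfolding differentiable_on_def differentiable_def
      by (intro ballI exI[of _ "\<lambda>h. h / r"]) (use r in \<open>auto intro!: derivative_eq_intros\<close>)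
  qed (use N in \<open>auto simp: negligible_iff_null_sets\<close>)
  then have "AE t in lebesgue. t \<notin> (\<lambda>x. (x - c) / r) ` N"
    by (intro AE_not_in) (simp add: negligible_iff_null_sets)
  then show ?thesis
  proof eventually_elim
    case (elim t)
    have "t = (r * t + c - c) / r" using r by simp
    then have "r * t + c \<notin> N" using elim by blast
    then show ?case using N(2) by blast
  qed
qed

section \<open>Reversal and concatenation of subunit curves\<close>

lemma subunit_curve_reverse:
  assumes "subunit_curve X U x y \<delta>"
  shows "subunit_curve X U y x \<delta>"
proof -
  obtain \<phi> a where \<phi>: "abs_continuous_on_interval 0 1 \<phi>" "\<phi> ` {0..1} \<subseteq> U" "\<phi> 0 = x" "\<phi> 1 = y"
    and AE: "AE t in lebesgue_on {0..1}.
           (\<phi> has_vector_derivative (\<Sum>i\<in>UNIV. a i t *\<^sub>R X i (\<phi> t))) (at t within {0..1}) \<and>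
           (\<Sum>i\<in>UNIV. \<bar>a i t\<bar>\<^sup>2) \<le> \<delta>\<^sup>2"
    using assms unfolding subunit_curve_def by blast
  have m1: "(- 1::real) \<noteq> 0" by simp
  have img: "(\<lambda>t. 1 - t) ` {0..1} = {0..1::real}" by (auto intro!: image_eqI[of _ _ "1 - _"])
  have "AE t in lebesgue_on {0..1}.
     ((\<lambda>t. \<phi> (1 - t)) has_vector_derivative (\<Sum>i\<in>UNIV. (- a i (1 - t)) *\<^sub>R X i (\<phi> (1 - t)))) (at t within {0..1}) \<and>
     (\<Sum>i\<in>UNIV. \<bar>- a i (1 - t)\<bar>\<^sup>2) \<le> \<delta>\<^sup>2"
    unfolding AE_restrict_space_iff[of "{0..1::real}" lebesgue, simplified]
    using AE_lebesgue_on_affine[OF AE m1, of 1]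
  proof eventually_elim
    case (elim t)
    show ?case
    proof (intro impI conjI)
      assume t: "0 \<le> t \<and> t \<le> 1"
      then have e: "(\<phi> has_vector_derivative (\<Sum>i\<in>UNIV. a i (1 - t) *\<^sub>R X i (\<phi> (1 - t)))) (at (1 - t) within {0..1})"
        "(\<Sum>i\<in>UNIV. \<bar>a i (1 - t)\<bar>\<^sup>2) \<le> \<delta>\<^sup>2" using elim by auto
      have "((\<lambda>t. 1 - t) has_vector_derivative - 1) (at t within {0..1})"
        by (auto intro!: derivative_eq_intros)
      from vector_diff_chain_within[OF this, of \<phi>, unfolded img, OF e(1)]
      show "((\<lambda>t. \<phi> (1 - t)) has_vector_derivative (\<Sum>i\<in>UNIV. (- a i (1 - t)) *\<^sub>R X i (\<phi> (1 - t)))) (at t within {0..1})"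
        by (simp add: o_def sum_negf)
      show "(\<Sum>i\<in>UNIV. \<bar>- a i (1 - t)\<bar>\<^sup>2) \<le> \<delta>\<^sup>2" using e(2) by simp
    qed
  qed
  moreover have "(\<lambda>t. \<phi> (1 - t)) ` {0..1} \<subseteq> U" using \<phi>(2) by auto
  ultimately show ?thesis
    unfolding subunit_curve_def using abs_continuous_on_interval_reflect[OF \<phi>(1)] \<phi>(3,4)
    by (intro exI[of _ "\<lambda>t. \<phi> (1 - t)"] exI[of _ "\<lambda>i t. - a i (1 - t)"]) simp
qed

text \<open>Near \<open>t\<close> the piece \<open>T\<close> and the full interval \<open>A'\<close>
  agree, so the derivative of the reparametrized piece is the derivative of the glued curve.
  \<open>A\<close> is the image of \<open>T\<close>, as the chain rule for derivatives within sets
  demands.\<close>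

lemma has_vector_derivative_affine_piece:
  assumes d: "(f has_vector_derivative D) (at (r * t + c) within A)"
    and img: "(\<lambda>t. r * t + c) ` T = A" and h: "\<And>t. t \<in> T \<Longrightarrow> h t = f (r * t + c)"
    and nhd: "open S" "t \<in> S" "T \<inter> S = A' \<inter> S" and t: "t \<in> T"
  shows "(h has_vector_derivative r *\<^sub>R D) (at t within A')"
proof -
  have "((\<lambda>t. r * t + c) has_vector_derivative r) (at t within T)"
    by (auto intro!: derivative_eq_intros simp: has_real_derivative_iff_has_vector_derivative[symmetric])
  from vector_diff_chain_within[OF this, of f, unfolded img, OF d]
  have "((\<lambda>t. f (r * t + c)) has_vector_derivative r *\<^sub>R D) (at t within T)" by (simp add: o_def)
  then have "(h has_vector_derivative r *\<^sub>R D) (at t within T)"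
    by (rule has_vector_derivative_transform[rotated 2]) (use t h in auto)
  moreover have "at t within T = at t within A'"
    by (rule at_within_nhd[OF nhd(2,1)]) (use nhd(3) in blast)
  ultimately show ?thesis by simp
qed

lemma sum_power2_scaled_le:
  fixes a :: "'i \<Rightarrow> real"
  assumes "(\<Sum>i\<in>I. \<bar>a i\<bar>\<^sup>2) \<le> \<delta>\<^sup>2" "0 < \<theta>" "\<delta> / \<theta> = \<epsilon>"
  shows "(\<Sum>i\<in>I. \<bar>a i / \<theta>\<bar>\<^sup>2) \<le> \<epsilon>\<^sup>2"
proof -
  have "(\<Sum>i\<in>I. \<bar>a i / \<theta>\<bar>\<^sup>2) = (\<Sum>i\<in>I. \<bar>a i\<bar>\<^sup>2) / \<theta>\<^sup>2"
    by (simp add: power_divide sum_divide_distrib)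
  also have "\<dots> \<le> \<delta>\<^sup>2 / \<theta>\<^sup>2" using assms(1) by (intro divide_right_mono) auto
  finally show ?thesis using assms(3) by (simp add: power_divide[symmetric])
qed

lemma subunit_curve_concat:
  assumes 1: "subunit_curve X U x z \<delta>1" and 2: "subunit_curve X U z y \<delta>2" and pos: "0 < \<delta>1" "0 < \<delta>2"
  shows "subunit_curve X U x y (\<delta>1 + \<delta>2)"
proof -
  obtain f a where f: "abs_continuous_on_interval 0 1 f" "f ` {0..1} \<subseteq> U" "f 0 = x" "f 1 = z"
    and AEf: "AE t in lebesgue_on {0..1}.
           (f has_vector_derivative (\<Sum>i\<in>UNIV. a i t *\<^sub>R X i (f t))) (at t within {0..1}) \<and>
           (\<Sum>i\<in>UNIV. \<bar>a i t\<bar>\<^sup>2) \<le> \<delta>1\<^sup>2"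
    using 1 unfolding subunit_curve_def by blast
  obtain g b where g: "abs_continuous_on_interval 0 1 g" "g ` {0..1} \<subseteq> U" "g 0 = z" "g 1 = y"
    and AEg: "AE t in lebesgue_on {0..1}.
           (g has_vector_derivative (\<Sum>i\<in>UNIV. b i t *\<^sub>R X i (g t))) (at t within {0..1}) \<and>
           (\<Sum>i\<in>UNIV. \<bar>b i t\<bar>\<^sup>2) \<le> \<delta>2\<^sup>2"
    using 2 unfolding subunit_curve_def by blast
  \<comment> \<open>The parameter interval is divided in proportion to the two bounds, so both
    pieces run with the same speed bound \<open>\<delta>1 + \<delta>2\<close>; halving it would give
    \<open>2 * max \<delta>1 \<delta>2\<close>.\<close>
  define \<theta> where "\<theta> = \<delta>1 / (\<delta>1 + \<delta>2)"
  have \<theta>: "0 < \<theta>" "\<theta> < 1" "\<delta>1 / \<theta> = \<delta>1 + \<delta>2" "\<delta>2 / (1 - \<theta>) = \<delta>1 + \<delta>2"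
    using pos by (auto simp: \<theta>_def field_simps)
  \<comment> \<open>Both pieces are clamped and added, minus the common point \<open>z\<close>: at
    every time one of them rests in \<open>z\<close>. Absolute continuity then follows from sums and
    monotone changes of parameter, without gluing.\<close>
  define h where "h t = f (min 1 (t / \<theta>)) + (g (max 0 ((t - \<theta>) / (1 - \<theta>))) + - z)" for t
  define e where "e i t = (if t < \<theta> then a i (t / \<theta>) / \<theta> else b i ((t - \<theta>) / (1 - \<theta>)) / (1 - \<theta>))" for i t
  have h1: "h t = f (t / \<theta>)" if "t \<le> \<theta>" for t
    using that \<theta> g(3) by (simp add: h_def min_def max_def field_simps)
  have h2: "h t = g ((t - \<theta>) / (1 - \<theta>))" if "\<theta> \<le> t" for t
    using that \<theta> f(4) by (simp add: h_def min_def max_def field_simps)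
  have lin: "(t - \<theta>) / (1 - \<theta>) = (1 / (1 - \<theta>)) * t + (- \<theta> / (1 - \<theta>))" for t
    by (simp add: diff_divide_distrib)
  have AC1: "abs_continuous_on_interval 0 1 (\<lambda>t. f (min 1 (t / \<theta>)))"
  proof (rule abs_continuous_on_interval_compose_mono[OF f(1), where L = "1 / \<theta>"])
    fix s t :: real assume "0 \<le> s" "s \<le> t" "t \<le> 1"
    then have "s / \<theta> \<le> t / \<theta>" using \<theta> by (simp add: divide_right_mono)
    then show "min 1 (s / \<theta>) \<le> min 1 (t / \<theta>)" "min 1 (t / \<theta>) - min 1 (s / \<theta>) \<le> 1 / \<theta> * (t - s)"
      by (auto simp: min_def diff_divide_distrib)
  qed (use \<theta> in auto)
  have AC2: "abs_continuous_on_interval 0 1 (\<lambda>t. g (max 0 ((t - \<theta>) / (1 - \<theta>))))"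
  proof (rule abs_continuous_on_interval_compose_mono[OF g(1), where L = "1 / (1 - \<theta>)"])
    fix s t :: real assume "0 \<le> s" "s \<le> t" "t \<le> 1"
    then have "(s - \<theta>) / (1 - \<theta>) \<le> (t - \<theta>) / (1 - \<theta>)" using \<theta> by (simp add: divide_right_mono)
    then show "max 0 ((s - \<theta>) / (1 - \<theta>)) \<le> max 0 ((t - \<theta>) / (1 - \<theta>))"
      "max 0 ((t - \<theta>) / (1 - \<theta>)) - max 0 ((s - \<theta>) / (1 - \<theta>)) \<le> 1 / (1 - \<theta>) * (t - s)"
      by (auto simp: max_def diff_divide_distrib)
  qed (use \<theta> in \<open>auto simp: max_def\<close>)
  have const: "abs_continuous_on_interval 0 1 (\<lambda>t. - z)"
    unfolding abs_continuous_on_interval_def by (auto intro!: exI[of _ 1] simp: case_prod_beta)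
  have "abs_continuous_on_interval 0 1 h"
    unfolding h_def by (intro abs_continuous_on_interval_add AC1 AC2 const)
  moreover have "h ` {0..1} \<subseteq> U"
  proof (intro image_subsetI)
    fix t :: real assume t: "t \<in> {0..1}"
    show "h t \<in> U"
    proof (cases "t \<le> \<theta>")
      case True
      then have "t / \<theta> \<in> {0..1}" using t \<theta> by auto
      then show ?thesis using h1[OF True] f(2) by auto
    next
      case False
      then have "(t - \<theta>) / (1 - \<theta>) \<in> {0..1}" using t \<theta> by auto
      then show ?thesis using h2[of t] False g(2) by auto
    qed
  qed
  moreover have "h 0 = x" "h 1 = y" using h1[of 0] h2[of 1] \<theta> f(3) g(4) by auto
  moreover have "AE t in lebesgue_on {0..1}.
     (h has_vector_derivative (\<Sum>i\<in>UNIV. e i t *\<^sub>R X i (h t))) (at t within {0..1}) \<and>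
     (\<Sum>i\<in>UNIV. \<bar>e i t\<bar>\<^sup>2) \<le> (\<delta>1 + \<delta>2)\<^sup>2"
  proof -
    have ne: "AE t in lebesgue. t \<notin> {\<theta>}"
      by (rule AE_not_in) (simp add: negligible_iff_null_sets[symmetric])
    have p1: "1 / \<theta> \<noteq> 0" "1 / (1 - \<theta>) \<noteq> 0" using \<theta> by auto
    show ?thesis
      unfolding AE_restrict_space_iff[of "{0..1::real}" lebesgue, simplified]
      using ne AE_lebesgue_on_affine[OF AEf p1(1), of 0]
        AE_lebesgue_on_affine[OF AEg p1(2), of "- \<theta> / (1 - \<theta>)", folded lin]
    proof eventually_elim
      case (elim t)
      show ?case
      proof (intro impI, cases "t < \<theta>")
        case True
        assume t: "0 \<le> t \<and> t \<le> 1"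
        have "t / \<theta> \<in> {0..1}" using t \<theta> True by auto
        then have d: "(f has_vector_derivative (\<Sum>i\<in>UNIV. a i (1 / \<theta> * t + 0) *\<^sub>R X i (f (1 / \<theta> * t + 0))))
            (at (1 / \<theta> * t + 0) within {0..1})"
          and bd: "(\<Sum>i\<in>UNIV. \<bar>a i (t / \<theta>)\<bar>\<^sup>2) \<le> \<delta>1\<^sup>2" using elim(2) by auto
        have "(h has_vector_derivative (1 / \<theta>) *\<^sub>R (\<Sum>i\<in>UNIV. a i (1 / \<theta> * t + 0) *\<^sub>R X i (f (1 / \<theta> * t + 0))))
            (at t within {0..1})"
        proof (rule has_vector_derivative_affine_piece[OF d, of "{0..\<theta>}" h "{..<\<theta>}"])
          show "(\<lambda>t. 1 / \<theta> * t + 0) ` {0..\<theta>} = {0..1}" using \<theta> by (auto intro!: image_eqI[of _ _ "_ * \<theta>"])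
        qed (use t True \<theta> h1 in auto)
        moreover have "(1 / \<theta>) *\<^sub>R (\<Sum>i\<in>UNIV. a i (1 / \<theta> * t + 0) *\<^sub>R X i (f (1 / \<theta> * t + 0))) = (\<Sum>i\<in>UNIV. e i t *\<^sub>R X i (h t))"
          using True h1[of t] by (simp add: e_def scaleR_sum_right)
        moreover have "(\<Sum>i\<in>UNIV. \<bar>e i t\<bar>\<^sup>2) \<le> (\<delta>1 + \<delta>2)\<^sup>2"
          using True sum_power2_scaled_le[OF bd \<theta>(1,3)] by (simp add: e_def)
        ultimately show "(h has_vector_derivative (\<Sum>i\<in>UNIV. e i t *\<^sub>R X i (h t))) (at t within {0..1}) \<and>
          (\<Sum>i\<in>UNIV. \<bar>e i t\<bar>\<^sup>2) \<le> (\<delta>1 + \<delta>2)\<^sup>2" by simp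
      next
        case False
        assume t: "0 \<le> t \<and> t \<le> 1"
        have gt: "\<theta> < t" using False elim(1) by auto
        let ?s = "(t - \<theta>) / (1 - \<theta>)"
        have "?s \<in> {0..1}" using t \<theta> gt by auto
        then have d: "(g has_vector_derivative (\<Sum>i\<in>UNIV. b i ?s *\<^sub>R X i (g ?s))) (at ?s within {0..1})"
          and bd: "(\<Sum>i\<in>UNIV. \<bar>b i ?s\<bar>\<^sup>2) \<le> \<delta>2\<^sup>2" using elim(3) by auto
        have "(h has_vector_derivative (1 / (1 - \<theta>)) *\<^sub>R (\<Sum>i\<in>UNIV. b i ?s *\<^sub>R X i (g ?s))) (at t within {0..1})"
        proof (rule has_vector_derivative_affine_piece[OF d[unfolded lin], of "{\<theta>..1}" h "{\<theta><..}", folded lin])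
          show "(\<lambda>t. (t - \<theta>) / (1 - \<theta>)) ` {\<theta>..1} = {0..1}"
          proof (intro equalityI subsetI)
            fix s :: real assume s: "s \<in> {0..1}"
            have "\<theta> + s * (1 - \<theta>) \<le> \<theta> + 1 * (1 - \<theta>)" using s \<theta> by (intro add_left_mono mult_right_mono) auto
            then show "s \<in> (\<lambda>t. (t - \<theta>) / (1 - \<theta>)) ` {\<theta>..1}"
              using s \<theta> by (intro image_eqI[of _ _ "\<theta> + s * (1 - \<theta>)"]) auto
          qed (use \<theta> in auto)
        qed (use t gt \<theta> h2 in auto)
        moreover have "(1 / (1 - \<theta>)) *\<^sub>R (\<Sum>i\<in>UNIV. b i ?s *\<^sub>R X i (g ?s)) = (\<Sum>i\<in>UNIV. e i t *\<^sub>R X i (h t))"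
          using gt h2[of t] by (simp add: e_def scaleR_sum_right)
        moreover have "(\<Sum>i\<in>UNIV. \<bar>e i t\<bar>\<^sup>2) \<le> (\<delta>1 + \<delta>2)\<^sup>2"
          using gt \<theta>(2) sum_power2_scaled_le[OF bd _ \<theta>(4)] by (simp add: e_def)
        ultimately show "(h has_vector_derivative (\<Sum>i\<in>UNIV. e i t *\<^sub>R X i (h t))) (at t within {0..1}) \<and>
          (\<Sum>i\<in>UNIV. \<bar>e i t\<bar>\<^sup>2) \<le> (\<delta>1 + \<delta>2)\<^sup>2" by simp
      qed
    qed
  qed
  ultimately show ?thesis unfolding subunit_curve_def by blast
qed

lemma subunit_curve_refl:
  assumes "x \<in> U"
  shows "subunit_curve X U x x \<delta>"
proof -
  have "abs_continuous_on_interval 0 1 (\<lambda>_. x)"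
    unfolding abs_continuous_on_interval_def by (auto intro!: exI[of _ 1] simp: case_prod_beta)
  then show ?thesis
    unfolding subunit_curve_def using assms
    by (intro exI[of _ "\<lambda>_. x"] exI[of _ "\<lambda>_ _. 0"]) auto
qed

text \<open>The infimum need not be attained and may be infinite. A strict inequality with a real
  bound translates directly into a curve, so the triangle inequality below is stated in this
  form.\<close>

lemma subunit_dist_less_iff:
  "subunit_dist X U x y < ennreal r \<longleftrightarrow> (\<exists>\<delta>. 0 < \<delta> \<and> \<delta> < r \<and> subunit_curve X U x y \<delta>)"
  unfolding subunit_dist_def Inf_less_iff by (auto simp: ennreal_less_iff)

lemma subunit_dist_less_commute:
  "subunit_dist X U x y < ennreal r \<longleftrightarrow> subunit_dist X U y x < ennreal r"
  unfolding subunit_dist_less_iff using subunit_curve_reverse by blast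

lemma subunit_dist_commute: "subunit_dist X U x y = subunit_dist X U y x"
proof -
  have "subunit_curve X U x y = subunit_curve X U y x" using subunit_curve_reverse by blast
  then show ?thesis unfolding subunit_dist_def by simp
qed

lemma subunit_dist_triangle_less:
  assumes "subunit_dist X U x z < ennreal r" "subunit_dist X U z y < ennreal s"
  shows "subunit_dist X U x y < ennreal (r + s)"
proof -
  obtain \<delta> where "0 < \<delta>" "\<delta> < r" "subunit_curve X U x z \<delta>" using assms(1) unfolding subunit_dist_less_iff by blast
  moreover obtain \<epsilon> where "0 < \<epsilon>" "\<epsilon> < s" "subunit_curve X U z y \<epsilon>" using assms(2) unfolding subunit_dist_less_iff by blast
  ultimately show ?thesis
    unfolding subunit_dist_less_iff using subunit_curve_concat by (intro exI[of _ "\<delta> + \<epsilon>"]) auto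
qed

lemma subunit_dist_refl_less: "x \<in> U \<Longrightarrow> 0 < r \<Longrightarrow> subunit_dist X U x x < ennreal r"
  unfolding subunit_dist_less_iff using subunit_curve_refl by (intro exI[of _ "r / 2"]) auto

text \<open>Inside the ball of radius \<open>n\<close> the measures of disjoint sets have bounded
  finite sums, so only countably many of them are nonzero; every set of positive measure is seen by
  some \<open>n\<close>.\<close>

lemma countable_disjoint_positive_measure:
  fixes A :: "'i \<Rightarrow> 'a::euclidean_space set"
  assumes disj: "disjoint_family_on A Z" and meas: "\<And>z. z \<in> Z \<Longrightarrow> A z \<in> sets lebesgue"
    and pos: "\<And>z. z \<in> Z \<Longrightarrow> 0 < emeasure lebesgue (A z)"
  shows "countable Z"
proof -
  define R where "R n = (cball 0 (real n) :: 'a set)" for n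
  have R: "R n \<in> lmeasurable" for n unfolding R_def by simp
  have AR: "A z \<inter> R n \<in> lmeasurable" if "z \<in> Z" for z n
    using fmeasurable_Int_fmeasurable[OF R meas[OF that]] by (simp add: Int_commute)
  have c: "countable {z\<in>Z. measure lebesgue (A z \<inter> R n) \<noteq> 0}" for n
  proof (rule summable_countable_real)
    show "(\<lambda>z. measure lebesgue (A z \<inter> R n)) summable_on Z"
    proof (rule nonneg_bdd_above_summable_on)
      show "bdd_above (sum (\<lambda>z. measure lebesgue (A z \<inter> R n)) ` {F. F \<subseteq> Z \<and> finite F})"
      proof (rule bdd_aboveI2[where M = "measure lebesgue (R n)"])
        fix F assume "F \<in> {F. F \<subseteq> Z \<and> finite F}"
        then have F: "F \<subseteq> Z" "finite F" by auto
        have "(\<Sum>z\<in>F. measure lebesgue (A z \<inter> R n)) = measure lebesgue (\<Union>z\<in>F. A z \<inter> R n)"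
        proof (rule measure_finite_Union[symmetric, OF F(2)])
          show "(\<lambda>z. A z \<inter> R n) ` F \<subseteq> sets lebesgue" using F AR by (auto dest: fmeasurableD)
          show "disjoint_family_on (\<lambda>z. A z \<inter> R n) F"
            using disj F unfolding disjoint_family_on_def by blast
          show "emeasure lebesgue (A z \<inter> R n) \<noteq> \<infinity>" if "z \<in> F" for z
            using fmeasurableD2[OF AR, of z n] that F by auto
        qed
        also have "\<dots> \<le> measure lebesgue (R n)"
          using F R AR by (intro measure_mono_fmeasurable sets.finite_UN) (auto dest: fmeasurableD)
        finally show "(\<Sum>z\<in>F. measure lebesgue (A z \<inter> R n)) \<le> measure lebesgue (R n)" .
      qed
    qed auto
  qed
  have "Z \<subseteq> (\<Union>n. {z\<in>Z. measure lebesgue (A z \<inter> R n) \<noteq> 0})"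
  proof
    fix z assume z: "z \<in> Z"
    have "\<exists>n. measure lebesgue (A z \<inter> R n) \<noteq> 0"
    proof (rule ccontr)
      assume "\<nexists>n. measure lebesgue (A z \<inter> R n) \<noteq> 0"
      then have "emeasure lebesgue (A z \<inter> R n) = 0" for n
        using emeasure_eq_measure2[OF AR[OF z], of n] by simp
      then have "(\<Union>n. A z \<inter> R n) \<in> null_sets lebesgue"
        using AR[OF z] by (intro null_sets_UN) (auto simp: null_sets_def dest: fmeasurableD)
      moreover have "(\<Union>n. A z \<inter> R n) = A z"
        using real_arch_simple by (auto simp: R_def)
      ultimately show False using pos[OF z] by (simp add: null_sets_def)
    qed
    then show "z \<in> (\<Union>n. {z\<in>Z. measure lebesgue (A z \<inter> R n) \<noteq> 0})" using z by blast
  qed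
  then show ?thesis by (rule countable_subset) (intro countable_UN c, simp)
qed

lemma subunit_separable:
  assumes sub: "\<Omega> \<subseteq> U" and e: "0 < \<epsilon>"
    and meas: "\<And>z. z \<in> \<Omega> \<Longrightarrow> subunit_ball X U z (\<epsilon> / 2) \<in> sets lebesgue"
    and pos: "\<And>z. z \<in> \<Omega> \<Longrightarrow> 0 < emeasure lebesgue (subunit_ball X U z (\<epsilon> / 2))"
  obtains Z where "countable Z" "Z \<subseteq> \<Omega>" "\<And>x. x \<in> \<Omega> \<Longrightarrow> \<exists>z\<in>Z. subunit_dist X U x z < ennreal \<epsilon>"
proof -
  text \<open>The balls of radius \<open>\<epsilon> / 2\<close> around a maximal \<open>\<epsilon>\<close>-separated set are disjoint.\<close>
  define sep where "sep Z \<longleftrightarrow> Z \<subseteq> \<Omega> \<and> (\<forall>x\<in>Z. \<forall>y\<in>Z. x \<noteq> y \<longrightarrow> \<not> subunit_dist X U x y < ennreal \<epsilon>)" for Z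
  have "\<exists>M\<in>Collect sep. \<forall>Z\<in>Collect sep. M \<subseteq> Z \<longrightarrow> Z = M"
  proof (rule subset_Zorn')
    fix C assume C: "subset.chain (Collect sep) C"
    then have sep: "\<And>Z. Z \<in> C \<Longrightarrow> sep Z" unfolding subset.chain_def by auto
    have "sep (\<Union>C)"
      unfolding sep_def
    proof (intro conjI ballI impI)
      show "\<Union>C \<subseteq> \<Omega>" using sep unfolding sep_def by blast
      fix x y assume "x \<in> \<Union>C" "y \<in> \<Union>C" "x \<noteq> y"
      then obtain A B where "A \<in> C" "B \<in> C" "x \<in> A" "y \<in> B" by blast
      moreover have "A \<subseteq> B \<or> B \<subseteq> A" using C \<open>A \<in> C\<close> \<open>B \<in> C\<close> unfolding subset.chain_def by blast
      ultimately show "\<not> subunit_dist X U x y < ennreal \<epsilon>"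
        using sep \<open>x \<noteq> y\<close> unfolding sep_def by (metis subsetD)
    qed
    then show "\<Union>C \<in> Collect sep" by simp
  qed
  then obtain Z where Z: "sep Z" "\<And>Y. sep Y \<Longrightarrow> Z \<subseteq> Y \<Longrightarrow> Y = Z" by auto
  show ?thesis
  proof (rule that)
    show ZO: "Z \<subseteq> \<Omega>" using Z(1) unfolding sep_def by blast
    show "countable Z"
    proof (rule countable_disjoint_positive_measure[where A = "\<lambda>z. subunit_ball X U z (\<epsilon> / 2)"])
      show "disjoint_family_on (\<lambda>z. subunit_ball X U z (\<epsilon> / 2)) Z"
        unfolding disjoint_family_on_def
      proof (intro ballI impI)
        fix x y assume xy: "x \<in> Z" "y \<in> Z" "x \<noteq> y"
        have False if "w \<in> subunit_ball X U x (\<epsilon> / 2) \<inter> subunit_ball X U y (\<epsilon> / 2)" for w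
        proof -
          have "subunit_dist X U x w < ennreal (\<epsilon> / 2)" "subunit_dist X U w y < ennreal (\<epsilon> / 2)"
            using that subunit_dist_less_commute unfolding subunit_ball_def by blast+
          from subunit_dist_triangle_less[OF this] have "subunit_dist X U x y < ennreal \<epsilon>" by simp
          then show False using Z(1) xy unfolding sep_def by blast
        qed
        then show "subunit_ball X U x (\<epsilon> / 2) \<inter> subunit_ball X U y (\<epsilon> / 2) = {}" by blast
      qed
    qed (use meas pos ZO in auto)
    fix x assume x: "x \<in> \<Omega>"
    show "\<exists>z\<in>Z. subunit_dist X U x z < ennreal \<epsilon>"
    proof (rule ccontr)
      assume no: "\<not> (\<exists>z\<in>Z. subunit_dist X U x z < ennreal \<epsilon>)"
      have "sep (insert x Z)"
        using Z(1) x no subunit_dist_less_commute[of X U] unfolding sep_def by blast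
      then have "x \<in> Z" using Z(2) by blast
      then show False using no subunit_dist_refl_less[OF _ e] x sub by blast
    qed
  qed
qed

text \<open>A pair has distance below \<open>r\<close> iff, for some \<open>z\<close> from the
  countable nets and some rational \<open>s\<close> between 0 and \<open>r\<close>, its first point
  lies in the ball of radius \<open>s\<close> about \<open>z\<close> and its second in the ball of
  radius \<open>r - s\<close>. Each sublevel set is thus a countable union of measurable
  rectangles.\<close>

lemma subunit_dist_measurable:
  assumes \<Omega>: "\<Omega> \<in> sets lebesgue" "\<Omega> \<subseteq> U"
    and meas: "\<And>z s. z \<in> \<Omega> \<Longrightarrow> 0 < s \<Longrightarrow> subunit_ball X U z s \<inter> \<Omega> \<in> sets lebesgue"
    and sep: "\<And>\<epsilon>. 0 < \<epsilon> \<Longrightarrow> \<exists>Z. countable Z \<and> Z \<subseteq> \<Omega> \<and> (\<forall>x\<in>\<Omega>. \<exists>z\<in>Z. subunit_dist X U x z < ennreal \<epsilon>)"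
  shows "(\<lambda>(x, y). subunit_dist X U x y) \<in> borel_measurable (lebesgue_on \<Omega> \<Otimes>\<^sub>M lebesgue_on \<Omega>)"
proof -
  let ?M = "lebesgue_on \<Omega> \<Otimes>\<^sub>M lebesgue_on \<Omega>"
  have space: "space ?M = \<Omega> \<times> \<Omega>" by (simp add: space_pair_measure space_restrict_space)
  obtain Z where Z: "\<And>n. countable (Z n)" "\<And>n. Z n \<subseteq> \<Omega>"
    "\<And>n x. x \<in> \<Omega> \<Longrightarrow> \<exists>z\<in>Z n. subunit_dist X U x z < ennreal (1 / real (Suc n))"
  proof -
    have "\<forall>n. \<exists>Z. countable Z \<and> Z \<subseteq> \<Omega> \<and> (\<forall>x\<in>\<Omega>. \<exists>z\<in>Z. subunit_dist X U x z < ennreal (1 / real (Suc n)))"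
      using sep by simp
    then show ?thesis using that by metis
  qed
  have sets_less: "{p\<in>\<Omega> \<times> \<Omega>. subunit_dist X U (fst p) (snd p) < ennreal r} \<in> sets ?M" if r: "0 < r" for r
  proof -
    define I where "I = (SIGMA z:(\<Union>n. Z n). {s\<in>\<rat>. 0 < s \<and> s < r})"
    have I: "countable I"
      unfolding I_def by (intro countable_SIGMA countable_UN Z(1) countable_subset[OF _ countable_rat]) auto
    have "{p\<in>\<Omega> \<times> \<Omega>. subunit_dist X U (fst p) (snd p) < ennreal r} =
        (\<Union>(z, s)\<in>I. (subunit_ball X U z s \<inter> \<Omega>) \<times> (subunit_ball X U z (r - s) \<inter> \<Omega>))"
    proof (intro equalityI subsetI)
      fix p assume "p \<in> {p\<in>\<Omega> \<times> \<Omega>. subunit_dist X U (fst p) (snd p) < ennreal r}"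
      then obtain x y where p: "p = (x, y)" "x \<in> \<Omega>" "y \<in> \<Omega>" "subunit_dist X U x y < ennreal r" by auto
      then obtain \<delta> where \<delta>: "0 < \<delta>" "\<delta> < r" "subunit_curve X U x y \<delta>" unfolding subunit_dist_less_iff by blast
      \<comment> \<open>A third of the slack \<open>r - \<delta>\<close>: with \<open>s < e\<close>
        one gets \<open>s + (\<delta> + e) \<le> r - s\<close>.\<close>
      define e where "e = (r - \<delta>) / 3"
      have e: "0 < e" unfolding e_def using \<delta> by simp
      obtain n where n: "1 / real (Suc n) < e" using nat_approx_posE[OF e] by blast
      obtain z where z: "z \<in> Z n" "subunit_dist X U x z < ennreal (1 / real (Suc n))" using Z(3)[OF p(2)] by blast
      obtain s where s: "s \<in> \<rat>" "1 / real (Suc n) < s" "s < e" using Rats_dense_in_real[OF n] by blast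
      have s0: "0 < s" using s(2) by (smt (verit) divide_pos_pos of_nat_0_less_iff zero_less_Suc)
      have s1: "s < r" using s(3) \<delta> unfolding e_def by simp
      have xz: "subunit_dist X U x z < ennreal s"
        using z(2) s(2) s0 by (meson ennreal_leI less_imp_le order_less_le_trans)
      have "subunit_dist X U x y < ennreal (\<delta> + e)"
        unfolding subunit_dist_less_iff using \<delta> e by auto
      from subunit_dist_triangle_less[OF xz[unfolded subunit_dist_less_commute[of X U x z]] this]
      have "subunit_dist X U z y < ennreal (s + (\<delta> + e))" .
      also have "\<dots> \<le> ennreal (r - s)" using s(3) unfolding e_def by (intro ennreal_leI) (simp add: field_simps)
      finally have "y \<in> subunit_ball X U z (r - s)" using p \<Omega>(2) unfolding subunit_ball_def by auto
      moreover have "x \<in> subunit_ball X U z s"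
        using xz p \<Omega>(2) subunit_dist_less_commute unfolding subunit_ball_def by blast
      moreover have "(z, s) \<in> I" unfolding I_def using z(1) s s0 s1 by auto
      ultimately show "p \<in> (\<Union>(z, s)\<in>I. (subunit_ball X U z s \<inter> \<Omega>) \<times> (subunit_ball X U z (r - s) \<inter> \<Omega>))"
        using p by blast
    next
      fix p assume "p \<in> (\<Union>(z, s)\<in>I. (subunit_ball X U z s \<inter> \<Omega>) \<times> (subunit_ball X U z (r - s) \<inter> \<Omega>))"
      then obtain z s x y where *: "p = (x, y)" "x \<in> subunit_ball X U z s \<inter> \<Omega>" "y \<in> subunit_ball X U z (r - s) \<inter> \<Omega>"
        by blast
      then have "subunit_dist X U x z < ennreal s" "subunit_dist X U z y < ennreal (r - s)"
        using subunit_dist_less_commute unfolding subunit_ball_def by blast+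
      from subunit_dist_triangle_less[OF this] show "p \<in> {p\<in>\<Omega> \<times> \<Omega>. subunit_dist X U (fst p) (snd p) < ennreal r}"
        using * by simp
    qed
    also have "\<dots> \<in> sets ?M"
    proof (rule sets.countable_UN''[OF I])
      fix i assume "i \<in> I"
      then obtain z s where i: "i = (z, s)" "z \<in> \<Omega>" "0 < s" "s < r" unfolding I_def using Z(2) by blast
      have "subunit_ball X U z s \<inter> \<Omega> \<in> sets (lebesgue_on \<Omega>)" "subunit_ball X U z (r - s) \<inter> \<Omega> \<in> sets (lebesgue_on \<Omega>)"
        using meas i \<Omega>(1) by (auto simp: sets_restrict_space_iff)
      then show "(case i of (z, s) \<Rightarrow> (subunit_ball X U z s \<inter> \<Omega>) \<times> (subunit_ball X U z (r - s) \<inter> \<Omega>)) \<in> sets ?M"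
        using i(1) by auto
    qed
    finally show ?thesis .
  qed
  show ?thesis
  proof (rule borel_measurableI_less)
    fix y :: ennreal
    show "{p \<in> space ?M. (case p of (x, y) \<Rightarrow> subunit_dist X U x y) < y} \<in> sets ?M"
    proof (cases y)
      case (real r)
      show ?thesis
      proof (cases "0 < r")
        case True
        then show ?thesis using sets_less[of r] real space by (simp add: case_prod_beta)
      next
        case False
        then have "y = 0" using real by (simp add: ennreal_neg)
        then show ?thesis by simp
      qed
    next
      case top
      have "{p \<in> \<Omega> \<times> \<Omega>. subunit_dist X U (fst p) (snd p) < top} =
          (\<Union>n. {p\<in>\<Omega> \<times> \<Omega>. subunit_dist X U (fst p) (snd p) < ennreal (real (Suc n))})"
      proof (intro equalityI subsetI)
        fix p assume p: "p \<in> {p \<in> \<Omega> \<times> \<Omega>. subunit_dist X U (fst p) (snd p) < top}"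
        then obtain r where r: "subunit_dist X U (fst p) (snd p) = ennreal r" "0 \<le> r"
          by (cases "subunit_dist X U (fst p) (snd p)") auto
        obtain n where "r < real n" using reals_Archimedean2 by blast
        then have "ennreal r < ennreal (real (Suc n))" using r(2) by (subst ennreal_less_iff) auto
        then show "p \<in> (\<Union>n. {p\<in>\<Omega> \<times> \<Omega>. subunit_dist X U (fst p) (snd p) < ennreal (real (Suc n))})"
          using p r(1) by auto
      qed (auto simp: less_top[symmetric] simp del: of_nat_Suc)
      also have "\<dots> \<in> sets ?M" by (intro sets.countable_UN image_subsetI sets_less) simp
      finally show ?thesis using top space by (simp add: case_prod_beta)
    qed
  qed
qed

section \<open>Kernels of weak type and exponential moments\<close>

text \<open>Concavity of the logarithm, in the form of its tangent at the weighted mean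
  \<open>m\<close>.\<close>

lemma weighted_am_gm3:
  fixes a b c :: real
  assumes "0 \<le> \<alpha>" "0 \<le> \<beta>" "0 \<le> \<gamma>" "\<alpha> + \<beta> + \<gamma> = 1" "0 \<le> a" "0 \<le> b" "0 \<le> c"
  shows "a powr \<alpha> * b powr \<beta> * c powr \<gamma> \<le> \<alpha> * a + \<beta> * b + \<gamma> * c"
proof (cases "a = 0 \<or> b = 0 \<or> c = 0")
  case True
  have "0 \<le> \<alpha> * a + \<beta> * b + \<gamma> * c" using assms by simp
  with True show ?thesis by auto
next
  case False
  then have pos: "0 < a" "0 < b" "0 < c" using assms by auto
  define m where "m = \<alpha> * a + \<beta> * b + \<gamma> * c"
  have "0 < m"
  proof -
    define d where "d = min a (min b c)"
    have "0 < d" "d \<le> a" "d \<le> b" "d \<le> c" using pos unfolding d_def by auto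
    then have "\<alpha> * d + \<beta> * d + \<gamma> * d \<le> m"
      unfolding m_def using assms by (intro add_mono mult_left_mono) auto
    moreover have "\<alpha> * d + \<beta> * d + \<gamma> * d = d" using assms(4) by (simp add: distrib_right[symmetric])
    ultimately show ?thesis using \<open>0 < d\<close> by linarith
  qed
  have ln_le: "ln x \<le> ln m + (x / m - 1)" if "0 < x" for x
    using ln_le_minus_one[of "x / m"] that \<open>0 < m\<close> by (simp add: ln_div)
  have "\<alpha> * ln a + \<beta> * ln b + \<gamma> * ln c \<le>
      \<alpha> * (ln m + (a / m - 1)) + \<beta> * (ln m + (b / m - 1)) + \<gamma> * (ln m + (c / m - 1))"
    using assms pos by (intro add_mono mult_left_mono ln_le) auto
  also have "\<dots> = (\<alpha> + \<beta> + \<gamma>) * (ln m - 1) + (\<alpha> * a + \<beta> * b + \<gamma> * c) / m"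
    by (simp add: algebra_simps add_divide_distrib)
  also have "\<dots> = ln m" unfolding m_def[symmetric] using assms(4) \<open>0 < m\<close> by simp
  finally have "exp (\<alpha> * ln a + \<beta> * ln b + \<gamma> * ln c) \<le> m" using \<open>0 < m\<close> by (metis exp_le_cancel_iff exp_ln)
  then show ?thesis using pos by (simp add: powr_def exp_add m_def)
qed

text \<open>Upper bounds \<open>A\<close>, \<open>B\<close>, \<open>C\<close> stand in for the
  integrals: each factor is divided by its bound and the weighted arithmetic-geometric inequality is
  integrated. Positive real bounds avoid the cases of a vanishing or infinite integral.\<close>

lemma nn_integral_holder3:
  fixes u v w :: "'a \<Rightarrow> real"
  assumes m[measurable]: "u \<in> borel_measurable M" "v \<in> borel_measurable M" "w \<in> borel_measurable M"
    and nn: "\<And>x. 0 \<le> u x" "\<And>x. 0 \<le> v x" "\<And>x. 0 \<le> w x"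
    and e: "0 \<le> \<alpha>" "0 \<le> \<beta>" "0 \<le> \<gamma>" "\<alpha> + \<beta> + \<gamma> = 1"
    and pos: "0 < A" "0 < B" "0 < C"
    and int: "(\<integral>\<^sup>+x. ennreal (u x) \<partial>M) \<le> ennreal A" "(\<integral>\<^sup>+x. ennreal (v x) \<partial>M) \<le> ennreal B"
      "(\<integral>\<^sup>+x. ennreal (w x) \<partial>M) \<le> ennreal C"
  shows "(\<integral>\<^sup>+x. ennreal (u x powr \<alpha> * v x powr \<beta> * w x powr \<gamma>) \<partial>M) \<le> ennreal (A powr \<alpha> * B powr \<beta> * C powr \<gamma>)"
proof -
  define D where "D = A powr \<alpha> * B powr \<beta> * C powr \<gamma>"
  have D: "0 < D" unfolding D_def using pos by simp
  have "u x powr \<alpha> * v x powr \<beta> * w x powr \<gamma> \<le>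
      D * (\<alpha> / A) * u x + D * (\<beta> / B) * v x + D * (\<gamma> / C) * w x" for x
  proof -
    have "(u x / A) powr \<alpha> * (v x / B) powr \<beta> * (w x / C) powr \<gamma> \<le> \<alpha> * (u x / A) + \<beta> * (v x / B) + \<gamma> * (w x / C)"
      by (rule weighted_am_gm3) (use e nn pos in auto)
    moreover have "(u x / A) powr \<alpha> * (v x / B) powr \<beta> * (w x / C) powr \<gamma> = (u x powr \<alpha> * v x powr \<beta> * w x powr \<gamma>) / D"
      unfolding D_def using pos nn by (simp add: powr_divide)
    ultimately have "(u x powr \<alpha> * v x powr \<beta> * w x powr \<gamma>) \<le> D * (\<alpha> * (u x / A) + \<beta> * (v x / B) + \<gamma> * (w x / C))"
      using D by (simp add: divide_le_eq mult.commute)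
    then show ?thesis by (simp add: algebra_simps)
  qed
  then have "(\<integral>\<^sup>+x. ennreal (u x powr \<alpha> * v x powr \<beta> * w x powr \<gamma>) \<partial>M) \<le>
      (\<integral>\<^sup>+x. ennreal (D * (\<alpha> / A)) * ennreal (u x) + ennreal (D * (\<beta> / B)) * ennreal (v x) + ennreal (D * (\<gamma> / C)) * ennreal (w x) \<partial>M)"
    using D e pos nn
    by (intro nn_integral_mono) (simp add: ennreal_mult[symmetric] ennreal_plus[symmetric] del: ennreal_plus)
  also have "\<dots> = ennreal (D * (\<alpha> / A)) * (\<integral>\<^sup>+x. ennreal (u x) \<partial>M) +
      ennreal (D * (\<beta> / B)) * (\<integral>\<^sup>+x. ennreal (v x) \<partial>M) + ennreal (D * (\<gamma> / C)) * (\<integral>\<^sup>+x. ennreal (w x) \<partial>M)"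
    by (simp add: nn_integral_add nn_integral_cmult)
  also have "\<dots> \<le> ennreal (D * (\<alpha> / A)) * ennreal A + ennreal (D * (\<beta> / B)) * ennreal B + ennreal (D * (\<gamma> / C)) * ennreal C"
    using int by (intro add_mono mult_left_mono) auto
  also have "\<dots> = ennreal (D * (\<alpha> / A) * A + D * (\<beta> / B) * B + D * (\<gamma> / C) * C)"
    using D e pos by (simp add: ennreal_mult[symmetric] ennreal_plus[symmetric] del: ennreal_plus)
  also have "D * (\<alpha> / A) * A + D * (\<beta> / B) * B + D * (\<gamma> / C) * C = D * (\<alpha> + \<beta> + \<gamma>)"
    using pos by (simp add: algebra_simps)
  finally show ?thesis using e(4) by (simp add: D_def)
qed

text \<open>Layer cake formula. Levels \<open>s\<close> up to \<open>s0 = t0 powr (- a)\<close> are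
  estimated by the total mass; at higher ones the weak type bound applies with
  \<open>t = s powr (- (1 / a))\<close>, which is at most \<open>t0\<close>. Integrating
  \<open>\<Gamma> * s powr (- (1 / a))\<close> over the tail produces the factor
  \<open>a / (1 - a)\<close>.\<close>

lemma (in finite_measure) nn_integral_powr_weak_type:
  fixes g :: "'a \<Rightarrow> real"
  assumes g[measurable]: "g \<in> borel_measurable M" and nn: "\<And>x. 0 \<le> g x"
    and t0: "0 < t0" and \<Gamma>: "0 \<le> \<Gamma>" and a: "0 < a" "a < 1"
    and weak: "\<And>t. 0 < t \<Longrightarrow> t \<le> t0 \<Longrightarrow> emeasure M {x\<in>space M. 1 / t < g x} \<le> ennreal (\<Gamma> * t)"
  shows "(\<integral>\<^sup>+x. ennreal (g x powr a) \<partial>M) \<le>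
    ennreal (t0 powr (1 - a) * (measure M (space M) / t0 + \<Gamma> * (a / (1 - a))))"
proof -
  interpret pair_sigma_finite M lborel ..
  define s0 where "s0 = t0 powr (- a)"
  have s0: "0 < s0" unfolding s0_def using t0 by simp
  define \<mu> where "\<mu> s = emeasure M {x\<in>space M. s < g x powr a}" for s
  have "(\<integral>\<^sup>+x. ennreal (g x powr a) \<partial>M) = (\<integral>\<^sup>+x. (\<integral>\<^sup>+s. indicator {0<..<g x powr a} s \<partial>lborel) \<partial>M)"
    by (intro nn_integral_cong) simp
  also have "\<dots> = (\<integral>\<^sup>+x. (\<integral>\<^sup>+s. (if 0 < s \<and> s < g x powr a then 1 else 0) \<partial>lborel) \<partial>M)"
    by (intro nn_integral_cong) (auto simp: indicator_def)
  also have "\<dots> = (\<integral>\<^sup>+s. (\<integral>\<^sup>+x. (if 0 < s \<and> s < g x powr a then 1 else 0) \<partial>M) \<partial>lborel)"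
    by (rule Fubini'[symmetric]) measurable
  also have "\<dots> \<le> (\<integral>\<^sup>+s. emeasure M (space M) * indicator {0..s0} s + ennreal (\<Gamma> * s powr (- (1 / a))) * indicator {s0..} s \<partial>lborel)"
  proof (rule nn_integral_mono)
    fix s :: real
    show "(\<integral>\<^sup>+x. (if 0 < s \<and> s < g x powr a then 1 else 0) \<partial>M) \<le>
      emeasure M (space M) * indicator {0..s0} s + ennreal (\<Gamma> * s powr (- (1 / a))) * indicator {s0..} s"
    proof (cases "0 < s")
      case False
      then show ?thesis by simp
    next
      case True
      have "(\<integral>\<^sup>+x. (if 0 < s \<and> s < g x powr a then 1 else 0) \<partial>M) = (\<integral>\<^sup>+x. indicator {x\<in>space M. s < g x powr a} x \<partial>M)"
        using True by (intro nn_integral_cong) (auto simp: indicator_def)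
      also have "\<dots> = \<mu> s" unfolding \<mu>_def by (rule nn_integral_indicator) measurable
      finally have eq: "(\<integral>\<^sup>+x. (if 0 < s \<and> s < g x powr a then 1 else 0) \<partial>M) = \<mu> s" .
      show ?thesis
      proof (cases "s \<le> s0")
        case le: True
        have "\<mu> s \<le> emeasure M (space M)" unfolding \<mu>_def by (rule emeasure_space)
        then show ?thesis unfolding eq using True le by (simp add: add_increasing2)
      next
        case gt: False
        define t where "t = s powr (- (1 / a))"
        have t: "0 < t" unfolding t_def using True by simp
        have "t \<le> s0 powr (- (1 / a))"
          unfolding t_def using gt s0 a by (intro powr_mono2') auto
        also have "\<dots> = t0" unfolding s0_def using t0 a by (simp add: powr_powr)
        finally have "t \<le> t0" .
        have "{x\<in>space M. s < g x powr a} \<subseteq> {x\<in>space M. 1 / t < g x}"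
        proof (intro Collect_mono impI, elim conjE, intro conjI)
          fix x assume x: "s < g x powr a"
          have "s powr (1 / a) < (g x powr a) powr (1 / a)"
            using x True a by (intro powr_less_mono2) auto
          also have "\<dots> = g x" using a nn[of x] by (simp add: powr_powr)
          finally show "1 / t < g x" unfolding t_def by (simp add: powr_minus divide_inverse)
        qed
        then have "\<mu> s \<le> emeasure M {x\<in>space M. 1 / t < g x}"
          unfolding \<mu>_def by (rule emeasure_mono) measurable
        also have "\<dots> \<le> ennreal (\<Gamma> * t)" by (rule weak[OF t \<open>t \<le> t0\<close>])
        finally show ?thesis unfolding eq using gt by (simp add: t_def)
      qed
    qed
  qed
  also have "\<dots> = emeasure M (space M) * ennreal s0 + (\<integral>\<^sup>+s. ennreal (\<Gamma> * s powr (- (1 / a))) * indicator {s0..} s \<partial>lborel)"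
    using s0 by (subst nn_integral_add) (auto simp: nn_integral_cmult_indicator)
  also have "(\<integral>\<^sup>+s. ennreal (\<Gamma> * s powr (- (1 / a))) * indicator {s0..} s \<partial>lborel) =
      ennreal (0 - (- \<Gamma> * (a / (1 - a)) * s0 powr (1 - 1 / a)))"
  proof (rule nn_integral_FTC_atLeast[where F = "\<lambda>s. - \<Gamma> * (a / (1 - a)) * s powr (1 - 1 / a)"])
    fix s assume "s0 \<le> s"
    then have s: "0 < s" using s0 by simp
    have "((\<lambda>s. - \<Gamma> * (a / (1 - a)) * s powr (1 - 1 / a)) has_real_derivative
        - \<Gamma> * (a / (1 - a)) * ((1 - 1 / a) * s powr (1 - 1 / a - 1))) (at s)"
      by (intro DERIV_cmult has_real_derivative_powr s)
    moreover have "- \<Gamma> * (a / (1 - a)) * ((1 - 1 / a) * s powr (1 - 1 / a - 1)) = \<Gamma> * s powr (- (1 / a))"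
      using a by (simp add: field_simps)
    ultimately show "((\<lambda>s. - \<Gamma> * (a / (1 - a)) * s powr (1 - 1 / a)) has_real_derivative \<Gamma> * s powr (- (1 / a))) (at s)"
      by simp
    show "0 \<le> \<Gamma> * s powr (- (1 / a))" using \<Gamma> by simp
  next
    have "((\<lambda>s::real. s powr (1 - 1 / a)) \<longlongrightarrow> 0) at_top"
      by (rule tendsto_neg_powr) (use a in \<open>auto simp: field_simps filterlim_ident\<close>)
    then show "((\<lambda>s. - \<Gamma> * (a / (1 - a)) * s powr (1 - 1 / a)) \<longlongrightarrow> 0) at_top"
      by (rule tendsto_mult_right_zero)
  qed simp
  also have "0 - (- \<Gamma> * (a / (1 - a)) * s0 powr (1 - 1 / a)) = \<Gamma> * (a / (1 - a)) * t0 powr (1 - a)"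
  proof -
    have "s0 powr (1 - 1 / a) = t0 powr (1 - a)"
    proof -
      have "- a * (1 - 1 / a) = 1 - a" using a by (simp add: right_diff_distrib)
      then show ?thesis unfolding s0_def powr_powr by simp
    qed
    then show ?thesis by simp
  qed
  also have "emeasure M (space M) * ennreal s0 + ennreal (\<Gamma> * (a / (1 - a)) * t0 powr (1 - a)) =
      ennreal (measure M (space M) * s0 + \<Gamma> * (a / (1 - a)) * t0 powr (1 - a))"
    using s0 a \<Gamma> by (simp add: emeasure_eq_measure ennreal_mult[symmetric] ennreal_plus[symmetric] del: ennreal_plus)
  also have "measure M (space M) * s0 + \<Gamma> * (a / (1 - a)) * t0 powr (1 - a) =
      t0 powr (1 - a) * (measure M (space M) / t0 + \<Gamma> * (a / (1 - a)))"
  proof -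
    have "s0 = t0 powr (1 - a) / t0"
      unfolding s0_def using t0 by (simp add: powr_diff powr_minus divide_inverse)
    then show ?thesis by (simp add: algebra_simps)
  qed
  finally show ?thesis .
qed

text \<open>The interface to the geometry. The weak L^1 bound on \<open>h x\<close> is asked for
  \<open>t \<le> t0\<close>, that is, at large values of \<open>h\<close>, because volume bounds
  come with a limit on the radius; the finite total measure takes care of the rest. Quasi-symmetry
  exchanges the two variables after Tonelli's theorem.\<close>

locale weak_type_kernel = finite_measure M for M :: "'a measure" +
  fixes h :: "'a \<Rightarrow> 'a \<Rightarrow> real" and \<Gamma> \<Gamma>' t0 :: real
  assumes h_measurable: "(\<lambda>(x, y). h x y) \<in> borel_measurable (M \<Otimes>\<^sub>M M)"
    and h_nonneg: "\<And>x y. 0 \<le> h x y"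
    and t0: "0 < t0" and \<Gamma>: "0 < \<Gamma>" and \<Gamma>': "1 \<le> \<Gamma>'"
    and weak_type: "\<And>x t. x \<in> space M \<Longrightarrow> 0 < t \<Longrightarrow> t \<le> t0 \<Longrightarrow>
      emeasure M {y\<in>space M. 1 / t < h x y} \<le> ennreal (\<Gamma> * t)"
    and quasi_symmetric: "\<And>x y. x \<in> space M \<Longrightarrow> y \<in> space M \<Longrightarrow> h x y \<le> \<Gamma>' * h y x"
begin

text \<open>For \<open>a = k / (k + 1)\<close> one has \<open>a / (1 - a) = k\<close>; this is the
  bracket in the bound of \<open>nn_integral_powr_weak_type\<close>, linear in
  \<open>k\<close>.\<close>

definition moment_const :: "nat \<Rightarrow> real" where
  "moment_const k = measure M (space M) / t0 + \<Gamma> * real k"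

lemma moment_const_pos: "1 \<le> k \<Longrightarrow> 0 < moment_const k"
  unfolding moment_const_def using \<Gamma> t0 by (intro add_nonneg_pos) auto

lemma kernel_section_measurable[measurable]:
  assumes "x \<in> space M"
  shows "h x \<in> borel_measurable M"
  using measurable_compose[OF measurable_Pair1'[OF assms] h_measurable] by (simp add: o_def)

lemma kernel_power_integral:
  assumes k: "1 \<le> k" and x: "x \<in> space M"
  shows "(\<integral>\<^sup>+y. ennreal (h x y powr (real k / real (k + 1))) \<partial>M) \<le>
    ennreal (t0 powr (1 / real (k + 1)) * moment_const k)"
proof -
  let ?a = "real k / real (k + 1)"
  have "1 - ?a = 1 / real (k + 1)" "?a / (1 - ?a) = real k" by (simp_all add: field_simps)
  moreover have "0 < ?a" "?a < 1" using k by (simp_all add: field_simps)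
  ultimately show ?thesis
    using nn_integral_powr_weak_type[OF kernel_section_measurable[OF x] h_nonneg t0 _ _ _ weak_type[OF x], of ?a] \<Gamma>
    unfolding moment_const_def by simp
qed

text \<open>With \<open>q = k p / (p - 1)\<close> and \<open>a = k / (k + 1)\<close> the integrand
  is the product of \<open>(h powr a * F powr p) powr (1 / q)\<close>,
  \<open>(h powr a) powr ((p - 1) / p)\<close> and \<open>(F powr p) powr (1 / p - 1 / q)\<close>;
  the powers of \<open>h\<close> match because \<open>a * (1 / k + 1) = 1\<close>. The last exponent
  is nonnegative since \<open>p - 1 \<le> k\<close> gives \<open>p \<le> q\<close>. The power
  \<open>q\<close> makes the first integral linear, so the order of integration can be
  exchanged.\<close>

lemma moment_bound:
  fixes f F :: "'a \<Rightarrow> real"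
  assumes p: "1 < p" and k: "1 \<le> k" "p - 1 \<le> real k" and B: "0 < B" and \<Phi>: "0 < \<Phi>"
    and F[measurable]: "F \<in> borel_measurable M" and F_nn: "\<And>x. 0 \<le> F x"
    and F_int: "(\<integral>\<^sup>+x. ennreal (F x powr p) \<partial>M) \<le> ennreal (\<Phi> powr p)"
    and f: "\<And>x. x \<in> space M \<Longrightarrow>
      ennreal \<bar>f x\<bar> \<le> ennreal B * (\<integral>\<^sup>+y. ennreal (h x y powr ((p - 1) / p) * F y) \<partial>M)"
  shows "(\<integral>\<^sup>+x. ennreal (\<bar>f x\<bar> powr (real k * (p / (p - 1)))) \<partial>M) \<le>
    ennreal ((B * \<Phi>) powr (real k * (p / (p - 1))) * \<Gamma>' * t0 * moment_const k ^ (k + 1))"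
proof -
  define q where "q = real k * (p / (p - 1))"
  define a where "a = real k / real (k + 1)"
  define S where "S = t0 powr (1 / real (k + 1)) * moment_const k"
  have q: "0 < q" "p \<le> q"
  proof -
    show "0 < q" unfolding q_def using p k by simp
    have "(p - 1) * (p / (p - 1)) \<le> q" unfolding q_def using p k by (intro mult_right_mono) auto
    then show "p \<le> q" using p by simp
  qed
  have a: "0 < a" "a < 1" unfolding a_def using k by (auto simp: field_simps)
  have S: "0 < S" unfolding S_def using t0 moment_const_pos[OF k(1)] by simp
  define \<alpha> \<beta> \<gamma> where "\<alpha> = 1 / q" and "\<beta> = (p - 1) / p" and "\<gamma> = 1 / p - 1 / q"
  have e: "0 < \<alpha>" "0 < \<beta>" "0 \<le> \<gamma>" "\<alpha> + \<beta> + \<gamma> = 1"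
    unfolding \<alpha>_def \<beta>_def \<gamma>_def using p q by (auto simp: field_simps)
  have e1: "a * \<alpha> + a * \<beta> = (p - 1) / p"
  proof -
    have "\<alpha> = (p - 1) / p * (1 / real k)" unfolding \<alpha>_def q_def using p k by (simp add: field_simps)
    then have "a * \<alpha> + a * \<beta> = (p - 1) / p * (a * (1 / real k + 1))" unfolding \<beta>_def by (simp only: distrib_left mult_ac)
    also have "a * (1 / real k + 1) = 1"
    proof -
      have "1 / real k + 1 = real (k + 1) / real k" using k(1) by (simp add: add_divide_distrib)
      then show ?thesis unfolding a_def using k(1) by simp
    qed
    finally show ?thesis by simp
  qed
  have e2: "p * \<alpha> + p * \<gamma> = 1" unfolding \<alpha>_def \<gamma>_def using p q by (simp add: field_simps)
  have e3: "\<beta> * q = real k" unfolding \<beta>_def q_def using p by simp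
  define c where "c = B powr q * S ^ k * \<Phi> powr (q - p)"
  have c: "0 < c" unfolding c_def using B S \<Phi> by simp
  define J where "J x = (\<integral>\<^sup>+y. ennreal (h x y powr a * F y powr p) \<partial>M)" for x
  note [measurable] = kernel_section_measurable
  have pointwise: "ennreal (\<bar>f x\<bar> powr q) \<le> ennreal c * J x" if x: "x \<in> space M" for x
  proof (cases "J x")
    case top
    then show ?thesis using c by (simp add: ennreal_mult_top)
  next
    case (real A0)
    \<comment> \<open>The three-factor Hoelder inequality takes positive bounds, and
      \<open>A0\<close> may be 0; any \<open>A > A0\<close> serves, and \<open>A\<close> then
      decreases to \<open>A0\<close>.\<close>
    have "\<bar>f x\<bar> powr q / c \<le> A" if A: "A0 < A" for A
    proof -
      have A_pos: "0 < A" using A real by simp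
      have "(\<integral>\<^sup>+y. ennreal (h x y powr ((p - 1) / p) * F y) \<partial>M) =
          (\<integral>\<^sup>+y. ennreal ((h x y powr a * F y powr p) powr \<alpha> * (h x y powr a) powr \<beta> * (F y powr p) powr \<gamma>) \<partial>M)"
      proof (intro nn_integral_cong arg_cong[where f = ennreal])
        fix y
        have "(h x y powr a * F y powr p) powr \<alpha> * (h x y powr a) powr \<beta> * (F y powr p) powr \<gamma> =
            (h x y powr (a * \<alpha>) * h x y powr (a * \<beta>)) * (F y powr (p * \<alpha>) * F y powr (p * \<gamma>))"
          by (simp add: powr_mult powr_powr mult_ac)
        also have "\<dots> = h x y powr ((p - 1) / p) * F y powr 1"
          unfolding powr_add[symmetric] e1 e2 ..
        finally show "h x y powr ((p - 1) / p) * F y =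
          (h x y powr a * F y powr p) powr \<alpha> * (h x y powr a) powr \<beta> * (F y powr p) powr \<gamma>"
          using F_nn[of y] by simp
      qed
      also have "\<dots> \<le> ennreal (A powr \<alpha> * S powr \<beta> * (\<Phi> powr p) powr \<gamma>)"
      proof (rule nn_integral_holder3)
        show "(\<integral>\<^sup>+y. ennreal (h x y powr a * F y powr p) \<partial>M) \<le> ennreal A"
          using real A unfolding J_def by (simp add: ennreal_leI)
        show "(\<integral>\<^sup>+y. ennreal (h x y powr a) \<partial>M) \<le> ennreal S"
          unfolding S_def a_def by (rule kernel_power_integral[OF k(1) x])
      qed (use F_int e A_pos S \<Phi> x in auto)
      finally have "ennreal \<bar>f x\<bar> \<le> ennreal B * ennreal (A powr \<alpha> * S powr \<beta> * (\<Phi> powr p) powr \<gamma>)"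
        using order_trans[OF f[OF x] mult_left_mono] by simp
      then have "\<bar>f x\<bar> \<le> B * (A powr \<alpha> * S powr \<beta> * (\<Phi> powr p) powr \<gamma>)"
        using B by (simp add: ennreal_mult[symmetric] ennreal_le_iff)
      then have "\<bar>f x\<bar> powr q \<le> (B * (A powr \<alpha> * S powr \<beta> * (\<Phi> powr p) powr \<gamma>)) powr q"
        using q by (intro powr_mono2) auto
      also have "\<dots> = B powr q * (A powr (\<alpha> * q) * S powr (\<beta> * q) * \<Phi> powr (p * \<gamma> * q))"
        using B A_pos S \<Phi> by (simp add: powr_mult powr_powr)
      also have "\<dots> = c * A"
      proof -
        have "\<alpha> * q = 1" "p * \<gamma> * q = q - p" unfolding \<alpha>_def \<gamma>_def using q p by (auto simp: field_simps)
        then show ?thesis unfolding c_def e3 using A_pos S by (simp add: powr_realpow)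
      qed
      finally show ?thesis using c by (simp add: field_simps)
    qed
    then have "\<bar>f x\<bar> powr q / c \<le> A0" by (rule dense_ge)
    then have "\<bar>f x\<bar> powr q \<le> c * A0" using c by (simp add: field_simps)
    then show ?thesis using real c by (simp add: ennreal_mult[symmetric] ennreal_leI)
  qed
  have meas: "(\<lambda>(x, y). ennreal (h x y powr a * F y powr p)) \<in> borel_measurable (M \<Otimes>\<^sub>M M)"
  proof -
    have "(\<lambda>z. ennreal (h (fst z) (snd z) powr a * F (snd z) powr p)) \<in> borel_measurable (M \<Otimes>\<^sub>M M)"
      using h_measurable by (simp add: case_prod_beta)
    then show ?thesis by (simp add: case_prod_beta)
  qed
  have J_meas: "J \<in> borel_measurable M"
    using borel_measurable_nn_integral_fst[OF meas] by (simp add: J_def[abs_def])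
  interpret pair_sigma_finite M M ..
  have "(\<integral>\<^sup>+x. ennreal (\<bar>f x\<bar> powr q) \<partial>M) \<le> (\<integral>\<^sup>+x. ennreal c * J x \<partial>M)"
    by (intro nn_integral_mono pointwise)
  also have "\<dots> = ennreal c * (\<integral>\<^sup>+x. J x \<partial>M)"
    by (rule nn_integral_cmult[OF J_meas])
  also have "(\<integral>\<^sup>+x. J x \<partial>M) = (\<integral>\<^sup>+y. (\<integral>\<^sup>+x. ennreal (h x y powr a * F y powr p) \<partial>M) \<partial>M)"
    unfolding J_def by (rule Fubini'[symmetric, OF meas])
  also have "\<dots> \<le> (\<integral>\<^sup>+y. ennreal (\<Gamma>' * S) * ennreal (F y powr p) \<partial>M)"
  proof (rule nn_integral_mono)
    \<comment> \<open>Tonelli's theorem leaves an integral in the first variable of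
      \<open>h\<close>, while the weak type bound concerns the second; quasi-symmetry exchanges them
      at the cost of \<open>\<Gamma>'\<close>.\<close>
    fix y assume y: "y \<in> space M"
    have "(\<integral>\<^sup>+x. ennreal (h x y powr a * F y powr p) \<partial>M) \<le>
        (\<integral>\<^sup>+x. ennreal (\<Gamma>' * F y powr p) * ennreal (h y x powr a) \<partial>M)"
    proof (rule nn_integral_mono)
      fix x assume x: "x \<in> space M"
      have "h x y powr a \<le> (\<Gamma>' * h y x) powr a"
        using quasi_symmetric[OF x y] h_nonneg a by (intro powr_mono2) auto
      also have "\<dots> = \<Gamma>' powr a * h y x powr a" using \<Gamma>' h_nonneg by (simp add: powr_mult)
      also have "\<dots> \<le> \<Gamma>' * h y x powr a"
        using powr_mono[of a 1 \<Gamma>'] \<Gamma>' a by (intro mult_right_mono) auto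
      finally have "h x y powr a * F y powr p \<le> \<Gamma>' * h y x powr a * F y powr p" by (intro mult_right_mono) auto
      then show "ennreal (h x y powr a * F y powr p) \<le> ennreal (\<Gamma>' * F y powr p) * ennreal (h y x powr a)"
        using \<Gamma>' by (simp add: ennreal_mult[symmetric] ennreal_leI mult_ac)
    qed
    also have "\<dots> = ennreal (\<Gamma>' * F y powr p) * (\<integral>\<^sup>+x. ennreal (h y x powr a) \<partial>M)"
      using y by (intro nn_integral_cmult) measurable
    also have "\<dots> \<le> ennreal (\<Gamma>' * F y powr p) * ennreal S"
      unfolding S_def a_def by (intro mult_left_mono kernel_power_integral[OF k(1) y]) simp
    also have "\<dots> = ennreal (\<Gamma>' * S) * ennreal (F y powr p)"
      using \<Gamma>' S by (simp add: ennreal_mult[symmetric] mult_ac)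
    finally show "(\<integral>\<^sup>+x. ennreal (h x y powr a * F y powr p) \<partial>M) \<le> ennreal (\<Gamma>' * S) * ennreal (F y powr p)" .
  qed
  also have "\<dots> = ennreal (\<Gamma>' * S) * (\<integral>\<^sup>+y. ennreal (F y powr p) \<partial>M)"
    by (rule nn_integral_cmult) measurable
  also have "\<dots> \<le> ennreal (\<Gamma>' * S) * ennreal (\<Phi> powr p)" by (intro mult_left_mono F_int) simp
  finally have "(\<integral>\<^sup>+x. ennreal (\<bar>f x\<bar> powr q) \<partial>M) \<le> ennreal c * (ennreal (\<Gamma>' * S) * ennreal (\<Phi> powr p))"
    by (simp add: mult_left_mono)
  also have "\<dots> = ennreal (c * (\<Gamma>' * S * \<Phi> powr p))"
    using c \<Gamma>' S by (simp add: ennreal_mult[symmetric])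
  also have "c * (\<Gamma>' * S * \<Phi> powr p) = (B * \<Phi>) powr q * \<Gamma>' * t0 * moment_const k ^ (k + 1)"
  proof -
    \<comment> \<open>The constant \<open>c\<close> contains \<open>S ^ k\<close>, since
      \<open>\<beta> * q = k\<close>, and the exchanged integral gives one more \<open>S\<close>;
      the roots of \<open>t0\<close> multiply to a single \<open>t0\<close>.\<close>
    have "S ^ (k + 1) = t0 * moment_const k ^ (k + 1)"
    proof -
      have "(t0 powr (1 / real (k + 1))) ^ (k + 1) = t0"
        using t0 by (simp add: powr_realpow[symmetric] powr_powr del: power_Suc of_nat_add of_nat_Suc)
      then show ?thesis unfolding S_def by (simp only: power_mult_distrib)
    qed
    moreover have "\<Phi> powr (q - p) * \<Phi> powr p = \<Phi> powr q" by (simp add: powr_add[symmetric])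
    moreover have "(B * \<Phi>) powr q = B powr q * \<Phi> powr q" using B \<Phi> by (simp add: powr_mult)
    ultimately show ?thesis unfolding c_def by (simp add: mult_ac)
  qed
  finally show ?thesis unfolding q_def .
qed

text \<open>A crude substitute for Stirling's formula: the exponential series dominates each of its
  terms. With \<open>k + b\<close> in place of \<open>x\<close> it is the source of the factor
  \<open>e ^ k\<close>.\<close>

lemma power_le_fact_exp:
  fixes x :: real
  assumes "0 \<le> x"
  shows "x ^ k / fact k \<le> exp x"
proof -
  have "x ^ k / fact k = (\<Sum>n\<in>{k}. x ^ n /\<^sub>R fact n)" by (simp add: divide_inverse mult.commute)
  also have "\<dots> \<le> (\<Sum>n. x ^ n /\<^sub>R fact n)"
    using assms by (intro sum_le_suminf summable_exp_generic) auto
  finally show ?thesis by (simp add: exp_def)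
qed

text \<open>In the expansion of the exponential, term \<open>k\<close> for large \<open>k\<close> is
  at most a constant times \<open>(k + b) * (x * e) ^ k\<close>, where \<open>x * e < 1\<close> is
  the hypothesis \<open>small\<close>. The sum of these bounds depends on neither \<open>f\<close>
  nor \<open>F\<close>.\<close>

lemma exponential_moment:
  assumes p: "1 < p" and K: "1 \<le> K" "p - 1 \<le> real K" and B: "0 < B" and \<Phi>: "0 < \<Phi>" and \<sigma>: "0 < \<sigma>"
    and small: "\<sigma> * (B * \<Phi>) powr (p / (p - 1)) * \<Gamma> * exp 1 < 1"
  obtains Ct where "0 < Ct" "\<And>f F. f \<in> borel_measurable M \<Longrightarrow> F \<in> borel_measurable M \<Longrightarrow> (\<And>x. 0 \<le> F x) \<Longrightarrow>
    (\<integral>\<^sup>+x. ennreal (F x powr p) \<partial>M) \<le> ennreal (\<Phi> powr p) \<Longrightarrow>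
    (\<And>x. x \<in> space M \<Longrightarrow>
      ennreal \<bar>f x\<bar> \<le> ennreal B * (\<integral>\<^sup>+y. ennreal (h x y powr ((p - 1) / p) * F y) \<partial>M)) \<Longrightarrow>
    (\<integral>\<^sup>+x. ennreal (exp (\<sigma> * \<bar>f x\<bar> powr (p / (p - 1)))) \<partial>M) \<le> ennreal Ct"
proof -
  define p' where "p' = p / (p - 1)"
  define m where "m = measure M (space M)"
  define b where "b = m / (t0 * \<Gamma>)"
  define J where "J k = (B * \<Phi>) powr (real k * p') * \<Gamma>' * t0 * moment_const k ^ (k + 1)" for k
  define x where "x = \<sigma> * (B * \<Phi>) powr p' * \<Gamma>"
  \<comment> \<open>For \<open>k < K\<close> the moment bound may fail to apply, as \<open>k\<close>
    can lie below \<open>p - 1\<close>; there \<open>T ^ k \<le> 1 + T ^ K\<close> reduces the term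
    to the moment of order \<open>K\<close>.\<close>
  define c where "c k = (if k < K then \<sigma> ^ k / fact k * (m + J K) else \<sigma> ^ k / fact k * J k)" for k
  have b: "0 \<le> b" unfolding b_def m_def using t0 \<Gamma> by simp
  have x: "0 < x" "x * exp 1 < 1" unfolding x_def p'_def using small \<sigma> B \<Phi> \<Gamma> by simp_all
  have mc: "moment_const k = \<Gamma> * (real k + b)" for k
    unfolding moment_const_def b_def m_def using \<Gamma> t0 by (simp add: field_simps)
  have J_nn: "0 \<le> J k" for k
    unfolding J_def mc using t0 \<Gamma> \<Gamma>' b by (intro mult_nonneg_nonneg zero_le_power) auto
  have c_nn: "0 \<le> c k" for k unfolding c_def using J_nn \<sigma> by (simp add: m_def)
  have J_bound: "\<sigma> ^ k / fact k * J k \<le> (\<Gamma>' * t0 * \<Gamma> * exp b) * ((real k + b) * (x * exp 1) ^ k)" for k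
  proof -
    have "\<sigma> ^ k / fact k * J k = (\<Gamma>' * t0 * \<Gamma>) * (x ^ k * (real k + b)) * ((real k + b) ^ k / fact k)"
    proof -
      have "(B * \<Phi>) powr (real k * p') = ((B * \<Phi>) powr p') ^ k"
        using B \<Phi> by (simp add: powr_realpow[symmetric] powr_powr mult.commute)
      then show ?thesis unfolding J_def mc x_def by (simp add: power_mult_distrib)
    qed
    also have "\<dots> \<le> (\<Gamma>' * t0 * \<Gamma>) * (x ^ k * (real k + b)) * exp (real k + b)"
      using \<Gamma> \<Gamma>' t0 x b by (intro mult_left_mono power_le_fact_exp) auto
    also have "\<dots> = (\<Gamma>' * t0 * \<Gamma> * exp b) * ((real k + b) * (x * exp 1) ^ k)"
      by (simp add: exp_add power_mult_distrib exp_of_nat_mult[symmetric])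
    finally show ?thesis .
  qed
  have norm_x: "norm (x * exp 1) < 1" using x by (simp add: abs_mult)
  have "summable (\<lambda>k. real k * (x * exp 1) ^ k + b * (x * exp 1) ^ k)"
  proof (intro summable_add summable_mult summable_geometric norm_x)
    have "summable (\<lambda>k. real (Suc k) * (x * exp 1) ^ k)"
    proof (rule sums_summable)
      show "(\<lambda>k. real (Suc k) * (x * exp 1) ^ k) sums (1 / (1 - x * exp 1)\<^sup>2)"
        using geometric_deriv_sums[OF norm_x] by simp
    qed
    then have "summable (\<lambda>k. real (Suc k) * (x * exp 1) ^ k - (x * exp 1) ^ k)"
      by (intro summable_diff summable_geometric norm_x)
    then show "summable (\<lambda>k. real k * (x * exp 1) ^ k)" by (simp add: algebra_simps)
  qed
  then have "summable (\<lambda>k. (\<Gamma>' * t0 * \<Gamma> * exp b) * ((real k + b) * (x * exp 1) ^ k))"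
    by (intro summable_mult) (simp add: algebra_simps)
  then have sum_c: "summable c"
  proof (rule summable_comparison_test'[where N = K])
    show "norm (c k) \<le> (\<Gamma>' * t0 * \<Gamma> * exp b) * ((real k + b) * (x * exp 1) ^ k)" if "K \<le> k" for k
      using J_bound[of k] c_nn[of k] that by (simp add: c_def)
  qed
  show ?thesis
  proof (rule that[of "suminf c + 1"])
    show "0 < suminf c + 1" using suminf_nonneg[OF sum_c c_nn] by simp
    fix f F :: "'a \<Rightarrow> real"
    assume f[measurable]: "f \<in> borel_measurable M" and F: "F \<in> borel_measurable M" "\<And>x. 0 \<le> F x"
      "(\<integral>\<^sup>+x. ennreal (F x powr p) \<partial>M) \<le> ennreal (\<Phi> powr p)"
      and rep: "\<And>x. x \<in> space M \<Longrightarrow>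
        ennreal \<bar>f x\<bar> \<le> ennreal B * (\<integral>\<^sup>+y. ennreal (h x y powr ((p - 1) / p) * F y) \<partial>M)"
    define T where "T x = \<bar>f x\<bar> powr p'" for x
    have T_nn: "0 \<le> T x" for x unfolding T_def by simp
    have [measurable]: "T \<in> borel_measurable M" unfolding T_def by measurable
    have T_moment: "(\<integral>\<^sup>+x. ennreal (T x ^ k) \<partial>M) \<le> ennreal (J k)" if k: "1 \<le> k" "p - 1 \<le> real k" for k
    proof -
      have "(\<integral>\<^sup>+x. ennreal (T x ^ k) \<partial>M) = (\<integral>\<^sup>+x. ennreal (\<bar>f x\<bar> powr (real k * p')) \<partial>M)"
      proof (intro nn_integral_cong arg_cong[where f = ennreal])
        fix x show "T x ^ k = \<bar>f x\<bar> powr (real k * p')"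
          unfolding T_def using k(1) by (cases "f x = 0") (simp_all add: powr_realpow[symmetric] powr_powr mult.commute)
      qed
      then show ?thesis
        using moment_bound[OF p k B \<Phi> F rep] unfolding J_def p'_def by simp
    qed
    have term_le: "(\<integral>\<^sup>+x. ennreal (\<sigma> ^ k / fact k * T x ^ k) \<partial>M) \<le> ennreal (c k)" for k
    proof -
      have "(\<integral>\<^sup>+x. ennreal (\<sigma> ^ k / fact k * T x ^ k) \<partial>M) = ennreal (\<sigma> ^ k / fact k) * (\<integral>\<^sup>+x. ennreal (T x ^ k) \<partial>M)"
        using \<sigma> T_nn by (subst nn_integral_cmult[symmetric]) (auto simp flip: ennreal_mult)
      also have "\<dots> \<le> ennreal (\<sigma> ^ k / fact k) * ennreal (if k < K then m + J K else J k)"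
      proof (intro mult_left_mono)
        show "(\<integral>\<^sup>+x. ennreal (T x ^ k) \<partial>M) \<le> ennreal (if k < K then m + J K else J k)"
        proof (cases "k < K")
          case True
          have "T x ^ k \<le> 1 + T x ^ K" for x
          proof (cases "T x \<le> 1")
            case True
            then show ?thesis using power_le_one[OF T_nn True, of k] T_nn[of x] by (simp add: add_increasing2)
          next
            case False
            then have "T x ^ k \<le> T x ^ K" using \<open>k < K\<close> by (intro power_increasing) auto
            then show ?thesis by simp
          qed
          then have "(\<integral>\<^sup>+x. ennreal (T x ^ k) \<partial>M) \<le> (\<integral>\<^sup>+x. 1 + ennreal (T x ^ K) \<partial>M)"
            using T_nn by (intro nn_integral_mono) (simp add: ennreal_plus[symmetric] ennreal_leI del: ennreal_plus flip: ennreal_1)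
          also have "\<dots> = ennreal m + (\<integral>\<^sup>+x. ennreal (T x ^ K) \<partial>M)"
            by (subst nn_integral_add) (auto simp: emeasure_eq_measure m_def)
          also have "\<dots> \<le> ennreal m + ennreal (J K)" by (intro add_left_mono T_moment K)
          also have "\<dots> = ennreal (m + J K)" using J_nn[of K] by (simp add: m_def)
          finally show ?thesis using True by simp
        next
          case False
          then show ?thesis using T_moment[of k] K by simp
        qed
      qed simp
      also have "\<dots> = ennreal (c k)"
        using \<sigma> J_nn by (auto simp: c_def m_def ennreal_mult[symmetric])
      finally show ?thesis .
    qed
    have "(\<integral>\<^sup>+x. ennreal (exp (\<sigma> * \<bar>f x\<bar> powr (p / (p - 1)))) \<partial>M) =
        (\<integral>\<^sup>+x. (\<Sum>k. ennreal (\<sigma> ^ k / fact k * T x ^ k)) \<partial>M)"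
    proof (rule nn_integral_cong)
      fix x
      have s: "(\<lambda>k. \<sigma> ^ k / fact k * T x ^ k) sums exp (\<sigma> * T x)"
        using exp_converges[of "\<sigma> * T x"] by (simp add: power_mult_distrib divide_inverse mult_ac)
      have "(\<Sum>k. ennreal (\<sigma> ^ k / fact k * T x ^ k)) = ennreal (\<Sum>k. \<sigma> ^ k / fact k * T x ^ k)"
        using s T_nn \<sigma> by (intro suminf_ennreal2) (auto intro: sums_summable)
      then show "ennreal (exp (\<sigma> * \<bar>f x\<bar> powr (p / (p - 1)))) = (\<Sum>k. ennreal (\<sigma> ^ k / fact k * T x ^ k))"
        using sums_unique[OF s] by (simp add: T_def p'_def)
    qed
    also have "\<dots> = (\<Sum>k. \<integral>\<^sup>+x. ennreal (\<sigma> ^ k / fact k * T x ^ k) \<partial>M)"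
      by (rule nn_integral_suminf) measurable
    also have "\<dots> \<le> (\<Sum>k. ennreal (c k))" by (intro suminf_le term_le) auto
    also have "\<dots> = ennreal (suminf c)" by (rule suminf_ennreal2[OF c_nn sum_c])
    also have "\<dots> \<le> ennreal (suminf c + 1)" by (intro ennreal_leI) simp
    finally show "(\<integral>\<^sup>+x. ennreal (exp (\<sigma> * \<bar>f x\<bar> powr (p / (p - 1)))) \<partial>M) \<le> ennreal (suminf c + 1)" .
  qed
qed

end

section \<open>The first eigenvalue\<close>

lemma commutator_span_mono: "i \<le> j \<Longrightarrow> commutator_span X i x \<subseteq> commutator_span X j x"
  unfolding commutator_span_def words_def by (intro span_mono image_mono) auto

lemma telescope_mono_nat:
  fixes d :: "nat \<Rightarrow> nat"
  assumes "mono d"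
  shows "(\<Sum>j=1..s. d j - d (j - 1)) = d s - d 0"
proof (induction s)
  case (Suc s)
  then show ?case using monoD[OF assms, of s "Suc s"] monoD[OF assms, of 0 s] by simp
qed simp

text \<open>Weights \<open>j \<ge> 1\<close> on a telescoping sum give the lower bound. The upper
  bound, uniform in \<open>x\<close> for a common \<open>s\<close>, makes the set of values on
  \<open>closure \<Omega>\<close> finite, so that \<open>Max\<close> in the Metivier index is
  meaningful.\<close>

lemma pointwise_homogeneous_dim_bounds:
  fixes X :: "'m \<Rightarrow> real^'n \<Rightarrow> real^'n"
  assumes s: "commutator_span X s x = UNIV"
  shows "CARD('n) \<le> pointwise_homogeneous_dim X x" "pointwise_homogeneous_dim X x \<le> (\<Sum>j=1..s. j * CARD('n))"
proof -
  define d where "d j = dim (commutator_span X j x)" for j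
  define t where "t = pointwise_step X x"
  have mono: "mono d" unfolding d_def by (intro monoI dim_subset commutator_span_mono)
  have dt: "commutator_span X t x = UNIV" unfolding t_def pointwise_step_def using s by (rule LeastI)
  have ts: "t \<le> s" unfolding t_def pointwise_step_def using s by (rule Least_le)
  have "words 0 = ({} :: 'm list set)" by (auto simp: words_def)
  then have "d 0 = 0" unfolding d_def commutator_span_def by simp
  moreover have "d t = CARD('n)" unfolding d_def dt by (simp add: dim_UNIV)
  ultimately have "CARD('n) = (\<Sum>j=1..t. d j - d (j - 1))" using telescope_mono_nat[OF mono, of t] by simp
  also have "\<dots> \<le> (\<Sum>j=1..t. j * (d j - d (j - 1)))" by (intro sum_mono) auto
  finally show "CARD('n) \<le> pointwise_homogeneous_dim X x"
    unfolding pointwise_homogeneous_dim_def d_def t_def .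
  have dn: "d j \<le> CARD('n)" for j unfolding d_def using dim_subset_UNIV_cart by auto
  have "(\<Sum>j=1..t. j * (d j - d (j - 1))) \<le> (\<Sum>j=1..t. j * CARD('n))"
    by (intro sum_mono mult_left_mono) (auto intro: order_trans[OF diff_le_self dn])
  also have "\<dots> \<le> (\<Sum>j=1..s. j * CARD('n))" using ts by (intro sum_mono2) auto
  finally show "pointwise_homogeneous_dim X x \<le> (\<Sum>j=1..s. j * CARD('n))"
    unfolding pointwise_homogeneous_dim_def d_def t_def .
qed

text \<open>The factor of \<open>a powr p\<close> can be brought as close to 1 as desired at the
  cost of the other one; this keeps the energy of an approximation of \<open>u\<close> below 2. The
  choice \<open>\<delta> = 1\<close> gives the usual factor \<open>2 powr p\<close>.\<close>

lemma powr_add_le: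
  fixes a b p \<delta> :: real
  assumes "0 \<le> a" "0 \<le> b" "0 < \<delta>" "0 < p"
  shows "(a + b) powr p \<le> (1 + \<delta>) powr p * a powr p + (1 + 1 / \<delta>) powr p * b powr p"
proof (cases "b \<le> \<delta> * a")
  case True
  then have "(a + b) powr p \<le> ((1 + \<delta>) * a) powr p"
    using assms by (intro powr_mono2) (auto simp: algebra_simps)
  also have "\<dots> = (1 + \<delta>) powr p * a powr p" using assms by (simp add: powr_mult)
  finally show ?thesis using assms by (simp add: add_increasing2)
next
  case False
  then have "a \<le> b / \<delta>" using assms by (simp add: field_simps)
  then have "(a + b) powr p \<le> ((1 + 1 / \<delta>) * b) powr p"
    using assms by (intro powr_mono2) (auto simp: algebra_simps)
  also have "\<dots> = (1 + 1 / \<delta>) powr p * b powr p" using assms by (simp add: powr_mult)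
  finally show ?thesis using assms by (simp add: add_increasing)
qed

lemma powr_le_two_powr_sum:
  fixes a b x p :: real
  assumes "0 \<le> a" "0 \<le> b" "0 \<le> x" "x \<le> a + b" "0 < p"
  shows "x powr p \<le> 2 powr p * (a powr p + b powr p)"
proof -
  have "x powr p \<le> (a + b) powr p" using assms by (intro powr_mono2) auto
  also have "\<dots> \<le> 2 powr p * a powr p + 2 powr p * b powr p"
    using powr_add_le[OF assms(1,2) zero_less_one assms(5)] by simp
  finally show ?thesis by (simp add: distrib_left)
qed

lemma powr_real_nat: "0 \<le> a \<Longrightarrow> 0 < n \<Longrightarrow> a powr real n = a ^ n"
  by (cases "a = 0") (auto simp: powr_realpow)

lemma norm_powr_le_sum:
  fixes v :: "real^'m"
  assumes "0 < p"
  shows "norm v powr p \<le> real CARD('m) powr p * (\<Sum>j\<in>UNIV. \<bar>v $ j\<bar> powr p)"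
proof -
  obtain j where j: "\<And>i. \<bar>v $ i\<bar> \<le> \<bar>v $ j\<bar>"
  proof -
    have "Max (range (\<lambda>i. \<bar>v $ i\<bar>)) \<in> range (\<lambda>i. \<bar>v $ i\<bar>)" by (intro Max_in) auto
    then obtain j where "Max (range (\<lambda>i. \<bar>v $ i\<bar>)) = \<bar>v $ j\<bar>" by (rule rangeE)
    then show ?thesis using that[of j] Max_ge[of "range (\<lambda>i. \<bar>v $ i\<bar>)"] by auto
  qed
  have "norm v \<le> (\<Sum>i\<in>UNIV. \<bar>v $ i\<bar>)" by (rule norm_le_l1_cart)
  also have "\<dots> \<le> real CARD('m) * \<bar>v $ j\<bar>" using sum_bounded_above[of UNIV "\<lambda>i. \<bar>v $ i\<bar>"] j by auto
  finally have "norm v powr p \<le> (real CARD('m) * \<bar>v $ j\<bar>) powr p" using assms by (intro powr_mono2) auto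
  also have "\<dots> = real CARD('m) powr p * \<bar>v $ j\<bar> powr p" by (simp add: powr_mult)
  also have "\<dots> \<le> real CARD('m) powr p * (\<Sum>j\<in>UNIV. \<bar>v $ j\<bar> powr p)"
    by (intro mult_left_mono member_le_sum) auto
  finally show ?thesis .
qed

lemma integrable_lebesgue_on_mono:
  fixes g :: "'a::euclidean_space \<Rightarrow> real"
  assumes g: "integrable (lebesgue_on T) g" and S: "S \<in> sets lebesgue" "T \<in> sets lebesgue" "S \<subseteq> T"
  shows "integrable (lebesgue_on S) g"
    and "(\<And>x. 0 \<le> g x) \<Longrightarrow> integral\<^sup>L (lebesgue_on S) g \<le> integral\<^sup>L (lebesgue_on T) g"
    and "(\<And>x. x \<in> T - S \<Longrightarrow> g x = 0) \<Longrightarrow> integral\<^sup>L (lebesgue_on S) g = integral\<^sup>L (lebesgue_on T) g"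
proof -
  have gT: "integrable lebesgue (\<lambda>x. if x \<in> T then g x else 0)"
    using Lebesgue_Measure.integrable_restrict_UNIV[OF S(2)] g by blast
  have eq: "(\<lambda>x. indicator S x *\<^sub>R (if x \<in> T then g x else 0)) = (\<lambda>x. if x \<in> S then g x else 0)"
    using S(3) by (intro ext) (auto simp: indicator_def)
  have gS: "integrable lebesgue (\<lambda>x. if x \<in> S then g x else 0)"
    using integrable_mult_indicator[OF S(1) gT] unfolding eq .
  then show "integrable (lebesgue_on S) g"
    using Lebesgue_Measure.integrable_restrict_UNIV[OF S(1)] by blast
  show "integral\<^sup>L (lebesgue_on S) g \<le> integral\<^sup>L (lebesgue_on T) g" if "\<And>x. 0 \<le> g x"
    unfolding Lebesgue_Measure.integral_restrict_UNIV[OF S(1), symmetric] Lebesgue_Measure.integral_restrict_UNIV[OF S(2), symmetric]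
    using S(3) that by (intro integral_mono gS gT) auto
  show "integral\<^sup>L (lebesgue_on S) g = integral\<^sup>L (lebesgue_on T) g" if "\<And>x. x \<in> T - S \<Longrightarrow> g x = 0"
    unfolding Lebesgue_Measure.integral_restrict_UNIV[OF S(1), symmetric] Lebesgue_Measure.integral_restrict_UNIV[OF S(2), symmetric]
    using S(3) that by (intro Bochner_Integration.integral_cong) auto
qed

lemma AE_lebesgue_on_mono:
  assumes "AE x in lebesgue_on T. P x" "S \<in> sets lebesgue" "T \<in> sets lebesgue" "S \<subseteq> T"
  shows "AE x in lebesgue_on S. P x"
proof -
  have "AE x in lebesgue. x \<in> T \<longrightarrow> P x" using assms(1,3) by (simp add: AE_restrict_space_iff)
  then have "AE x in lebesgue. x \<in> S \<longrightarrow> P x" by eventually_elim (use assms(4) in blast)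
  then show ?thesis using assms(2) by (simp add: AE_restrict_space_iff)
qed

locale sobolev_domain = hormander_domain X U \<Omega>
  for X :: "'m::finite \<Rightarrow> real^'n \<Rightarrow> real^'n" and U \<Omega> +
  fixes p :: real
  assumes dim: "2 \<le> CARD('n)" and \<Omega>_nonempty: "\<Omega> \<noteq> {}" and p: "p = real (metivier_index X \<Omega>)"
begin

lemma metivier_ge_2: "2 \<le> metivier_index X \<Omega>"
proof -
  obtain s where s: "hormander_at_step X U s" using hormander unfolding hormander_condition_def by blast
  then have span: "commutator_span X s x = UNIV" if "x \<in> closure \<Omega>" for x
    using that \<Omega>(3) unfolding hormander_at_step_def by blast
  obtain x where x: "x \<in> closure \<Omega>" using \<Omega>_nonempty closure_subset by blast
  have "finite (pointwise_homogeneous_dim X ` closure \<Omega>)"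
    by (rule finite_subset[of _ "{..\<Sum>j=1..s. j * CARD('n)}"]) (use pointwise_homogeneous_dim_bounds(2)[OF span] in auto)
  then have "pointwise_homogeneous_dim X x \<le> metivier_index X \<Omega>"
    unfolding metivier_index_def using x by (intro Max_ge) auto
  then show ?thesis using pointwise_homogeneous_dim_bounds(1)[OF span[OF x]] dim by linarith
qed

lemma p_ge_2: "2 \<le> p" using metivier_ge_2 unfolding p by simp

lemma p_pos: "0 < p" using p_ge_2 by simp

lemma sets_lebesgue: "U \<in> sets lebesgue" "\<Omega> \<in> sets lebesgue"
  using U \<Omega> by auto

lemma \<Omega>_sub: "\<Omega> \<subseteq> U" using \<Omega>(3) closure_subset by blast

lemma \<Omega>_lmeasurable: "\<Omega> \<in> lmeasurable"
  using \<Omega> by (intro lmeasurable_open) (auto intro: bounded_subset[OF compact_imp_bounded[OF \<Omega>(2)]] closure_subset[THEN subsetD])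

lemma test_function_U: "f \<in> test_functions \<Omega> \<Longrightarrow> f \<in> test_functions U"
  by (rule test_functions_mono[OF _ \<Omega>_sub])

lemma classical_X_eq_0:
  assumes f: "f \<in> test_functions \<Omega>" and x: "x \<notin> \<Omega>"
  shows "classical_X X f x = 0"
proof -
  obtain K where K: "compact K" "K \<subseteq> \<Omega>" "\<And>x. x \<notin> K \<Longrightarrow> f x = 0" using test_functionsE[OF f] by metis
  have "frechet_derivative f (at x) = (\<lambda>_. 0)"
    by (rule frechet_derivative_eq_0_outside[OF compact_imp_closed[OF K(1)] K(3)]) (use K(2) x in auto)
  then show ?thesis by (simp add: classical_X_def vec_eq_iff)
qed

lemma integrable_test:
  assumes f: "f \<in> test_functions \<Omega>"
  shows "integrable (lebesgue_on U) (\<lambda>x. \<bar>f x\<bar> powr p)" "integrable (lebesgue_on U) (\<lambda>x. norm (classical_X X f x) powr p)"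
proof -
  show "integrable (lebesgue_on U) (\<lambda>x. \<bar>f x\<bar> powr p)"
  proof (rule integrable_extend)
    show "continuous_on U (\<lambda>x. \<bar>f x\<bar> powr p)"
      using p_pos by (intro continuous_on_powr' continuous_intros test_continuous[OF f]) auto
    show "\<bar>f x\<bar> powr p = 0" if "x \<notin> closure \<Omega>" for x
      using test_functions_eq_0[OF f] that closure_subset[of \<Omega>] by fastforce
  qed
  show "integrable (lebesgue_on U) (\<lambda>x. norm (classical_X X f x) powr p)"
  proof (rule integrable_extend)
    show "continuous_on U (\<lambda>x. norm (classical_X X f x) powr p)"
      using p_pos by (intro continuous_on_powr' continuous_intros classical_X_test[OF f]) auto
    show "norm (classical_X X f x) powr p = 0" if "x \<notin> closure \<Omega>" for x
      using classical_X_test(2)[OF f that] by simp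
  qed
qed

lemma poincare_test:
  obtains c where "0 < c" "\<And>f. f \<in> test_functions \<Omega> \<Longrightarrow>
    (LINT x|lebesgue_on \<Omega>. \<bar>f x\<bar> powr p) \<le> c * (LINT x|lebesgue_on \<Omega>. norm (classical_X X f x) powr p)"
proof -
  obtain c where c: "0 < c" "\<And>f. f \<in> test_functions \<Omega> \<Longrightarrow>
    (LINT x|lebesgue_on U. \<bar>f x\<bar> ^ metivier_index X \<Omega>) \<le>
    c * (LINT x|lebesgue_on U. norm (classical_X X f x) ^ metivier_index X \<Omega>)"
    using poincare_test_functions[OF metivier_ge_2] by metis
  have pw: "a powr p = a ^ metivier_index X \<Omega>" if "0 \<le> a" for a
    unfolding p using that metivier_ge_2 by (intro powr_real_nat) auto
  show ?thesis
  proof (rule that[OF c(1)])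
    fix f assume f: "f \<in> test_functions \<Omega>"
    have "(LINT x|lebesgue_on \<Omega>. \<bar>f x\<bar> powr p) = (LINT x|lebesgue_on U. \<bar>f x\<bar> powr p)"
      by (rule integrable_lebesgue_on_mono(3)[OF integrable_test(1)[OF f] sets_lebesgue(2,1) \<Omega>_sub])
        (use test_functions_eq_0[OF f] in auto)
    moreover have "(LINT x|lebesgue_on \<Omega>. norm (classical_X X f x) powr p) = (LINT x|lebesgue_on U. norm (classical_X X f x) powr p)"
      by (rule integrable_lebesgue_on_mono(3)[OF integrable_test(2)[OF f] sets_lebesgue(2,1) \<Omega>_sub])
        (use classical_X_eq_0[OF f] in auto)
    ultimately show "(LINT x|lebesgue_on \<Omega>. \<bar>f x\<bar> powr p) \<le> c * (LINT x|lebesgue_on \<Omega>. norm (classical_X X f x) powr p)"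
      using c(2)[OF f] by (simp add: pw)
  qed
qed

section \<open>Sobolev functions as limits of test functions\<close>

lemma weak_X_integrable:
  assumes u: "u \<in> W1p X U p"
  shows "integrable (lebesgue_on U) (\<lambda>x. \<bar>u x\<bar> powr p)"
    "integrable (lebesgue_on U) (\<lambda>x. norm (weak_X X U u x) powr p)"
    "u \<in> borel_measurable (lebesgue_on U)" "weak_X X U u \<in> borel_measurable (lebesgue_on U)"
proof -
  show "integrable (lebesgue_on U) (\<lambda>x. \<bar>u x\<bar> powr p)" "u \<in> borel_measurable (lebesgue_on U)"
    using u unfolding W1p_def in_Lp_def by auto
  have comp: "(\<lambda>x. weak_X X U u x $ j) \<in> borel_measurable (lebesgue_on U)"
    "integrable (lebesgue_on U) (\<lambda>x. \<bar>weak_X X U u x $ j\<bar> powr p)" for j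
    using W1p_weak_X(2)[OF U(1) u, of j] unfolding in_Lp_def by auto
  show m: "weak_X X U u \<in> borel_measurable (lebesgue_on U)"
  proof (subst borel_measurable_euclidean_space, intro ballI)
    fix b :: "real^'m" assume "b \<in> Basis"
    then obtain j where "b = axis j 1" by (auto simp: Basis_vec_def)
    then show "(\<lambda>x. weak_X X U u x \<bullet> b) \<in> borel_measurable (lebesgue_on U)"
      using comp(1)[of j] by (simp add: inner_axis)
  qed
  show "integrable (lebesgue_on U) (\<lambda>x. norm (weak_X X U u x) powr p)"
  proof (rule Bochner_Integration.integrable_bound)
    show "integrable (lebesgue_on U) (\<lambda>x. real CARD('m) powr p * (\<Sum>j\<in>UNIV. \<bar>weak_X X U u x $ j\<bar> powr p))"
      using comp by simp
    show "(\<lambda>x. norm (weak_X X U u x) powr p) \<in> borel_measurable (lebesgue_on U)" using m by measurable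
    show "AE x in lebesgue_on U. norm (norm (weak_X X U u x) powr p) \<le>
        norm (real CARD('m) powr p * (\<Sum>j\<in>UNIV. \<bar>weak_X X U u x $ j\<bar> powr p))"
    proof (intro AE_I2)
      fix x
      have "0 \<le> real CARD('m) powr p * (\<Sum>j\<in>UNIV. \<bar>weak_X X U u x $ j\<bar> powr p)"
        by (intro mult_nonneg_nonneg sum_nonneg) auto
      then show "norm (norm (weak_X X U u x) powr p) \<le>
        norm (real CARD('m) powr p * (\<Sum>j\<in>UNIV. \<bar>weak_X X U u x $ j\<bar> powr p))"
        using norm_powr_le_sum[OF p_pos, of "weak_X X U u x"] by simp
    qed
  qed
qed

lemma W1p_norm_components:
  assumes "W1p_norm X U p v < \<epsilon>"
  shows "(LINT x|lebesgue_on U. \<bar>v x\<bar> powr p) \<le> \<epsilon> powr p"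
    "(LINT x|lebesgue_on U. \<bar>weak_X X U v x $ j\<bar> powr p) \<le> \<epsilon> powr p"
proof -
  have L: "Lp_norm p U g powr p = (LINT x|lebesgue_on U. \<bar>g x\<bar> powr p)" for g :: "real^'n \<Rightarrow> real"
    unfolding Lp_norm_def using p_pos by (simp add: powr_powr)
  define A where "A = (LINT x|lebesgue_on U. \<bar>v x\<bar> powr p)"
  define B where "B j = (LINT x|lebesgue_on U. \<bar>weak_X X U v x $ j\<bar> powr p)" for j
  have nn: "0 \<le> A" "0 \<le> B j" for j unfolding A_def B_def by auto
  have S: "0 \<le> sum B UNIV" using nn(2) by (intro sum_nonneg) auto
  have "(A + sum B UNIV) powr (1 / p) < \<epsilon>" using assms unfolding W1p_norm_def L A_def B_def .
  then have "((A + sum B UNIV) powr (1 / p)) powr p \<le> \<epsilon> powr p" using p_pos by (intro powr_mono2) auto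
  then have le: "A + sum B UNIV \<le> \<epsilon> powr p" using p_pos nn S by (simp add: powr_powr)
  show "(LINT x|lebesgue_on U. \<bar>v x\<bar> powr p) \<le> \<epsilon> powr p" using le S unfolding A_def by simp
  have "B j \<le> sum B UNIV" using nn(2) by (intro member_le_sum) auto
  then show "(LINT x|lebesgue_on U. \<bar>weak_X X U v x $ j\<bar> powr p) \<le> \<epsilon> powr p" using le nn(1) unfolding B_def by simp
qed

text \<open>One sequence serves every later limit argument: a subsequence of norm approximations
  also converges almost everywhere. That convergence is recorded on \<open>U\<close> rather than
  \<open>\<Omega>\<close>, so that the limit is seen to vanish off \<open>\<Omega>\<close>.\<close>

lemma W1p_zero_approx:
  assumes u: "u \<in> W1p_zero X U p \<Omega>"
  obtains f where "\<And>k::nat. f k \<in> test_functions \<Omega>"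
    "(\<lambda>k. LINT x|lebesgue_on \<Omega>. \<bar>u x - f k x\<bar> powr p) \<longlonglongrightarrow> 0"
    "\<And>k. integrable (lebesgue_on \<Omega>) (\<lambda>x. \<bar>u x - f k x\<bar> powr p)"
    "(\<lambda>k. LINT x|lebesgue_on \<Omega>. norm (weak_X X U u x - classical_X X (f k) x) powr p) \<longlonglongrightarrow> 0"
    "\<And>k. integrable (lebesgue_on \<Omega>) (\<lambda>x. norm (weak_X X U u x - classical_X X (f k) x) powr p)"
    "AE x in lebesgue_on U. (\<lambda>k. f k x) \<longlonglongrightarrow> u x"
proof -
  have uW: "u \<in> W1p X U p" and ex: "\<And>\<epsilon>. 0 < \<epsilon> \<Longrightarrow> \<exists>f\<in>test_functions \<Omega>. W1p_norm X U p (\<lambda>x. f x - u x) < \<epsilon>"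
    using u unfolding W1p_zero_def by auto
  have "\<exists>f\<in>test_functions \<Omega>. W1p_norm X U p (\<lambda>x. f x - u x) < 1 / real (Suc k)" for k by (rule ex) simp
  then obtain g where g: "\<And>k. g k \<in> test_functions \<Omega>" "\<And>k. W1p_norm X U p (\<lambda>x. g k x - u x) < 1 / real (Suc k)"
    by metis
  have eps0: "(\<lambda>k. (1 / real (Suc k)) powr p) \<longlonglongrightarrow> 0"
  proof -
    have "(\<lambda>k. 1 / real (Suc k)) \<longlonglongrightarrow> 0" by (rule LIMSEQ_Suc[OF lim_const_over_n])
    from tendsto_powr'[OF this tendsto_const[of p]] p_pos show ?thesis by simp
  qed
  note gU = test_function_U[OF g(1)]
  have gW: "g k \<in> W1p X U p" for k by (rule test_function_in_W1p[OF p_pos U(1) X gU])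
  have g_meas: "g k \<in> borel_measurable (lebesgue_on U)" for k using weak_X_integrable(3)[OF gW] .
  have cX_ae: "AE x in lebesgue_on U. weak_X X U (\<lambda>x. g k x - u x) x = classical_X X (g k) x - weak_X X U u x" for k
  proof -
    have "AE x in lebesgue_on U. weak_X X U (\<lambda>x. g k x - u x) x = weak_X X U (g k) x - weak_X X U u x"
      by (rule weak_X_diff[OF U(1) X]) (use W1p_weak_X(1)[OF U(1) gW] W1p_weak_X(1)[OF U(1) uW] in blast)+
    with weak_X_test_function[OF U(1) X gU[of k]] show ?thesis by eventually_elim simp
  qed
  have cX_meas: "classical_X X (g k) \<in> borel_measurable (lebesgue_on U)" for k
    by (rule continuous_imp_measurable_on_sets_lebesgue[OF classical_X_test(1)[OF g(1)] sets_lebesgue(1)])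
  have wX_meas: "(\<lambda>x. weak_X X U (\<lambda>x. g k x - u x) x $ j) \<in> borel_measurable (lebesgue_on U)" for k j
  proof -
    have "weak_deriv U (X j) (\<lambda>x. g k x - u x) (\<lambda>x. weak_X X U (\<lambda>x. g k x - u x) x $ j)"
      by (rule weak_X_weak_deriv)
        (use weak_deriv_diff[OF U(1) X W1p_weak_X(1)[OF U(1) gW] W1p_weak_X(1)[OF U(1) uW]] in blast)
    from measurable_if_locally_integrable[OF U(1) weak_deriv_integrable(2)[OF this]] show ?thesis .
  qed
  note uI = weak_X_integrable[OF uW]
  have int0: "integrable (lebesgue_on U) (\<lambda>x. \<bar>u x - g k x\<bar> powr p)" for k
  proof (rule Bochner_Integration.integrable_bound)
    show "integrable (lebesgue_on U) (\<lambda>x. 2 powr p * (\<bar>u x\<bar> powr p + \<bar>g k x\<bar> powr p))"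
      using uI(1) integrable_test(1)[OF g(1)] by simp
    show "(\<lambda>x. \<bar>u x - g k x\<bar> powr p) \<in> borel_measurable (lebesgue_on U)" using uI(3) g_meas by measurable
    have "\<bar>u x - g k x\<bar> powr p \<le> 2 powr p * (\<bar>u x\<bar> powr p + \<bar>g k x\<bar> powr p)" for x
      by (rule powr_le_two_powr_sum) (use p_pos in auto)
    then show "AE x in lebesgue_on U. norm (\<bar>u x - g k x\<bar> powr p) \<le> norm (2 powr p * (\<bar>u x\<bar> powr p + \<bar>g k x\<bar> powr p))"
      by (intro AE_I2) simp
  qed
  have int1: "integrable (lebesgue_on U) (\<lambda>x. norm (weak_X X U u x - classical_X X (g k) x) powr p)" for k
  proof (rule Bochner_Integration.integrable_bound)
    show "integrable (lebesgue_on U) (\<lambda>x. 2 powr p * (norm (weak_X X U u x) powr p + norm (classical_X X (g k) x) powr p))"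
      using uI(2) integrable_test(2)[OF g(1)] by simp
    show "(\<lambda>x. norm (weak_X X U u x - classical_X X (g k) x) powr p) \<in> borel_measurable (lebesgue_on U)"
      using uI(4) cX_meas by measurable
    have "norm (weak_X X U u x - classical_X X (g k) x) powr p \<le> 2 powr p * (norm (weak_X X U u x) powr p + norm (classical_X X (g k) x) powr p)" for x
      by (rule powr_le_two_powr_sum) (use p_pos norm_triangle_ineq4 in auto)
    then show "AE x in lebesgue_on U. norm (norm (weak_X X U u x - classical_X X (g k) x) powr p) \<le>
        norm (2 powr p * (norm (weak_X X U u x) powr p + norm (classical_X X (g k) x) powr p))"
      by (intro AE_I2) simp
  qed
  have lim0: "(\<lambda>k. LINT x|lebesgue_on U. \<bar>u x - g k x\<bar> powr p) \<longlonglongrightarrow> 0"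
  proof (rule Lim_null_comparison[OF always_eventually[OF allI] eps0])
    fix k
    show "norm (LINT x|lebesgue_on U. \<bar>u x - g k x\<bar> powr p) \<le> (1 / real (Suc k)) powr p"
      using W1p_norm_components(1)[OF g(2), of k] by (simp add: abs_minus_commute del: of_nat_Suc)
  qed
  define m where "m = real CARD('m)"
  have lim1: "(\<lambda>k. LINT x|lebesgue_on U. norm (weak_X X U u x - classical_X X (g k) x) powr p) \<longlonglongrightarrow> 0"
  proof (rule Lim_null_comparison[OF always_eventually[OF allI] tendsto_mult_right_zero[OF eps0, of "m powr p * m"]])
    fix k
    let ?D = "\<lambda>x. weak_X X U u x - classical_X X (g k) x"
    have comp: "\<bar>?D x $ j\<bar> powr p \<le> norm (?D x) powr p" for x j
      using p_pos component_le_norm_cart[of "?D x" j] by (intro powr_mono2) auto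
    have D_meas: "?D \<in> borel_measurable (lebesgue_on U)" using uI(4) cX_meas by measurable
    have Dj_meas: "(\<lambda>x. ?D x $ j) \<in> borel_measurable (lebesgue_on U)" for j
      by (rule measurable_compose[OF D_meas]) (intro borel_measurable_continuous_onI continuous_intros)
    have Dj: "integrable (lebesgue_on U) (\<lambda>x. \<bar>?D x $ j\<bar> powr p)" for j
      by (rule Bochner_Integration.integrable_bound[OF int1[of k]]) (use Dj_meas comp in auto)
    have "(LINT x|lebesgue_on U. norm (?D x) powr p) \<le> (LINT x|lebesgue_on U. m powr p * (\<Sum>j\<in>UNIV. \<bar>?D x $ j\<bar> powr p))"
    proof (rule integral_mono[OF int1])
      show "integrable (lebesgue_on U) (\<lambda>x. m powr p * (\<Sum>j\<in>UNIV. \<bar>?D x $ j\<bar> powr p))"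
        by (intro integrable_mult_right Bochner_Integration.integrable_sum Dj)
      show "norm (?D x) powr p \<le> m powr p * (\<Sum>j\<in>UNIV. \<bar>?D x $ j\<bar> powr p)" for x
        unfolding m_def by (rule norm_powr_le_sum[OF p_pos])
    qed
    also have "\<dots> = m powr p * (\<Sum>j\<in>UNIV. LINT x|lebesgue_on U. \<bar>?D x $ j\<bar> powr p)"
      by (simp only: integral_mult_right_zero Bochner_Integration.integral_sum Dj)
    also have "\<dots> \<le> m powr p * (\<Sum>j\<in>(UNIV::'m set). (1 / real (Suc k)) powr p)"
    proof (intro mult_left_mono sum_mono)
      fix j :: 'm
      have "(LINT x|lebesgue_on U. \<bar>?D x $ j\<bar> powr p) = (LINT x|lebesgue_on U. \<bar>weak_X X U (\<lambda>x. g k x - u x) x $ j\<bar> powr p)"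
      proof (rule integral_cong_AE)
        show "AE x in lebesgue_on U. \<bar>?D x $ j\<bar> powr p = \<bar>weak_X X U (\<lambda>x. g k x - u x) x $ j\<bar> powr p"
          using cX_ae[of k] by eventually_elim (simp add: abs_minus_commute)
      qed (use Dj_meas wX_meas in auto)
      then show "(LINT x|lebesgue_on U. \<bar>?D x $ j\<bar> powr p) \<le> (1 / real (Suc k)) powr p"
        using W1p_norm_components(2)[OF g(2), of k j] by simp
    qed simp
    also have "\<dots> = m powr p * m * (1 / real (Suc k)) powr p" by (simp add: m_def)
    finally show "norm (LINT x|lebesgue_on U. norm (?D x) powr p) \<le> m powr p * m * (1 / real (Suc k)) powr p" by simp
  qed
  obtain r :: "nat \<Rightarrow> nat" where r: "strict_mono r" "AE x in lebesgue_on U. (\<lambda>n. \<bar>u x - g (r n) x\<bar> powr p) \<longlonglongrightarrow> 0"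
    using tendsto_L1_AE_subseq[of "lebesgue_on U" "\<lambda>k x. \<bar>u x - g k x\<bar> powr p", OF int0] lim0 by auto
  have ae: "AE x in lebesgue_on U. (\<lambda>n. g (r n) x) \<longlonglongrightarrow> u x"
    using r(2)
  proof eventually_elim
    case (elim x)
    have "(\<lambda>n. (\<bar>u x - g (r n) x\<bar> powr p) powr (1 / p)) \<longlonglongrightarrow> 0 powr (1 / p)"
      by (rule tendsto_powr'[OF elim tendsto_const]) (use p_pos in auto)
    then have "(\<lambda>n. \<bar>u x - g (r n) x\<bar>) \<longlonglongrightarrow> 0" using p_pos by (simp add: powr_powr)
    then have "(\<lambda>n. u x - g (r n) x) \<longlonglongrightarrow> 0" by (rule tendsto_rabs_zero_cancel)
    from tendsto_diff[OF tendsto_const[of "u x"] this] show ?case by simp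
  qed
  note mono = integrable_lebesgue_on_mono[OF _ sets_lebesgue(2,1) \<Omega>_sub]
  have small: "(\<lambda>k. LINT x|lebesgue_on \<Omega>. G (r k) x) \<longlonglongrightarrow> 0"
    if lim: "(\<lambda>k. LINT x|lebesgue_on U. G k x) \<longlonglongrightarrow> 0" and nn: "\<And>k x. 0 \<le> G k x" and int: "\<And>k. integrable (lebesgue_on U) (G k)"
    for G :: "nat \<Rightarrow> real^'n \<Rightarrow> real"
  proof (rule Lim_null_comparison[OF always_eventually[OF allI] LIMSEQ_subseq_LIMSEQ[OF lim r(1), unfolded o_def]])
    fix k
    show "norm (LINT x|lebesgue_on \<Omega>. G (r k) x) \<le> (LINT x|lebesgue_on U. G (r k) x)"
      using mono(2)[OF int nn, of "r k"] Bochner_Integration.integral_nonneg[of "lebesgue_on \<Omega>" "G (r k)"] nn by simp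
  qed
  show ?thesis
    by (rule that[of "\<lambda>k. g (r k)"])
      (use g(1) small[OF lim0] small[OF lim1] int0 int1 ae mono(1)[OF int0] mono(1)[OF int1] in auto)
qed

text \<open>\<open>u\<close> is an almost everywhere limit of functions that vanish off
  \<open>\<Omega>\<close>. Consequently an element that is nonzero on \<open>U\<close> is nonzero on
  \<open>\<Omega>\<close>, and the quotients in \<open>lambda1\<close> have positive
  denominators.\<close>

lemma W1p_zero_vanishes:
  assumes u: "u \<in> W1p_zero X U p \<Omega>"
  shows "AE x in lebesgue_on U. x \<notin> \<Omega> \<longrightarrow> u x = 0"
proof -
  obtain f where f: "\<And>k::nat. f k \<in> test_functions \<Omega>" "AE x in lebesgue_on U. (\<lambda>k. f k x) \<longlonglongrightarrow> u x"
  proof (rule W1p_zero_approx[OF u])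
    fix f :: "nat \<Rightarrow> real^'n \<Rightarrow> real"
    assume "\<And>k. f k \<in> test_functions \<Omega>" "AE x in lebesgue_on U. (\<lambda>k. f k x) \<longlonglongrightarrow> u x"
    then show thesis by (rule that)
  qed
  show ?thesis using f(2)
  proof eventually_elim
    case (elim x)
    show ?case
    proof
      assume "x \<notin> \<Omega>"
      then have "(\<lambda>k. f k x) = (\<lambda>_. 0)" using test_functions_eq_0[OF f(1)] by blast
      then show "u x = 0" using elim by (simp add: LIMSEQ_const_iff)
    qed
  qed
qed

lemma W1p_zero_integrable:
  assumes u: "u \<in> W1p_zero X U p \<Omega>"
  shows "integrable (lebesgue_on \<Omega>) (\<lambda>x. \<bar>u x\<bar> powr p)" "integrable (lebesgue_on \<Omega>) (\<lambda>x. norm (weak_X X U u x) powr p)"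
  using u weak_X_integrable[of u] integrable_lebesgue_on_mono(1)[OF _ sets_lebesgue(2,1) \<Omega>_sub]
  unfolding W1p_zero_def by blast+

lemma integrable_test_\<Omega>:
  assumes f: "f \<in> test_functions \<Omega>"
  shows "integrable (lebesgue_on \<Omega>) (\<lambda>x. \<bar>f x\<bar> powr p)" "integrable (lebesgue_on \<Omega>) (\<lambda>x. norm (classical_X X f x) powr p)"
  using integrable_test[OF f] integrable_lebesgue_on_mono(1)[OF _ sets_lebesgue(2,1) \<Omega>_sub] by blast+

text \<open>The constant loses \<open>2 powr p\<close> twice, in passing from \<open>u\<close> to
  \<open>f k\<close> and back. This is harmless, since the inequality is meant to show that
  \<open>lambda1\<close> is positive and not to compute it.\<close>

lemma W1p_zero_poincare:
  obtains c where "0 < c" "\<And>u. u \<in> W1p_zero X U p \<Omega> \<Longrightarrow>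
    (LINT x|lebesgue_on \<Omega>. \<bar>u x\<bar> powr p) \<le> c * (LINT x|lebesgue_on \<Omega>. norm (weak_X X U u x) powr p)"
proof -
  obtain c where c: "0 < c" "\<And>f. f \<in> test_functions \<Omega> \<Longrightarrow>
    (LINT x|lebesgue_on \<Omega>. \<bar>f x\<bar> powr p) \<le> c * (LINT x|lebesgue_on \<Omega>. norm (classical_X X f x) powr p)"
    using poincare_test by metis
  define t where "t = (2::real) powr p"
  have t: "0 < t" unfolding t_def by simp
  note split = powr_le_two_powr_sum[OF _ _ _ _ p_pos, folded t_def]
  show ?thesis
  proof (rule that[of "t * c * t"])
    show "0 < t * c * t" using t c by simp
    fix u assume u: "u \<in> W1p_zero X U p \<Omega>"
    obtain f where f: "\<And>k::nat. f k \<in> test_functions \<Omega>"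
      "(\<lambda>k. LINT x|lebesgue_on \<Omega>. \<bar>u x - f k x\<bar> powr p) \<longlonglongrightarrow> 0"
      "\<And>k. integrable (lebesgue_on \<Omega>) (\<lambda>x. \<bar>u x - f k x\<bar> powr p)"
      "(\<lambda>k. LINT x|lebesgue_on \<Omega>. norm (weak_X X U u x - classical_X X (f k) x) powr p) \<longlonglongrightarrow> 0"
      "\<And>k. integrable (lebesgue_on \<Omega>) (\<lambda>x. norm (weak_X X U u x - classical_X X (f k) x) powr p)"
      "AE x in lebesgue_on U. (\<lambda>k. f k x) \<longlonglongrightarrow> u x"
      by (rule W1p_zero_approx[OF u]) (rule that; simp)
    define A where "A = (LINT x|lebesgue_on \<Omega>. norm (weak_X X U u x) powr p)"
    define a where "a k = (LINT x|lebesgue_on \<Omega>. \<bar>u x - f k x\<bar> powr p)" for k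
    define b where "b k = (LINT x|lebesgue_on \<Omega>. norm (weak_X X U u x - classical_X X (f k) x) powr p)" for k
    have bound: "(LINT x|lebesgue_on \<Omega>. \<bar>u x\<bar> powr p) \<le> t * (c * (t * (A + b k)) + a k)" for k
    proof -
      have "(LINT x|lebesgue_on \<Omega>. \<bar>u x\<bar> powr p) \<le> (LINT x|lebesgue_on \<Omega>. t * (\<bar>f k x\<bar> powr p + \<bar>u x - f k x\<bar> powr p))"
        using W1p_zero_integrable(1)[OF u] integrable_test_\<Omega>(1)[OF f(1)] f(3)
        by (intro integral_mono split) auto
      also have "\<dots> = t * ((LINT x|lebesgue_on \<Omega>. \<bar>f k x\<bar> powr p) + a k)"
        using integrable_test_\<Omega>(1)[OF f(1)] f(3) by (simp add: a_def)
      also have "\<dots> \<le> t * (c * (LINT x|lebesgue_on \<Omega>. norm (classical_X X (f k) x) powr p) + a k)"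
        using t c(2)[OF f(1)] by (intro mult_left_mono add_right_mono) auto
      also have "\<dots> \<le> t * (c * (LINT x|lebesgue_on \<Omega>. t * (norm (weak_X X U u x) powr p + norm (weak_X X U u x - classical_X X (f k) x) powr p)) + a k)"
      proof (intro mult_left_mono add_right_mono integral_mono split)
        show "norm (classical_X X (f k) x) \<le> norm (weak_X X U u x) + norm (weak_X X U u x - classical_X X (f k) x)" for x
          by (metis norm_minus_commute norm_triangle_sub)
      qed (use t c(1) integrable_test_\<Omega>(2)[OF f(1)] W1p_zero_integrable(2)[OF u] f(5) in auto)
      also have "\<dots> = t * (c * (t * (A + b k)) + a k)"
        using W1p_zero_integrable(2)[OF u] f(5) by (simp add: A_def b_def)
      finally show ?thesis .
    qed
    have "(\<lambda>k. t * (c * (t * (A + b k)) + a k)) \<longlonglongrightarrow> t * (c * (t * (A + 0)) + 0)"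
      by (intro tendsto_intros) (use f(2,4) in \<open>simp_all add: a_def b_def\<close>)
    then have "(LINT x|lebesgue_on \<Omega>. \<bar>u x\<bar> powr p) \<le> t * (c * (t * (A + 0)) + 0)"
      by (rule LIMSEQ_le_const) (use bound in blast)
    then show "(LINT x|lebesgue_on \<Omega>. \<bar>u x\<bar> powr p) \<le> t * c * t * (LINT x|lebesgue_on \<Omega>. norm (weak_X X U u x) powr p)"
      by (simp add: A_def mult.assoc)
  qed
qed

text \<open>The approximating function is \<open>f\<close> itself, but \<open>weak_X\<close> of the
  zero function is still a chosen field and is known to vanish only almost everywhere, so its norm
  has to be evaluated.\<close>

lemma test_function_in_W1p_zero:
  assumes f: "f \<in> test_functions \<Omega>"
  shows "f \<in> W1p_zero X U p \<Omega>"
proof -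
  have wd: "weak_deriv U (X j) (\<lambda>_. 0) (\<lambda>x. (0::real^'m) $ j)" for j
    unfolding weak_deriv_def by simp
  have ae: "AE x in lebesgue_on U. weak_X X U (\<lambda>_. 0) x = 0"
    by (rule weak_X_unique[OF U(1) wd])
  have "(LINT x|lebesgue_on U. \<bar>weak_X X U (\<lambda>_. 0) x $ j\<bar> powr p) = 0" for j
    by (rule integral_eq_zero_AE) (use ae in \<open>eventually_elim, simp\<close>)
  then have "W1p_norm X U p (\<lambda>x. f x - f x) = 0" unfolding W1p_norm_def Lp_norm_def by simp
  then show ?thesis
    unfolding W1p_zero_def using f test_function_in_W1p[OF p_pos U(1) X test_function_U[OF f]]
    by (auto intro!: bexI[of _ f])
qed

text \<open>Guarantees that the set of quotients in \<open>lambda1\<close> is nonempty, without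
  which its infimum would carry no information.\<close>

lemma nonzero_test_function:
  obtains f where "f \<in> test_functions \<Omega>" "\<not> (AE x in lebesgue_on U. f x = 0)"
proof -
  obtain x a b where ab: "x \<in> box a b" "cbox a b \<subseteq> \<Omega>"
    using \<Omega>_nonempty open_contains_cbox[of \<Omega>] \<Omega>(1) by (metis ex_in_conv)
  show ?thesis
  proof (rule that[OF box_bump_test_function[OF zero_less_one ab(2)]])
    show "\<not> (AE y in lebesgue_on U. box_bump 1 a b y = 0)"
    proof
      assume "AE y in lebesgue_on U. box_bump 1 a b y = 0"
      then have "AE y in lebesgue. y \<in> U \<longrightarrow> box_bump 1 a b y = 0"
        using sets_lebesgue(1) by (simp add: AE_restrict_space_iff)
      then have "AE y in lebesgue. y \<notin> box a b"
      proof eventually_elim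
        case (elim y)
        then show ?case using box_bump_pos[of 1 y a b] ab(2) box_subset_cbox[of a b] \<Omega>_sub by auto
      qed
      then have "box a b \<in> null_sets lebesgue" by (simp add: AE_iff_null_sets)
      then have "negligible (box a b)" by (simp add: negligible_iff_null_sets)
      then show False using ab(1) open_not_negligible[of "box a b"] by auto
    qed
  qed
qed

text \<open>The Poincare constant \<open>c\<close> bounds every quotient below by
  \<open>1 / c\<close>, and the set of quotients is nonempty. The second claim is the defining
  inequality of the infimum, with the chosen weak derivative replaced by the classical one.\<close>

lemma lambda1_bounds:
  shows lambda1_pos: "0 < lambda1 X U p \<Omega>"
    and lambda1_le: "\<And>f. f \<in> test_functions \<Omega> \<Longrightarrow>
      lambda1 X U p \<Omega> * (LINT x|lebesgue_on \<Omega>. \<bar>f x\<bar> powr p) \<le> (LINT x|lebesgue_on \<Omega>. norm (classical_X X f x) powr p)"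
proof -
  let ?N = "\<lambda>u. LINT x|lebesgue_on \<Omega>. norm (weak_X X U u x) powr p"
  let ?D = "\<lambda>u. LINT x|lebesgue_on \<Omega>. \<bar>u x\<bar> powr p"
  define R where "R = {?N u / ?D u |u. u \<in> W1p_zero X U p \<Omega> \<and> \<not> (AE x in lebesgue_on U. u x = 0)}"
  have lam: "lambda1 X U p \<Omega> = Inf R" unfolding lambda1_def R_def ..
  obtain c where c: "0 < c" "\<And>u. u \<in> W1p_zero X U p \<Omega> \<Longrightarrow> ?D u \<le> c * ?N u"
    by (rule W1p_zero_poincare) blast
  have D_pos: "0 < ?D u" if u: "u \<in> W1p_zero X U p \<Omega>" "\<not> (AE x in lebesgue_on U. u x = 0)" for u
  proof (rule ccontr)
    assume "\<not> 0 < ?D u"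
    moreover have "0 \<le> ?D u" by (intro Bochner_Integration.integral_nonneg) simp
    ultimately have "?D u = 0" by simp
    then have "AE x in lebesgue_on \<Omega>. \<bar>u x\<bar> powr p = 0"
      using integral_nonneg_eq_0_iff_AE[OF W1p_zero_integrable(1)[OF u(1)]] by simp
    then have "AE x in lebesgue. x \<in> \<Omega> \<longrightarrow> u x = 0" using sets_lebesgue(2) by (simp add: AE_restrict_space_iff)
    moreover have "AE x in lebesgue. x \<in> U \<longrightarrow> x \<notin> \<Omega> \<longrightarrow> u x = 0"
      using W1p_zero_vanishes[OF u(1)] sets_lebesgue(1) by (simp add: AE_restrict_space_iff)
    ultimately have "AE x in lebesgue. x \<in> U \<longrightarrow> u x = 0" by eventually_elim blast
    then show False using u(2) sets_lebesgue(1) by (simp add: AE_restrict_space_iff)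
  qed
  have lower: "1 / c \<le> y" if y: "y \<in> R" for y
  proof -
    obtain u where u: "u \<in> W1p_zero X U p \<Omega>" "\<not> (AE x in lebesgue_on U. u x = 0)" "y = ?N u / ?D u"
      using y unfolding R_def by blast
    have "?D u / c \<le> ?N u" using c(2)[OF u(1)] c(1) by (simp add: pos_divide_le_eq mult.commute)
    then show ?thesis using D_pos[OF u(1,2)] u(3) by (simp add: pos_le_divide_eq)
  qed
  obtain f0 where "f0 \<in> test_functions \<Omega>" "\<not> (AE x in lebesgue_on U. f0 x = 0)"
    by (rule nonzero_test_function)
  then have "?N f0 / ?D f0 \<in> R" using test_function_in_W1p_zero unfolding R_def by blast
  then have "R \<noteq> {}" by blast
  then have "1 / c \<le> Inf R" using lower by (rule cInf_greatest)
  moreover have "0 < 1 / c" using c(1) by simp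
  ultimately show "0 < lambda1 X U p \<Omega>" unfolding lam by linarith
  fix f assume f: "f \<in> test_functions \<Omega>"
  have ae: "AE x in lebesgue_on \<Omega>. weak_X X U f x = classical_X X f x"
    by (rule AE_lebesgue_on_mono[OF weak_X_test_function[OF U(1) X test_function_U[OF f]] sets_lebesgue(2,1) \<Omega>_sub])
  have N_eq: "?N f = (LINT x|lebesgue_on \<Omega>. norm (classical_X X f x) powr p)"
  proof (rule integral_cong_AE)
    show "AE x in lebesgue_on \<Omega>. norm (weak_X X U f x) powr p = norm (classical_X X f x) powr p"
      using ae by eventually_elim simp
  qed (use integrable_test_\<Omega>(2)[OF f] W1p_zero_integrable(2)[OF test_function_in_W1p_zero[OF f]] in auto)
  show "lambda1 X U p \<Omega> * ?D f \<le> (LINT x|lebesgue_on \<Omega>. norm (classical_X X f x) powr p)"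
  proof (cases "AE x in lebesgue_on U. f x = 0")
    case True
    have "?D f = 0"
      by (rule integral_eq_zero_AE)
        (use AE_lebesgue_on_mono[OF True sets_lebesgue(2,1) \<Omega>_sub] in \<open>eventually_elim, simp\<close>)
    moreover have "0 \<le> (LINT x|lebesgue_on \<Omega>. norm (classical_X X f x) powr p)" by (intro Bochner_Integration.integral_nonneg) simp
    ultimately show ?thesis by simp
  next
    case False
    have "bdd_below R" using lower by (rule bdd_belowI)
    then have "Inf R \<le> ?N f / ?D f"
      by (rule cInf_lower[rotated]) (use False test_function_in_W1p_zero[OF f] in \<open>auto simp: R_def\<close>)
    then show ?thesis
      using D_pos[OF test_function_in_W1p_zero[OF f] False] unfolding lam N_eq by (simp add: field_simps)
  qed
qed

end

section \<open>The exponential inequality\<close>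

locale trudinger_domain = sobolev_domain X U \<Omega> p
  for X :: "'m::finite \<Rightarrow> real^'n \<Rightarrow> real^'n" and U \<Omega> p +
  fixes C C0 C1 C2 C3 \<rho> :: real
  assumes volume: "volume_constants X U \<Omega> C C1 C2 C3 \<rho>"
    and representation: "representation_constant X U \<Omega> C0"
begin

abbreviation nsw :: "real^'n \<Rightarrow> real \<Rightarrow> real" where
  "nsw \<equiv> nsw_polynomial X U"

definition cc_dist :: "real^'n \<Rightarrow> real^'n \<Rightarrow> real" where
  "cc_dist x y = enn2real (subunit_dist X U x y)"

text \<open>An infinite distance gives \<open>cc_dist x y = 0\<close>, hence \<open>kernel x y = 0\<close>; in this case the kernel of the
  representation formula is 0 too.\<close>

definition kernel :: "real^'n \<Rightarrow> real^'n \<Rightarrow> real" where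
  "kernel x y = (if x \<in> \<Omega> \<and> y \<in> \<Omega> \<and> 0 < cc_dist x y then 1 / (C1 * nsw x (cc_dist x y)) else 0)"

lemma constants: "0 < C" "0 < C1" "C1 \<le> C2" "1 < C3" "0 < \<rho>" "0 < C0"
  using volume representation unfolding volume_constants_def representation_constant_def by auto

lemma volume_bounds:
  assumes "x \<in> closure \<Omega>" "0 < r" "ennreal r \<le> max (subunit_diameter X U (closure \<Omega>)) (ennreal \<rho>)"
  shows "C * r ^ metivier_index X \<Omega> \<le> nsw x r" "C1 * nsw x r \<le> ball_volume X U x r"
    "ball_volume X U x r \<le> C2 * nsw x r"
  using volume assms unfolding volume_constants_def by blast+

lemma volume_symmetric:
  assumes "x \<in> closure \<Omega>" "y \<in> closure \<Omega>"
  shows "inverse C3 * ball_volume X U y (cc_dist x y) \<le> ball_volume X U x (cc_dist x y)"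
  using volume assms unfolding volume_constants_def cc_dist_def Let_def by blast

lemma in_closure: "x \<in> \<Omega> \<Longrightarrow> x \<in> closure \<Omega>"
  using closure_subset by blast

lemma small_radius: "r \<le> \<rho> \<Longrightarrow> ennreal r \<le> max (subunit_diameter X U (closure \<Omega>)) (ennreal \<rho>)"
  by (intro max.coboundedI2 ennreal_leI)

lemma cc_dist_radius:
  assumes "x \<in> \<Omega>" "y \<in> \<Omega>"
  shows "ennreal (cc_dist x y) \<le> max (subunit_diameter X U (closure \<Omega>)) (ennreal \<rho>)"
proof -
  have "ennreal (cc_dist x y) \<le> subunit_dist X U x y"
    unfolding cc_dist_def by (cases "subunit_dist X U x y") auto
  also have "\<dots> \<le> subunit_diameter X U (closure \<Omega>)"
    unfolding subunit_diameter_def using assms in_closure by (intro SUP_upper2[of x] SUP_upper2[of y]) auto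
  finally show ?thesis by (rule max.coboundedI1)
qed

lemma cc_dist_commute: "cc_dist x y = cc_dist y x"
  unfolding cc_dist_def by (subst subunit_dist_commute) (rule refl)

lemma nsw_pos:
  assumes "x \<in> closure \<Omega>" "0 < r" "ennreal r \<le> max (subunit_diameter X U (closure \<Omega>)) (ennreal \<rho>)"
  shows "0 < nsw x r"
proof -
  have "0 < C * r ^ metivier_index X \<Omega>" using constants assms(2) by simp
  then show ?thesis using volume_bounds(1)[OF assms] by linarith
qed

lemma nsw_mono: "0 \<le> r \<Longrightarrow> r \<le> s \<Longrightarrow> nsw x r \<le> nsw x s"
  unfolding nsw_polynomial_def by (intro sum_mono mult_left_mono power_mono) auto

text \<open>Words are nonempty, so every monomial has positive degree. The value 0 at radius 0 is
  the lower end of an intermediate value argument.\<close>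

lemma nsw_0: "nsw x 0 = 0"
  unfolding nsw_polynomial_def
proof (intro sum.neutral ballI)
  fix I :: "'n \<Rightarrow> 'm list" assume I: "I \<in> {I. \<forall>k. I k \<in> words (hormander_index X U)}"
  obtain k :: 'n where True by blast
  have "0 < length (I k)" using I unfolding words_def by (auto simp: Suc_le_eq)
  also have "length (I k) \<le> (\<Sum>k\<in>UNIV. length (I k))" by (rule member_le_sum) auto
  finally have "0 < (\<Sum>k\<in>UNIV. length (I k))" .
  then show "\<bar>det (\<chi> i k. commutator X (I k) x $ i)\<bar> * 0 ^ (\<Sum>k\<in>UNIV. length (I k)) = 0" by simp
qed

lemma nsw_measurable: "(\<lambda>z. nsw (fst z) (g z)) \<in> borel_measurable (lebesgue_on \<Omega> \<Otimes>\<^sub>M lebesgue_on \<Omega>)"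
  if g: "g \<in> borel_measurable (lebesgue_on \<Omega> \<Otimes>\<^sub>M lebesgue_on \<Omega>)"
proof -
  have det: "(\<lambda>x. det (\<chi> i k. commutator X (I k) x $ i)) \<in> borel_measurable (lebesgue_on \<Omega>)" for I :: "'n \<Rightarrow> 'm list"
  proof (rule continuous_imp_measurable_on_sets_lebesgue[OF _ sets_lebesgue(2)])
    have "smooth_on U (\<lambda>y. commutator X (I k) y $ i)" for i k
      by (rule smooth_on_bounded_linear[OF U(1) bounded_linear_vec_nth smooth_on_commutator[OF U(1) X]])
    then have "smooth_on U (\<lambda>x. det (\<chi> i k. commutator X (I k) x $ i))" by (intro smooth_on_det U) simp
    then show "continuous_on \<Omega> (\<lambda>x. det (\<chi> i k. commutator X (I k) x $ i))"
      using smooth_on_imp_continuous_on continuous_on_subset[OF _ \<Omega>_sub] by blast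
  qed
  show ?thesis
    unfolding nsw_polynomial_def
  proof (intro borel_measurable_sum borel_measurable_times borel_measurable_power g borel_measurable_abs)
    show "(\<lambda>z. det (\<chi> i k. commutator X (I k) (fst z) $ i)) \<in> borel_measurable (lebesgue_on \<Omega> \<Otimes>\<^sub>M lebesgue_on \<Omega>)"
      for I :: "'n \<Rightarrow> 'm list"
      using measurable_compose[OF measurable_fst det] .
  qed
qed

text \<open>By convention \<open>measure\<close> is 0 on nonmeasurable sets and on sets of infinite
  measure. The lower volume bound is positive, so it forces measurability and finite volume of the
  ball without any topological information on the distance.\<close>

lemma ball_measurable:
  assumes x: "x \<in> closure \<Omega>" and r: "0 < r" "ennreal r \<le> max (subunit_diameter X U (closure \<Omega>)) (ennreal \<rho>)"
  shows "subunit_ball X U x r \<in> sets lebesgue"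
    "emeasure lebesgue (subunit_ball X U x r) = ennreal (ball_volume X U x r)"
    "0 < emeasure lebesgue (subunit_ball X U x r)"
proof -
  have "0 < C1 * nsw x r" using nsw_pos[OF assms] constants by simp
  then have pos: "0 < ball_volume X U x r" using volume_bounds(2)[OF assms] by linarith
  show "subunit_ball X U x r \<in> sets lebesgue"
    using pos unfolding ball_volume_def by (metis measure_notin_sets less_irrefl)
  show eq: "emeasure lebesgue (subunit_ball X U x r) = ennreal (ball_volume X U x r)"
    using pos unfolding ball_volume_def measure_def by (cases "emeasure lebesgue (subunit_ball X U x r)") auto
  show "0 < emeasure lebesgue (subunit_ball X U x r)" unfolding eq using pos by simp
qed

lemma subunit_dist_measurable_\<Omega>:
  "(\<lambda>(x, y). subunit_dist X U x y) \<in> borel_measurable (lebesgue_on \<Omega> \<Otimes>\<^sub>M lebesgue_on \<Omega>)"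
proof (rule subunit_dist_measurable[OF sets_lebesgue(2) \<Omega>_sub])
  fix z s assume z: "z \<in> \<Omega>" and s: "0 < (s::real)"
  show "subunit_ball X U z s \<inter> \<Omega> \<in> sets lebesgue"
  proof (cases "ennreal s \<le> max (subunit_diameter X U (closure \<Omega>)) (ennreal \<rho>)")
    case True
    then show ?thesis using ball_measurable(1)[OF in_closure[OF z] s] sets_lebesgue(2) by blast
  next
    \<comment> \<open>A radius above the diameter of \<open>closure \<Omega>\<close> is outside the
      range of the volume bounds, but the ball then contains all of \<open>\<Omega>\<close>.\<close>
    case False
    have "subunit_dist X U z y < ennreal s" if "y \<in> \<Omega>" for y
    proof -
      have "subunit_dist X U z y \<le> subunit_diameter X U (closure \<Omega>)"
        unfolding subunit_diameter_def using z that in_closure by (intro SUP_upper2[of z] SUP_upper2[of y]) auto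
      also have "\<dots> < ennreal s" using False by (simp add: not_le)
      finally show ?thesis .
    qed
    then have "subunit_ball X U z s \<inter> \<Omega> = \<Omega>" using \<Omega>_sub unfolding subunit_ball_def by blast
    then show ?thesis using sets_lebesgue(2) by simp
  qed
next
  fix \<epsilon> :: real assume e: "0 < \<epsilon>"
  \<comment> \<open>Balls of radius \<open>e' / 2\<close> have to be in the range of the volume
    bounds in order to be measurable and of positive volume.\<close>
  define e' where "e' = min \<epsilon> \<rho>"
  have e': "0 < e'" "e' / 2 \<le> \<rho>" "0 < e' / 2" using e constants(5) unfolding e'_def by auto
  obtain Z where Z: "countable Z" "Z \<subseteq> \<Omega>" "\<And>x. x \<in> \<Omega> \<Longrightarrow> \<exists>z\<in>Z. subunit_dist X U x z < ennreal e'"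
    using subunit_separable[OF \<Omega>_sub e'(1), of X] ball_measurable[OF in_closure e'(3) small_radius[OF e'(2)]] by blast
  have "ennreal e' \<le> ennreal \<epsilon>" unfolding e'_def by (intro ennreal_leI) simp
  then show "\<exists>Z. countable Z \<and> Z \<subseteq> \<Omega> \<and> (\<forall>x\<in>\<Omega>. \<exists>z\<in>Z. subunit_dist X U x z < ennreal \<epsilon>)"
    using Z by (meson order_less_le_trans)
qed

lemma kernel_nonneg: "0 \<le> kernel x y"
  unfolding kernel_def using nsw_pos[OF in_closure _ cc_dist_radius] constants by (auto intro!: mult_nonneg_nonneg less_imp_le)

lemma kernel_measurable: "(\<lambda>(x, y). kernel x y) \<in> borel_measurable (lebesgue_on \<Omega> \<Otimes>\<^sub>M lebesgue_on \<Omega>)"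
proof -
  let ?M = "lebesgue_on \<Omega> \<Otimes>\<^sub>M lebesgue_on \<Omega>"
  have d: "(\<lambda>z. cc_dist (fst z) (snd z)) \<in> borel_measurable ?M"
    unfolding cc_dist_def using subunit_dist_measurable_\<Omega> by (simp add: case_prod_beta)
  have "(\<lambda>z. if 0 < cc_dist (fst z) (snd z) then 1 / (C1 * nsw (fst z) (cc_dist (fst z) (snd z))) else 0) \<in> borel_measurable ?M"
    using d nsw_measurable[OF d] by measurable
  moreover have "(if 0 < cc_dist (fst z) (snd z) then 1 / (C1 * nsw (fst z) (cc_dist (fst z) (snd z))) else 0) =
      (case z of (x, y) \<Rightarrow> kernel x y)" if "z \<in> space ?M" for z
    using that by (auto simp: kernel_def space_pair_measure space_restrict_space)
  ultimately show ?thesis by (rule measurable_cong[THEN iffD1, rotated])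
qed

text \<open>By the intermediate value theorem \<open>t = C1 * nsw x r\<close> for some
  \<open>r \<le> \<rho> / 2\<close>. As \<open>nsw\<close> is monotone in the radius,
  \<open>kernel x y > 1 / t\<close> puts \<open>y\<close> into the ball of radius \<open>r\<close>,
  whose volume is at most \<open>C2 * nsw x r = C2 / C1 * t\<close>.\<close>

lemma kernel_weak_type:
  assumes x: "x \<in> \<Omega>" and t: "0 < t" "t \<le> C1 * C * (\<rho> / 2) ^ metivier_index X \<Omega>"
  shows "emeasure (lebesgue_on \<Omega>) {y\<in>space (lebesgue_on \<Omega>). 1 / t < kernel x y} \<le> ennreal (C2 / C1 * t)"
proof -
  have r0: "0 < \<rho> / 2" "\<rho> / 2 \<le> \<rho>" using constants by auto
  have "t \<le> C1 * nsw x (\<rho> / 2)"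
  proof -
    have "C1 * (C * (\<rho> / 2) ^ metivier_index X \<Omega>) \<le> C1 * nsw x (\<rho> / 2)"
      using constants by (intro mult_left_mono volume_bounds(1) in_closure x r0 small_radius) auto
    then show ?thesis using t(2) by (simp only: mult.assoc)
  qed
  moreover have "continuous_on {0..\<rho> / 2} (\<lambda>r. C1 * nsw x r)"
    unfolding nsw_polynomial_def by (intro continuous_intros)
  ultimately obtain r where r: "0 \<le> r" "r \<le> \<rho> / 2" "C1 * nsw x r = t"
    using IVT'[of "\<lambda>r. C1 * nsw x r" 0 t "\<rho> / 2"] r0(1) t(1) nsw_0 by auto
  have "r \<noteq> 0" using r(3) t(1) nsw_0 by auto
  then have r_pos: "0 < r" using r(1) by simp
  have r_le: "ennreal r \<le> max (subunit_diameter X U (closure \<Omega>)) (ennreal \<rho>)"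
    using r(2) r0(2) by (intro small_radius) simp
  have sub: "{y\<in>\<Omega>. 1 / t < kernel x y} \<subseteq> subunit_ball X U x r"
  proof
    fix y assume "y \<in> {y\<in>\<Omega>. 1 / t < kernel x y}"
    then have y: "y \<in> \<Omega>" "1 / t < kernel x y" by auto
    have d: "0 < cc_dist x y"
    proof (rule ccontr)
      assume "\<not> 0 < cc_dist x y"
      then have "kernel x y = 0" unfolding kernel_def by simp
      then show False using y(2) t(1) by simp
    qed
    let ?L = "C1 * nsw x (cc_dist x y)"
    have L: "0 < ?L" using nsw_pos[OF in_closure[OF x] d cc_dist_radius[OF x y(1)]] constants by simp
    have "1 / t < 1 / ?L" using y(2) d x y(1) unfolding kernel_def by simp
    then have "?L < C1 * nsw x r" using L t(1) r(3) by (simp add: field_simps)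
    then have "nsw x (cc_dist x y) < nsw x r" using constants by simp
    then have "cc_dist x y < r" using nsw_mono[of r "cc_dist x y" x] r(1) by (meson not_le)
    \<comment> \<open>A positive \<open>cc_dist\<close> excludes an infinite distance, which
      \<open>enn2real\<close> sends to 0.\<close>
    moreover have "subunit_dist X U x y = ennreal (cc_dist x y)"
      using d unfolding cc_dist_def by (cases "subunit_dist X U x y") auto
    ultimately have "subunit_dist X U x y < ennreal r" using d by (simp add: ennreal_less_iff)
    then show "y \<in> subunit_ball X U x r" using y(1) \<Omega>_sub unfolding subunit_ball_def by blast
  qed
  have "emeasure (lebesgue_on \<Omega>) {y\<in>space (lebesgue_on \<Omega>). 1 / t < kernel x y} = emeasure lebesgue {y\<in>\<Omega>. 1 / t < kernel x y}"
    using sets_lebesgue(2) by (subst emeasure_restrict_space) (auto simp: space_restrict_space)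
  also have "\<dots> \<le> emeasure lebesgue (subunit_ball X U x r)"
    by (rule emeasure_mono[OF sub ball_measurable(1)[OF in_closure[OF x] r_pos r_le]])
  also have "\<dots> = ennreal (ball_volume X U x r)" by (rule ball_measurable(2)[OF in_closure[OF x] r_pos r_le])
  also have "\<dots> \<le> ennreal (C2 * nsw x r)" by (intro ennreal_leI volume_bounds(3)[OF in_closure[OF x] r_pos r_le])
  also have "C2 * nsw x r = C2 / C1 * t" using r(3) constants by (simp add: field_simps)
  finally show ?thesis .
qed

text \<open>Passing from \<open>nsw\<close> to the volume of balls and back costs
  \<open>C2 / C1\<close>; exchanging the centres of two balls of radius \<open>cc_dist x y\<close>
  costs \<open>C3\<close>.\<close>

lemma kernel_quasi_symmetric:
  assumes x: "x \<in> \<Omega>" and y: "y \<in> \<Omega>"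
  shows "kernel x y \<le> C2 * C3 / C1 * kernel y x"
proof (cases "0 < cc_dist x y")
  case False
  then show ?thesis using cc_dist_commute[of x y] by (simp add: kernel_def)
next
  case True
  let ?d = "cc_dist x y"
  have d_le: "ennreal ?d \<le> max (subunit_diameter X U (closure \<Omega>)) (ennreal \<rho>)" by (rule cc_dist_radius[OF x y])
  note px = nsw_pos[OF in_closure[OF x] True d_le] and py = nsw_pos[OF in_closure[OF y] True d_le]
  have "C1 * nsw y ?d \<le> ball_volume X U y ?d" by (rule volume_bounds(2)[OF in_closure[OF y] True d_le])
  also have "\<dots> = C3 * (inverse C3 * ball_volume X U y ?d)" using constants by simp
  also have "\<dots> \<le> C3 * ball_volume X U x ?d"
    using volume_symmetric[OF in_closure[OF x] in_closure[OF y]] constants by (intro mult_left_mono) auto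
  also have "\<dots> \<le> C3 * (C2 * nsw x ?d)"
    using volume_bounds(3)[OF in_closure[OF x] True d_le] constants by (intro mult_left_mono) auto
  finally have "C1 * nsw y ?d \<le> C3 * (C2 * nsw x ?d)" .
  then have "1 / (C1 * nsw x ?d) \<le> C2 * C3 / C1 * (1 / (C1 * nsw y ?d))"
    using constants px py by (simp add: field_simps)
  then show ?thesis using True x y cc_dist_commute[of x y] by (simp add: kernel_def)
qed

text \<open>The last parameter is a lower bound of \<open>C1 * nsw x (\<rho> / 2)\<close> that is
  uniform in \<open>x\<close>. The threshold for \<open>\<sigma>\<close> is governed by
  \<open>C2 / C1\<close>; the other two parameters go into the final constant.\<close>

sublocale weak_type_kernel "lebesgue_on \<Omega>" kernel "C2 / C1" "C2 * C3 / C1" "C1 * C * (\<rho> / 2) ^ metivier_index X \<Omega>"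
proof -
  interpret finite_measure "lebesgue_on \<Omega>" by (rule finite_measure_lebesgue_on[OF \<Omega>_lmeasurable])
  have "1 \<le> C2 * C3 / C1"
  proof -
    have "C1 * 1 \<le> C2 * C3" using constants by (intro mult_mono) auto
    then show ?thesis using constants by simp
  qed
  then show "weak_type_kernel (lebesgue_on \<Omega>) kernel (C2 / C1) (C2 * C3 / C1) (C1 * C * (\<rho> / 2) ^ metivier_index X \<Omega>)"
    using constants kernel_measurable kernel_nonneg kernel_weak_type kernel_quasi_symmetric
    by unfold_locales (auto simp: space_restrict_space)
qed

text \<open>With \<open>d = cc_dist x y\<close> and \<open>W = C1 * nsw x d\<close> the volume
  bounds say that the ball has volume at least \<open>W\<close>, and that
  \<open>W \<ge> C * C1 * d powr p\<close>. The latter bounds \<open>d\<close> by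
  \<open>(C * C1) powr (- (1 / p)) * W powr (1 / p)\<close>: the distance in the numerator is traded
  for the power \<open>1 / p\<close> of \<open>W\<close>, which leaves
  \<open>(1 / W) powr ((p - 1) / p)\<close>.\<close>

lemma representation_kernel:
  assumes f: "f \<in> test_functions \<Omega>" and x: "x \<in> \<Omega>"
  shows "ennreal \<bar>f x\<bar> \<le> ennreal (C0 * (C * C1) powr (- (1 / p))) *
    (\<integral>\<^sup>+y. ennreal (kernel x y powr ((p - 1) / p) * (norm (classical_X X f y) + \<bar>f y\<bar>)) \<partial>lebesgue_on \<Omega>)"
proof -
  define c where "c = (C * C1) powr (- (1 / p))"
  have c: "0 < c" unfolding c_def using constants by simp
  have meas: "(\<lambda>y. ennreal (kernel x y powr ((p - 1) / p) * (norm (classical_X X f y) + \<bar>f y\<bar>))) \<in> borel_measurable (lebesgue_on \<Omega>)"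
  proof -
    have "classical_X X f \<in> borel_measurable (lebesgue_on \<Omega>)"
      by (rule continuous_imp_measurable_on_sets_lebesgue[OF continuous_on_subset[OF classical_X_test(1)[OF f] \<Omega>_sub] sets_lebesgue(2)])
    moreover have "f \<in> borel_measurable (lebesgue_on \<Omega>)"
      by (rule continuous_imp_measurable_on_sets_lebesgue[OF test_continuous[OF f] sets_lebesgue(2)])
    moreover have "kernel x \<in> borel_measurable (lebesgue_on \<Omega>)"
      by (rule kernel_section_measurable) (use x in \<open>simp add: space_restrict_space\<close>)
    ultimately show ?thesis by measurable
  qed
  have pw: "cc_dist x y / ball_volume X U x (cc_dist x y) \<le> c * kernel x y powr ((p - 1) / p)" if y: "y \<in> \<Omega>" for y
  proof (cases "0 < cc_dist x y")
    case False
    then have "cc_dist x y = 0" unfolding cc_dist_def by (simp add: order_less_le)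
    then show ?thesis using c by simp
  next
    case True
    let ?d = "cc_dist x y"
    have d_le: "ennreal ?d \<le> max (subunit_diameter X U (closure \<Omega>)) (ennreal \<rho>)" by (rule cc_dist_radius[OF x y])
    define W where "W = C1 * nsw x ?d"
    have W: "0 < W" unfolding W_def using nsw_pos[OF in_closure[OF x] True d_le] constants by simp
    have "C1 * (C * ?d ^ metivier_index X \<Omega>) \<le> W"
      unfolding W_def using volume_bounds(1)[OF in_closure[OF x] True d_le] constants by (intro mult_left_mono) auto
    then have "C * C1 * ?d powr p \<le> W" unfolding p using True by (simp add: powr_realpow mult_ac)
    then have "(C * C1 * ?d powr p) powr (1 / p) \<le> W powr (1 / p)" using constants p_pos by (intro powr_mono2) auto
    then have "(C * C1) powr (1 / p) * ?d \<le> W powr (1 / p)"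
      using constants True p_pos by (simp add: powr_mult powr_powr)
    then have "?d \<le> c * W powr (1 / p)"
      unfolding c_def powr_minus using constants by (simp add: field_simps)
    have "?d / ball_volume X U x ?d \<le> ?d / W"
      using volume_bounds(2)[OF in_closure[OF x] True d_le] W True unfolding W_def by (intro divide_left_mono) auto
    also have "\<dots> \<le> c * W powr (1 / p) / W"
      using \<open>?d \<le> c * W powr (1 / p)\<close> W by (intro divide_right_mono) auto
    also have "\<dots> = c * (1 / W) powr ((p - 1) / p)"
    proof -
      have "W powr (1 / p) / W = W powr (1 / p - 1)" using W by (simp add: powr_diff)
      also have "1 / p - 1 = - ((p - 1) / p)" using p_pos by (simp add: field_simps)
      also have "W powr - ((p - 1) / p) = (1 / W) powr ((p - 1) / p)"
        using W by (simp add: powr_minus powr_divide divide_inverse inverse_powr)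
      finally show ?thesis by (metis times_divide_eq_right)
    qed
    also have "1 / W = kernel x y" unfolding kernel_def W_def using x y True by simp
    finally show ?thesis .
  qed
  have "ennreal \<bar>f x\<bar> \<le> ennreal C0 * (\<integral>\<^sup>+ y. ennreal (cc_dist x y / ball_volume X U x (cc_dist x y) *
      (norm (classical_X X f y) + \<bar>f y\<bar>)) \<partial>lebesgue_on \<Omega>)"
    using representation f in_closure[OF x] unfolding representation_constant_def cc_dist_def by blast
  also have "\<dots> \<le> ennreal C0 * (\<integral>\<^sup>+ y. ennreal c * ennreal (kernel x y powr ((p - 1) / p) *
      (norm (classical_X X f y) + \<bar>f y\<bar>)) \<partial>lebesgue_on \<Omega>)"
  proof (intro mult_left_mono nn_integral_mono)
    fix y assume "y \<in> space (lebesgue_on \<Omega>)"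
    then have y: "y \<in> \<Omega>" by (simp add: space_restrict_space)
    have "cc_dist x y / ball_volume X U x (cc_dist x y) * (norm (classical_X X f y) + \<bar>f y\<bar>) \<le>
        c * kernel x y powr ((p - 1) / p) * (norm (classical_X X f y) + \<bar>f y\<bar>)"
      by (intro mult_right_mono pw y) simp
    then show "ennreal (cc_dist x y / ball_volume X U x (cc_dist x y) * (norm (classical_X X f y) + \<bar>f y\<bar>)) \<le>
        ennreal c * ennreal (kernel x y powr ((p - 1) / p) * (norm (classical_X X f y) + \<bar>f y\<bar>))"
      using c by (simp add: ennreal_mult[symmetric] ennreal_leI mult.assoc)
  qed simp
  also have "\<dots> = ennreal C0 * (ennreal c * (\<integral>\<^sup>+ y. ennreal (kernel x y powr ((p - 1) / p) *
      (norm (classical_X X f y) + \<bar>f y\<bar>)) \<partial>lebesgue_on \<Omega>))"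
    by (simp only: nn_integral_cmult[OF meas])
  also have "\<dots> = ennreal (C0 * c) * (\<integral>\<^sup>+ y. ennreal (kernel x y powr ((p - 1) / p) *
      (norm (classical_X X f y) + \<bar>f y\<bar>)) \<partial>lebesgue_on \<Omega>)"
    using constants c by (simp add: ennreal_mult mult.assoc)
  finally show ?thesis unfolding c_def .
qed

text \<open>The energy is bounded by 2 instead of 1 so that the estimate applies to test functions
  close in norm to a \<open>u\<close> with norm at most 1.\<close>

lemma exponential_integral_test:
  assumes \<sigma>: "0 < \<sigma>"
    "\<sigma> < (p - 1) / (exp 1 * p) * C3 powr (- ((p + 1) / (p - 1))) *
            (C1 / (4 * C0 * (C1 + C2))) powr (p / (p - 1)) *
            (lambda1 X U p \<Omega> * C * C1 / (lambda1 X U p \<Omega> + 1)) powr (1 / (p - 1))"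
  obtains Ct where "0 < Ct" "\<And>f. f \<in> test_functions \<Omega> \<Longrightarrow>
    (LINT x|lebesgue_on \<Omega>. norm (classical_X X f x) powr p) \<le> 2 \<Longrightarrow>
    (\<integral>\<^sup>+ x. ennreal (exp (\<sigma> * \<bar>f x\<bar> powr (p / (p - 1)))) \<partial>lebesgue_on \<Omega>) \<le> ennreal Ct"
proof -
  define lam where "lam = lambda1 X U p \<Omega>"
  have lam: "0 < lam" unfolding lam_def by (rule lambda1_pos)
  define s where "s = 1 / (p - 1)"
  define p' where "p' = p / (p - 1)"
  have p1: "1 < p" using p_ge_2 by simp
  have s: "0 < s" "p' = 1 + s" "1 \<le> p'" "1 / p * p' = s" "p * s = p'"
    unfolding s_def p'_def using p1 by (auto simp: field_simps)
  define B where "B = C0 * (C * C1) powr (- (1 / p))"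
  \<comment> \<open>\<open>\<Phi> powr p = 2 powr p * (2 + 2 / lam)\<close>: the energy is at most
    2, the integral of \<open>|f| powr p\<close> at most \<open>2 / lam\<close> by the first
    eigenvalue, and \<open>2 powr p\<close> comes from splitting the power of the sum.\<close>
  define \<Phi> where "\<Phi> = (2 powr p * (2 * ((lam + 1) / lam))) powr (1 / p)"
  have B: "0 < B" unfolding B_def using constants by simp
  have \<Phi>: "0 < \<Phi>" unfolding \<Phi>_def using lam by simp
  have \<Phi>p: "\<Phi> powr p = 2 powr p * (2 * ((lam + 1) / lam))"
    unfolding \<Phi>_def using lam p1 by (simp add: powr_powr)
  define c1 where "c1 = C0 powr p'"
  define c2 where "c2 = (C * C1) powr s"
  define c3 where "c3 = ((lam + 1) / lam) powr s"
  define \<theta> where "\<theta> = C1 / (C1 + C2)"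
  have cpos: "0 < c1" "0 < c2" "0 < c3" unfolding c1_def c2_def c3_def using constants lam by auto
  have \<theta>: "0 < \<theta>" "\<theta> \<le> 1" "\<theta> * (C2 / C1) \<le> 1" unfolding \<theta>_def using constants by (auto simp: field_simps)
  have e1: "(C1 / (4 * C0 * (C1 + C2))) powr p' = (1 / 4) powr p' * \<theta> powr p' / c1"
  proof -
    have "C1 / (4 * C0 * (C1 + C2)) = (1 / 4) * \<theta> * (1 / C0)" unfolding \<theta>_def using constants by simp
    then show ?thesis unfolding c1_def using constants \<theta>(1) by (simp add: powr_mult powr_divide)
  qed
  have e2: "(lam * C * C1 / (lam + 1)) powr s = c2 / c3"
  proof -
    have "lam * C * C1 / (lam + 1) = (C * C1) / ((lam + 1) / lam)" using lam by simp
    then show ?thesis unfolding c2_def c3_def using powr_divide[of "C * C1" "(lam + 1) / lam" s] constants lam by (simp only:)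
  qed
  have e3: "(B * \<Phi>) powr p' = (c1 / c2) * (2 powr p' * 2 powr s * c3)"
  proof -
    have "B powr p' = c1 / c2"
    proof -
      have "- (1 / p) * p' = - s" using s(4) by simp
      then have "((C * C1) powr - (1 / p)) powr p' = inverse c2" unfolding c2_def powr_powr by (simp only: powr_minus)
      then show ?thesis unfolding B_def c1_def by (simp add: powr_mult divide_inverse)
    qed
    moreover have "\<Phi> powr p' = 2 powr p' * 2 powr s * c3"
    proof -
      have "\<Phi> powr p' = (2 powr p * (2 * ((lam + 1) / lam))) powr s"
        unfolding \<Phi>_def powr_powr s(4) ..
      also have "\<dots> = 2 powr (p * s) * (2 powr s * c3)"
        unfolding c3_def using lam by (simp only: powr_mult powr_powr)
      finally show ?thesis unfolding s(5) by (simp add: mult.assoc)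
    qed
    ultimately show ?thesis using B \<Phi> by (simp add: powr_mult)
  qed
  have small: "\<sigma> * (B * \<Phi>) powr p' * (C2 / C1) * exp 1 < 1"
  proof -
    have pos: "0 < (B * \<Phi>) powr p' * (C2 / C1) * exp 1" using B \<Phi> constants by simp
    have "\<sigma> * ((B * \<Phi>) powr p' * (C2 / C1) * exp 1) <
        ((p - 1) / (exp 1 * p) * C3 powr (- ((p + 1) / (p - 1))) * ((1 / 4) powr p' * \<theta> powr p' / c1) * (c2 / c3)) *
        ((B * \<Phi>) powr p' * (C2 / C1) * exp 1)"
      using \<sigma>(2) unfolding lam_def[symmetric] p'_def[symmetric] s_def[symmetric] e1 e2
      by (intro mult_strict_right_mono pos)
    also have "\<dots> = ((p - 1) / p) * C3 powr (- ((p + 1) / (p - 1))) * ((1 / 4) powr p' * 2 powr p' * 2 powr s) * (\<theta> powr p' * (C2 / C1))"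
    proof -
      have "(P / (E * Q)) * t * (a * w / k1) * (k2 / k3) * ((k1 / k2 * (b * d * k3)) * G * E) = (P / Q) * t * (a * b * d) * (w * G)"
        if "k1 \<noteq> 0" "k2 \<noteq> 0" "k3 \<noteq> 0" "E \<noteq> 0" for P E Q t a w k1 k2 k3 b d G :: real
        using that by (cases "Q = 0") (simp_all add: field_simps)
      from this[of c1 c2 c3 "exp 1" "p - 1" p] show ?thesis unfolding e3 using cpos by simp
    qed
    \<comment> \<open>The four factors are \<open>(p - 1) / p\<close>, a negative power of
      \<open>C3 > 1\<close>, the powers of 2 and 4, whose product is \<open>1 / 2\<close> because
      \<open>p' = 1 + s\<close>, and \<open>\<theta> powr p' * (C2 / C1)\<close>, at most
      \<open>C2 / (C1 + C2)\<close> because \<open>\<theta> \<le> 1 \<le> p'\<close>.\<close>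
    also have "\<dots> \<le> 1 * 1 * (1 / 2) * 1"
    proof (intro mult_mono)
      show "(p - 1) / p \<le> 1" using p1 by simp
      have "C3 powr (- ((p + 1) / (p - 1))) \<le> C3 powr 0" using constants p1 by (intro powr_mono) auto
      then show "C3 powr (- ((p + 1) / (p - 1))) \<le> 1" using constants by simp
      have "(1 / 4) powr p' * 2 powr p' = (1 / 2 :: real) powr p'" by (simp add: powr_mult[symmetric])
      also have "(1 / 2 :: real) powr p' * 2 powr s = 1 / 2"
        unfolding s(2) by (simp add: powr_add powr_divide)
      finally show "(1 / 4) powr p' * 2 powr p' * 2 powr s \<le> (1 / 2 :: real)" by simp
      have "\<theta> powr p' \<le> \<theta> powr 1" using \<theta> s(3) by (intro powr_mono') auto
      then have "\<theta> powr p' * (C2 / C1) \<le> \<theta> * (C2 / C1)" using constants \<theta> by (intro mult_right_mono) auto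
      then show "\<theta> powr p' * (C2 / C1) \<le> 1" using \<theta>(3) by linarith
    qed (use p1 constants in auto)
    finally have "\<sigma> * ((B * \<Phi>) powr p' * (C2 / C1) * exp 1) < 1" by linarith
    then show ?thesis by (simp only: mult.assoc)
  qed
  \<comment> \<open>The index is a natural number, so \<open>p - 1\<close> is one too and is the
    smallest order from which the moment bound applies.\<close>
  define K where "K = metivier_index X \<Omega> - 1"
  have K: "1 \<le> K" "p - 1 \<le> real K" unfolding K_def p using metivier_ge_2 by auto
  show ?thesis
  proof (rule exponential_moment[OF p1 K B \<Phi> \<sigma>(1) small[unfolded p'_def]])
    fix Ct :: real
    assume Ct: "0 < Ct" "\<And>f F. f \<in> borel_measurable (lebesgue_on \<Omega>) \<Longrightarrow> F \<in> borel_measurable (lebesgue_on \<Omega>) \<Longrightarrow>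
    (\<And>x. 0 \<le> F x) \<Longrightarrow> (\<integral>\<^sup>+x. ennreal (F x powr p) \<partial>lebesgue_on \<Omega>) \<le> ennreal (\<Phi> powr p) \<Longrightarrow>
    (\<And>x. x \<in> space (lebesgue_on \<Omega>) \<Longrightarrow>
      ennreal \<bar>f x\<bar> \<le> ennreal B * (\<integral>\<^sup>+y. ennreal (kernel x y powr ((p - 1) / p) * F y) \<partial>lebesgue_on \<Omega>)) \<Longrightarrow>
    (\<integral>\<^sup>+x. ennreal (exp (\<sigma> * \<bar>f x\<bar> powr (p / (p - 1)))) \<partial>lebesgue_on \<Omega>) \<le> ennreal Ct"
    show thesis
  proof (rule that[OF Ct(1)])
    fix f assume f: "f \<in> test_functions \<Omega>" and le: "(LINT x|lebesgue_on \<Omega>. norm (classical_X X f x) powr p) \<le> 2"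
    define F where "F x = norm (classical_X X f x) + \<bar>f x\<bar>" for x
    have f_meas: "f \<in> borel_measurable (lebesgue_on \<Omega>)"
      by (rule continuous_imp_measurable_on_sets_lebesgue[OF test_continuous[OF f] sets_lebesgue(2)])
    have X_meas: "classical_X X f \<in> borel_measurable (lebesgue_on \<Omega>)"
      by (rule continuous_imp_measurable_on_sets_lebesgue[OF continuous_on_subset[OF classical_X_test(1)[OF f] \<Omega>_sub] sets_lebesgue(2)])
    have F_meas: "F \<in> borel_measurable (lebesgue_on \<Omega>)" unfolding F_def using f_meas X_meas by measurable
    note int = integrable_test_\<Omega>[OF f]
    have "(\<integral>\<^sup>+x. ennreal (F x powr p) \<partial>lebesgue_on \<Omega>) \<le>
        (\<integral>\<^sup>+x. ennreal (2 powr p * (norm (classical_X X f x) powr p + \<bar>f x\<bar> powr p)) \<partial>lebesgue_on \<Omega>)"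
      unfolding F_def by (intro nn_integral_mono ennreal_leI powr_le_two_powr_sum p_pos) auto
    also have "\<dots> = ennreal (LINT x|lebesgue_on \<Omega>. 2 powr p * (norm (classical_X X f x) powr p + \<bar>f x\<bar> powr p))"
      using int by (intro nn_integral_eq_integral) auto
    also have "\<dots> \<le> ennreal (\<Phi> powr p)"
    proof (rule ennreal_leI)
      have "lam * (LINT x|lebesgue_on \<Omega>. \<bar>f x\<bar> powr p) \<le> 2" using lambda1_le[OF f] le unfolding lam_def by linarith
      then have "(LINT x|lebesgue_on \<Omega>. \<bar>f x\<bar> powr p) \<le> 2 / lam" using lam by (simp add: field_simps)
      then have "2 powr p * ((LINT x|lebesgue_on \<Omega>. norm (classical_X X f x) powr p) + (LINT x|lebesgue_on \<Omega>. \<bar>f x\<bar> powr p)) \<le> 2 powr p * (2 + 2 / lam)"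
        using le by (intro mult_left_mono add_mono) auto
      also have "2 + 2 / lam = 2 * ((lam + 1) / lam)" using lam by (simp add: field_simps)
      finally show "(LINT x|lebesgue_on \<Omega>. 2 powr p * (norm (classical_X X f x) powr p + \<bar>f x\<bar> powr p)) \<le> \<Phi> powr p"
        unfolding \<Phi>p using int by simp
    qed
    finally have F_int: "(\<integral>\<^sup>+x. ennreal (F x powr p) \<partial>lebesgue_on \<Omega>) \<le> ennreal (\<Phi> powr p)" .
    show "(\<integral>\<^sup>+x. ennreal (exp (\<sigma> * \<bar>f x\<bar> powr (p / (p - 1)))) \<partial>lebesgue_on \<Omega>) \<le> ennreal Ct"
    proof (rule Ct(2)[OF f_meas F_meas _ F_int])
      show "0 \<le> F x" for x unfolding F_def by simp
      show "ennreal \<bar>f x\<bar> \<le> ennreal B * (\<integral>\<^sup>+y. ennreal (kernel x y powr ((p - 1) / p) * F y) \<partial>lebesgue_on \<Omega>)"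
        if "x \<in> space (lebesgue_on \<Omega>)" for x
        using representation_kernel[OF f, of x] that unfolding F_def B_def by (simp add: space_restrict_space)
    qed
  qed
  qed
qed

text \<open>In \<open>powr_add_le\<close> the choice \<open>(1 + \<delta>) powr p = 3 / 2\<close>
  leaves \<open>1 / 2\<close> for the error term, which tends to 0.\<close>

lemma eventually_energy_le_2:
  assumes u: "u \<in> W1p_zero X U p \<Omega>" and norm: "Lp_norm p \<Omega> (weak_X X U u) \<le> 1"
    and f: "\<And>k::nat. f k \<in> test_functions \<Omega>"
    and lim: "(\<lambda>k. LINT x|lebesgue_on \<Omega>. norm (weak_X X U u x - classical_X X (f k) x) powr p) \<longlonglongrightarrow> 0"
    and int: "\<And>k. integrable (lebesgue_on \<Omega>) (\<lambda>x. norm (weak_X X U u x - classical_X X (f k) x) powr p)"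
  shows "\<forall>\<^sub>F k in sequentially. (LINT x|lebesgue_on \<Omega>. norm (classical_X X (f k) x) powr p) \<le> 2"
proof -
  define A where "A = (LINT x|lebesgue_on \<Omega>. norm (weak_X X U u x) powr p)"
  define b where "b k = (LINT x|lebesgue_on \<Omega>. norm (weak_X X U u x - classical_X X (f k) x) powr p)" for k
  have "0 \<le> A" unfolding A_def by (intro Bochner_Integration.integral_nonneg) simp
  have "A powr (1 / p) \<le> 1" using norm unfolding Lp_norm_def A_def .
  then have "(A powr (1 / p)) powr p \<le> 1 powr p" using p_pos by (intro powr_mono2) auto
  then have A: "A \<le> 1" using \<open>0 \<le> A\<close> p_pos by (simp add: powr_powr)
  define \<delta> where "\<delta> = (3 / 2) powr (1 / p) - 1"
  have "(1::real) powr (1 / p) < (3 / 2) powr (1 / p)" using p_pos by (intro powr_less_mono2) auto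
  then have \<delta>: "0 < \<delta>" unfolding \<delta>_def by simp
  have \<delta>p: "(1 + \<delta>) powr p = 3 / 2" unfolding \<delta>_def using p_pos by (simp add: powr_powr)
  define D where "D = (1 + 1 / \<delta>) powr p"
  have bound: "(LINT x|lebesgue_on \<Omega>. norm (classical_X X (f k) x) powr p) \<le> 3 / 2 + D * b k" for k
  proof -
    have "(LINT x|lebesgue_on \<Omega>. norm (classical_X X (f k) x) powr p) \<le>
        (LINT x|lebesgue_on \<Omega>. 3 / 2 * norm (weak_X X U u x) powr p + D * norm (weak_X X U u x - classical_X X (f k) x) powr p)"
    proof (rule integral_mono)
      fix x
      have "norm (classical_X X (f k) x) \<le> norm (weak_X X U u x) + norm (weak_X X U u x - classical_X X (f k) x)"
        by (metis norm_minus_commute norm_triangle_sub)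
      then have "norm (classical_X X (f k) x) powr p \<le> (norm (weak_X X U u x) + norm (weak_X X U u x - classical_X X (f k) x)) powr p"
        using p_pos by (intro powr_mono2) auto
      also have "\<dots> \<le> 3 / 2 * norm (weak_X X U u x) powr p + D * norm (weak_X X U u x - classical_X X (f k) x) powr p"
        using powr_add_le[OF norm_ge_zero norm_ge_zero \<delta> p_pos] unfolding \<delta>p D_def .
      finally show "norm (classical_X X (f k) x) powr p \<le>
        3 / 2 * norm (weak_X X U u x) powr p + D * norm (weak_X X U u x - classical_X X (f k) x) powr p" .
    qed (use integrable_test_\<Omega>(2)[OF f] W1p_zero_integrable(2)[OF u] int in auto)
    also have "\<dots> = 3 / 2 * A + D * b k"
      using W1p_zero_integrable(2)[OF u] int by (simp add: A_def b_def)
    finally show ?thesis using A by linarith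
  qed
  have "(\<lambda>k. 3 / 2 + D * b k) \<longlonglongrightarrow> 3 / 2 + D * 0"
    using lim unfolding b_def by (intro tendsto_intros)
  then have "\<forall>\<^sub>F k in sequentially. 3 / 2 + D * b k < 2" by (rule order_tendstoD) simp
  then show ?thesis by eventually_elim (use bound in \<open>smt (verit)\<close>)
qed

text \<open>In Fatou's lemma a bound for all large \<open>k\<close> suffices, which is what
  approximation provides. Division by the volume of \<open>\<Omega>\<close>, positive for a nonempty
  open set, brings the constant into the stated form.\<close>

lemma exponential_integral:
  assumes \<sigma>: "0 < \<sigma>"
    "\<sigma> < (p - 1) / (exp 1 * p) * C3 powr (- ((p + 1) / (p - 1))) *
            (C1 / (4 * C0 * (C1 + C2))) powr (p / (p - 1)) *
            (lambda1 X U p \<Omega> * C * C1 / (lambda1 X U p \<Omega> + 1)) powr (1 / (p - 1))"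
  shows "\<exists>Ct>0. \<forall>u\<in>W1p_zero X U p \<Omega>. Lp_norm p \<Omega> (weak_X X U u) \<le> 1 \<longrightarrow>
    (\<integral>\<^sup>+ x. ennreal (exp (\<sigma> * \<bar>u x\<bar> powr (p / (p - 1)))) \<partial>lebesgue_on \<Omega>) \<le> ennreal (Ct * measure lebesgue \<Omega>)"
proof -
  obtain Ct where Ct: "0 < Ct" "\<And>f. f \<in> test_functions \<Omega> \<Longrightarrow>
    (LINT x|lebesgue_on \<Omega>. norm (classical_X X f x) powr p) \<le> 2 \<Longrightarrow>
    (\<integral>\<^sup>+ x. ennreal (exp (\<sigma> * \<bar>f x\<bar> powr (p / (p - 1)))) \<partial>lebesgue_on \<Omega>) \<le> ennreal Ct"
    by (rule exponential_integral_test[OF \<sigma>]) blast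
  have vol: "0 < measure lebesgue \<Omega>"
  proof -
    have "\<not> negligible \<Omega>" using open_not_negligible \<Omega>(1) \<Omega>_nonempty by blast
    then show ?thesis
      using negligible_iff_measure0[OF \<Omega>_lmeasurable] by (simp add: order_less_le)
  qed
  show ?thesis
  proof (intro exI[of _ "Ct / measure lebesgue \<Omega>"] conjI ballI impI)
    show "0 < Ct / measure lebesgue \<Omega>" using Ct(1) vol by simp
    fix u assume u: "u \<in> W1p_zero X U p \<Omega>" and norm: "Lp_norm p \<Omega> (weak_X X U u) \<le> 1"
    obtain f where f: "\<And>k::nat. f k \<in> test_functions \<Omega>"
      "(\<lambda>k. LINT x|lebesgue_on \<Omega>. \<bar>u x - f k x\<bar> powr p) \<longlonglongrightarrow> 0"
      "\<And>k. integrable (lebesgue_on \<Omega>) (\<lambda>x. \<bar>u x - f k x\<bar> powr p)"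
      "(\<lambda>k. LINT x|lebesgue_on \<Omega>. norm (weak_X X U u x - classical_X X (f k) x) powr p) \<longlonglongrightarrow> 0"
      "\<And>k. integrable (lebesgue_on \<Omega>) (\<lambda>x. norm (weak_X X U u x - classical_X X (f k) x) powr p)"
      "AE x in lebesgue_on U. (\<lambda>k. f k x) \<longlonglongrightarrow> u x"
      by (rule W1p_zero_approx[OF u]) (rule that; simp)
    let ?E = "\<lambda>v x. ennreal (exp (\<sigma> * \<bar>v x\<bar> powr (p / (p - 1))))"
    have ev: "\<forall>\<^sub>F k in sequentially. (\<integral>\<^sup>+ x. ?E (f k) x \<partial>lebesgue_on \<Omega>) \<le> ennreal Ct"
      using eventually_energy_le_2[OF u norm f(1,4,5)] by eventually_elim (rule Ct(2)[OF f(1)])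
    have "AE x in lebesgue_on \<Omega>. (\<lambda>k. f k x) \<longlonglongrightarrow> u x"
      by (rule AE_lebesgue_on_mono[OF f(6) sets_lebesgue(2,1) \<Omega>_sub])
    then have ae: "AE x in lebesgue_on \<Omega>. ?E u x = liminf (\<lambda>k. ?E (f k) x)"
    proof eventually_elim
      case (elim x)
      have "(\<lambda>k. exp (\<sigma> * \<bar>f k x\<bar> powr (p / (p - 1)))) \<longlonglongrightarrow> exp (\<sigma> * \<bar>u x\<bar> powr (p / (p - 1)))"
        using p_ge_2 by (intro tendsto_intros tendsto_powr' elim) auto
      then have "(\<lambda>k. ?E (f k) x) \<longlonglongrightarrow> ?E u x" by (rule tendsto_ennrealI)
      then show ?case using lim_imp_Liminf[OF sequentially_bot] by metis
    qed
    have "(\<integral>\<^sup>+ x. ?E u x \<partial>lebesgue_on \<Omega>) = (\<integral>\<^sup>+ x. liminf (\<lambda>k. ?E (f k) x) \<partial>lebesgue_on \<Omega>)"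
      by (rule nn_integral_cong_AE[OF ae])
    also have "\<dots> \<le> liminf (\<lambda>k. \<integral>\<^sup>+ x. ?E (f k) x \<partial>lebesgue_on \<Omega>)"
    proof (rule nn_integral_liminf)
      fix k
      have "f k \<in> borel_measurable (lebesgue_on \<Omega>)"
        by (rule continuous_imp_measurable_on_sets_lebesgue[OF test_continuous[OF f(1)] sets_lebesgue(2)])
      then show "?E (f k) \<in> borel_measurable (lebesgue_on \<Omega>)" by measurable
    qed
    also have "\<dots> \<le> liminf (\<lambda>k::nat. ennreal Ct)" using ev by (rule Liminf_mono)
    also have "\<dots> = ennreal Ct" by (rule Liminf_const) simp
    also have "\<dots> = ennreal (Ct / measure lebesgue \<Omega> * measure lebesgue \<Omega>)" using vol by simp
    finally show "(\<integral>\<^sup>+ x. ?E u x \<partial>lebesgue_on \<Omega>) \<le> ennreal (Ct / measure lebesgue \<Omega> * measure lebesgue \<Omega>)" .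
  qed
qed

end

theorem theorem1p7:
  fixes U \<Omega> :: "(real^'n) set"
    and X :: "'m::finite \<Rightarrow> real^'n \<Rightarrow> real^'n"
    and C C0 C1 C2 C3 \<rho> p :: real
  assumes "2 \<le> CARD('n)"
    and "open U" and "connected U"
    and "\<And>j. smooth_on U (X j)"
    and "hormander_condition X U"
    and "open \<Omega>" and "\<Omega> \<noteq> {}" and "compact (closure \<Omega>)" and "closure \<Omega> \<subseteq> U"
    and "\<And>x r. x \<in> U \<Longrightarrow> 0 < r \<Longrightarrow> emeasure lebesgue (subunit_ball X U x r) < \<infinity>"
    and "volume_constants X U \<Omega> C C1 C2 C3 \<rho>"
    and "representation_constant X U \<Omega> C0"
    and "p = real (metivier_index X \<Omega>)"
  shows "0 < lambda1 X U p \<Omega> \<and>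
    (\<forall>\<sigma>. 0 < \<sigma> \<and>
        \<sigma> < (p - 1) / (exp 1 * p) * C3 powr (- ((p + 1) / (p - 1))) *
            (C1 / (4 * C0 * (C1 + C2))) powr (p / (p - 1)) *
            (lambda1 X U p \<Omega> * C * C1 / (lambda1 X U p \<Omega> + 1)) powr (1 / (p - 1))
      \<longrightarrow> (\<exists>Ct>0. \<forall>u\<in>W1p_zero X U p \<Omega>.
            Lp_norm p \<Omega> (weak_X X U u) \<le> 1 \<longrightarrow>
            (\<integral>\<^sup>+ x. ennreal (exp (\<sigma> * \<bar>u x\<bar> powr (p / (p - 1)))) \<partial>lebesgue_on \<Omega>)
              \<le> ennreal (Ct * measure lebesgue \<Omega>)))"
proof -
  interpret trudinger_domain X U \<Omega> p C C0 C1 C2 C3 \<rho>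
    using assms by unfold_locales auto
  show ?thesis using lambda1_pos exponential_integral by blast
qed

end
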